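(* Let $A_\Gamma$ be an Artin group of almost large type with defining graph $\Gamma$, and let $X_\Gamma$ be the associated flag simplicial complex. Then $X_\Gamma$ is systolic. Hence $A_\Gamma$ acts properly and cocompactly by automorphisms on a systolic complex $X_\Gamma$.
   Context: Artin groups: for a finite simple graph $\Gamma$ with edges labeled by integers $\geqslant 2$, $A_\Gamma$ is generated by the vertices of $\Gamma$ with relations $\underbrace{aba\cdots}_{m}=\underbrace{bab\cdots}_{m}$ for each edge $\{a,b\}$ labeled $m$. It is of almost large type if $\Gamma$ has no triangle (3-cycle) with an edge labeled by two and no square (4-cycle) with three edges labeled by two. Systolic: a graph is $6$-large if no simple cycle of length $4$ or $5$ is a full subgraph. A flag simplicial complex is systolic if it is connected, simply connected, and the link (full subgraph spanned by the neighbours) of each vertex in its $1$-skeleton is $6$-large. The complex $X_\Gamma$. Let $X^*_\Gamma$ be the universal cover of the standard presentation complex of $A_\Gamma$; its vertex set is $A_\Gamma$ (on which $A_\Gamma$ acts by left multiplication), with an edge $g\to gs$ labeled $s$ for each generator $s$. For each edge $e=\{a,b\}$ of $\Gamma$ with label $n$ and each $g\in A_\Gamma$ there is a $2$-cell (precell) $g\Pi_e^*$, whose boundary is the union of the path from $g$ spelling $\underbrace{aba\cdots}_n$ and the path from $g$ spelling $\underbrace{bab\cdots}_n$; both end at $gr$, where $r=\underbrace{aba\cdots}_n$. For $1\leqslant i\leqslant n-1$ let $u_i$ (resp. $d_i$) be the element represented by the alternating word in $a,b$ of length $i$ ending in $a$ (resp. in $b$), and let $l=1$. The boundary paths of $\Pi_e^*$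 have vertices $l,u_1,d_2,u_3,\ldots,r$ and $l,d_1,u_2,d_3,\ldots,r$. Subdivide each precell: add new (interior) vertices $c_1,\ldots,c_{n-2}$, put $c_0=l$, $c_{n-1}=r$, and for each of the two boundary paths $x_0=l,x_1,\ldots,x_n=r$ use the triangles $\{x_k,x_{k+1},c_k\}$ ($1\leqslant k\leqslant n-2$) and $\{x_k,c_{k-1},c_k\}$ ($1\leqslant k\leqslant n-1$). (For $n=2$ this just adds the diagonal from $l$ to $r$.) Do this equivariantly; the result is a simplicial complex $X^{\triangle}_\Gamma$, and the subdivided precells $g\Pi_e$ are called cells. Next, for each edge $e=\{a,b\}$ of $\Gamma$ with label $n\geqslant 3$, each $1\leqslant i\leqslant n-2$ and each $w\in\{u_i,d_i\}$, and each $g\in A_\Gamma$, add an edge between $g c_j\in g\Pi_e$ and $g w^{-1}c_{j+i}\in g w^{-1}\Pi_e$ for $1\leqslant j\leqslant n-2-i$, and an edge between $g c_j\in g\Pi_e$ and $g w^{-1}c_{j+i-1}\in gw^{-1}\Pi_e$ for $1\leqslant j\leqslant n-1-i$. (This is symmetric under exchanging the roles of $a$ and $b$.) $X_\Gamma$ is the flag simplicial complex whose $1$-skeleton is the resulting graph (the $1$-skeleton of $X^\triangle_\Gamma$ together with the added edges). $A_\Gamma$ acts on $X_\Gamma$ by simplicial automorphisms extending its action on $X^{\triangle}_\Gamma$. *)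

theory Defs
  imports "HOL-Analysis.Analysis" "HOL-Algebra.Group_Action"
begin

section \<open>Graphs and cycles\<close>

text \<open>A graph is a vertex set \<open>V\<close> together with a set \<open>E\<close> of two-element subsets of \<open>V\<close>.\<close>

definition simple_graph :: "'v set \<Rightarrow> 'v set set \<Rightarrow> bool" where
  "simple_graph V E \<longleftrightarrow> (\<forall>e\<in>E. e \<subseteq> V \<and> card e = 2)"

definition cycle_edges :: "'v list \<Rightarrow> 'v set set" where
  "cycle_edges cs = {{cs ! i, cs ! (Suc i mod length cs)} | i. i < length cs}"

definition simple_cycle :: "'v set \<Rightarrow> 'v set set \<Rightarrow> 'v list \<Rightarrow> bool" where
  "simple_cycle V E cs \<longleftrightarrow>
     3 \<le> length cs \<and> distinct cs \<and> set cs \<subseteq> V \<and> cycle_edges cs \<subseteq> E"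

definition induced_edges :: "'v set set \<Rightarrow> 'v set \<Rightarrow> 'v set set" where
  "induced_edges E S = {e \<in> E. e \<subseteq> S}"

definition six_large :: "'v set \<Rightarrow> 'v set set \<Rightarrow> bool" where
  "six_large V E \<longleftrightarrow>
     (\<forall>cs. simple_cycle V E cs \<and> length cs \<in> {4, 5} \<longrightarrow>
        induced_edges E (set cs) \<noteq> cycle_edges cs)"

definition neighbours :: "'v set set \<Rightarrow> 'v \<Rightarrow> 'v set" where
  "neighbours E v = {w. w \<noteq> v \<and> {v, w} \<in> E}"


section \<open>Simplicial complexes\<close>

text \<open>Simplices are the finite nonempty vertex sets in \<open>K\<close>; the vertex set is \<open>\<Union>K\<close>.\<close>

definition abstract_complex :: "'v set set \<Rightarrow> bool" where
  "abstract_complex K \<longleftrightarrow>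
     (\<forall>\<sigma>\<in>K. finite \<sigma> \<and> \<sigma> \<noteq> {} \<and> (\<forall>\<tau>. \<tau> \<noteq> {} \<and> \<tau> \<subseteq> \<sigma> \<longrightarrow> \<tau> \<in> K))"

definition skeleton_edges :: "'v set set \<Rightarrow> 'v set set" where
  "skeleton_edges K = {e \<in> K. card e = 2}"

definition flag_complex :: "'v set \<Rightarrow> 'v set set \<Rightarrow> 'v set set" where
  "flag_complex V E =
     {\<sigma>. finite \<sigma> \<and> \<sigma> \<noteq> {} \<and> \<sigma> \<subseteq> V \<and> (\<forall>v\<in>\<sigma>. \<forall>w\<in>\<sigma>. v \<noteq> w \<longrightarrow> {v, w} \<in> E)}"

definition is_flag :: "'v set set \<Rightarrow> bool" where
  "is_flag K \<longleftrightarrow> K = flag_complex (\<Union>K) (skeleton_edges K)"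

text \<open>Points of the geometric realization are given by barycentric coordinates. It carries the
  weak topology: a set is open iff its trace on each closed simplex is open there, where a closed
  simplex has its Euclidean topology (which is the one induced by the product topology on
  functions, as a simplex has only finitely many nonzero coordinates).\<close>

definition closed_simplex :: "'v set \<Rightarrow> ('v \<Rightarrow> real) set" where
  "closed_simplex \<sigma> = {x. (\<forall>v. 0 \<le> x v) \<and> (\<forall>v. v \<notin> \<sigma> \<longrightarrow> x v = 0) \<and> sum x \<sigma> = 1}"

definition realization_points :: "'v set set \<Rightarrow> ('v \<Rightarrow> real) set" where
  "realization_points K = (\<Union>\<sigma>\<in>K. closed_simplex \<sigma>)"

definition realization :: "'v set set \<Rightarrow> ('v \<Rightarrow> real) topology" where
  "realization K = topology (\<lambda>U. U \<subseteq> realization_points K \<and>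
     (\<forall>\<sigma>\<in>K. openin (top_of_set (closed_simplex \<sigma>)) (U \<inter> closed_simplex \<sigma>)))"

lemma openin_realization:
  "openin (realization K) U \<longleftrightarrow> U \<subseteq> realization_points K \<and>
     (\<forall>\<sigma>\<in>K. openin (top_of_set (closed_simplex \<sigma>)) (U \<inter> closed_simplex \<sigma>))"
proof -
  let ?P = "\<lambda>U. U \<subseteq> realization_points K \<and>
     (\<forall>\<sigma>\<in>K. openin (top_of_set (closed_simplex \<sigma>)) (U \<inter> closed_simplex \<sigma>))"
  have "istopology ?P"
    unfolding istopology_def
  proof (rule conjI; intro allI impI)
    fix S T assume S: "?P S" and T: "?P T"
    have "openin (top_of_set (closed_simplex \<sigma>)) (S \<inter> T \<inter> closed_simplex \<sigma>)" if "\<sigma> \<in> K" for \<sigma>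
    proof -
      have "S \<inter> T \<inter> closed_simplex \<sigma> = (S \<inter> closed_simplex \<sigma>) \<inter> (T \<inter> closed_simplex \<sigma>)"
        by blast
      then show ?thesis using S T that by (metis openin_Int)
    qed
    then show "?P (S \<inter> T)" using S by blast
  next
    fix \<U> assume U: "\<forall>U\<in>\<U>. ?P U"
    have "openin (top_of_set (closed_simplex \<sigma>)) (\<Union>\<U> \<inter> closed_simplex \<sigma>)" if "\<sigma> \<in> K" for \<sigma>
    proof -
      have "\<Union>\<U> \<inter> closed_simplex \<sigma> = \<Union>((\<lambda>U. U \<inter> closed_simplex \<sigma>) ` \<U>)" by blast
      then show ?thesis using U that by (metis (no_types, lifting) imageE openin_Union)
    qed
    then show "?P (\<Union>\<U>)" using U by blast
  qed
  then show ?thesis unfolding realization_def by simp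
qed

lemma topspace_realization: "topspace (realization K) = realization_points K"
proof
  show "topspace (realization K) \<subseteq> realization_points K"
    using openin_topspace[of "realization K"] unfolding openin_realization by blast
  have "realization_points K \<inter> closed_simplex \<sigma> = closed_simplex \<sigma>" if "\<sigma> \<in> K" for \<sigma>
    using that unfolding realization_points_def by blast
  then have "openin (realization K) (realization_points K)"
    unfolding openin_realization by simp
  then show "realization_points K \<subseteq> topspace (realization K)"
    by (rule openin_subset)
qed

text \<open>The counterpart of \<^const>\<open>simply_connected\<close> for abstract topologies.\<close>

definition simply_connected_top :: "'a topology \<Rightarrow> bool" where
  "simply_connected_top X \<longleftrightarrow>
     (\<forall>p q. pathin X p \<and> p 1 = p 0 \<and> pathin X q \<and> q 1 = q 0 \<longrightarrow>
        homotopic_with (\<lambda>r. r 1 = r 0) (top_of_set {0..1}) X p q)"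

definition systolic :: "'v set set \<Rightarrow> bool" where
  "systolic K \<longleftrightarrow>
     abstract_complex K \<and> is_flag K \<and>
     connected_space (realization K) \<and> simply_connected_top (realization K) \<and>
     (\<forall>v\<in>\<Union>K. six_large (neighbours (skeleton_edges K) v)
        (induced_edges (skeleton_edges K) (neighbours (skeleton_edges K) v)))"


section \<open>Group actions on simplicial complexes\<close>

definition simplicial_action :: "('g, 'b) monoid_scheme \<Rightarrow> 'v set set \<Rightarrow> ('g \<Rightarrow> 'v \<Rightarrow> 'v) \<Rightarrow> bool" where
  "simplicial_action G K \<phi> \<longleftrightarrow>
     group_action G (\<Union>K) \<phi> \<and> (\<forall>g\<in>carrier G. (\<lambda>\<sigma>. \<phi> g ` \<sigma>) ` K = K)"

text \<open>The map of realizations that extends a vertex map affinely over each simplex.\<close>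

definition affine_extension :: "('v \<Rightarrow> 'w) \<Rightarrow> ('v \<Rightarrow> real) \<Rightarrow> ('w \<Rightarrow> real)" where
  "affine_extension f x = (\<lambda>w. \<Sum>v | x v \<noteq> 0 \<and> f v = w. x v)"

definition proper_action :: "('g, 'b) monoid_scheme \<Rightarrow> 'v set set \<Rightarrow> ('g \<Rightarrow> 'v \<Rightarrow> 'v) \<Rightarrow> bool" where
  "proper_action G K \<phi> \<longleftrightarrow>
     (\<forall>C. compactin (realization K) C \<longrightarrow>
        finite {g \<in> carrier G. affine_extension (\<phi> g) ` C \<inter> C \<noteq> {}})"

definition cocompact_action :: "('g, 'b) monoid_scheme \<Rightarrow> 'v set set \<Rightarrow> ('g \<Rightarrow> 'v \<Rightarrow> 'v) \<Rightarrow> bool" where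
  "cocompact_action G K \<phi> \<longleftrightarrow>
     (\<exists>C. compactin (realization K) C \<and>
        (\<Union>g\<in>carrier G. affine_extension (\<phi> g) ` C) = topspace (realization K))"


section \<open>Group presentations\<close>

text \<open>The letter \<open>(s, True)\<close> stands for the generator \<open>s\<close>, and \<open>(s, False)\<close> for its formal
  inverse. A pair \<open>(l, r) \<in> R\<close> is the relation \<open>l = r\<close>.\<close>

type_synonym 's word = "('s \<times> bool) list"

definition words :: "'s set \<Rightarrow> 's word set" where
  "words S = lists (S \<times> UNIV)"

inductive pres_eq :: "'s set \<Rightarrow> ('s word \<times> 's word) set \<Rightarrow> 's word \<Rightarrow> 's word \<Rightarrow> bool"
  for S R where
  refl: "u \<in> words S \<Longrightarrow> pres_eq S R u u"
| sym: "pres_eq S R u v \<Longrightarrow> pres_eq S R v u"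
| trans: "pres_eq S R u v \<Longrightarrow> pres_eq S R v w \<Longrightarrow> pres_eq S R u w"
| cancel: "u \<in> words S \<Longrightarrow> v \<in> words S \<Longrightarrow> s \<in> S \<Longrightarrow>
    pres_eq S R (u @ [(s, b), (s, \<not> b)] @ v) (u @ v)"
| relation: "u \<in> words S \<Longrightarrow> v \<in> words S \<Longrightarrow> (l, r) \<in> R \<Longrightarrow> l \<in> words S \<Longrightarrow> r \<in> words S \<Longrightarrow>
    pres_eq S R (u @ l @ v) (u @ r @ v)"

definition pres_rel :: "'s set \<Rightarrow> ('s word \<times> 's word) set \<Rightarrow> ('s word \<times> 's word) set" where
  "pres_rel S R = {(u, v). pres_eq S R u v}"

definition presented_group :: "'s set \<Rightarrow> ('s word \<times> 's word) set \<Rightarrow> 's word set monoid" where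
  "presented_group S R =
     \<lparr> carrier = words S // pres_rel S R,
       mult = (\<lambda>A B. \<Union>u\<in>A. \<Union>v\<in>B. pres_rel S R `` {u @ v}),
       one = pres_rel S R `` {[]} \<rparr>"

lemma words_append [simp]: "u @ v \<in> words S \<longleftrightarrow> u \<in> words S \<and> v \<in> words S"
  by (auto simp: words_def)

lemma words_Nil [simp]: "[] \<in> words S"
  by (simp add: words_def)

lemma pres_eq_words: "pres_eq S R u v \<Longrightarrow> u \<in> words S \<and> v \<in> words S"
  by (induction rule: pres_eq.induct) (auto simp: words_def)

lemma equiv_pres_rel: "equiv (words S) (pres_rel S R)"
  by (rule equivI)
    (auto simp: pres_rel_def refl_on_def intro!: symI transI
      dest: pres_eq_words intro: pres_eq.intros)

lemma pres_eq_ctxt: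
  assumes "pres_eq S R u v" "x \<in> words S" "y \<in> words S"
  shows "pres_eq S R (x @ u @ y) (x @ v @ y)"
  using assms
proof (induction rule: pres_eq.induct)
  case (cancel u v s b)
  then show ?case using pres_eq.cancel[of "x @ u" S "v @ y" s R b] by simp
next
  case (relation u v l r)
  then show ?case using pres_eq.relation[of "x @ u" S "v @ y" l r R] by simp
qed (auto intro: pres_eq.intros)

lemma pres_eq_append:
  assumes "pres_eq S R u u'" "pres_eq S R v v'"
  shows "pres_eq S R (u @ v) (u' @ v')"
  using pres_eq_ctxt[OF assms(1), of "[]" v] pres_eq_ctxt[OF assms(2), of u' "[]"]
    pres_eq_words[OF assms(1)] pres_eq_words[OF assms(2)]
  by (auto intro: pres_eq.trans)

lemma presented_group_mult:
  assumes "u \<in> words S" "v \<in> words S"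
  shows "(pres_rel S R `` {u}) \<otimes>\<^bsub>presented_group S R\<^esub> (pres_rel S R `` {v}) =
    pres_rel S R `` {u @ v}"
proof -
  have "congruent2 (pres_rel S R) (pres_rel S R) (\<lambda>u v. pres_rel S R `` {u @ v})"
  proof (rule congruent2I')
    fix x1 x2 y1 y2 assume "(x1, x2) \<in> pres_rel S R" "(y1, y2) \<in> pres_rel S R"
    then have "(x1 @ y1, x2 @ y2) \<in> pres_rel S R"
      by (simp add: pres_rel_def pres_eq_append)
    then show "pres_rel S R `` {x1 @ y1} = pres_rel S R `` {x2 @ y2}"
      by (rule equiv_class_eq[OF equiv_pres_rel])
  qed
  then show ?thesis
    using UN_equiv_class2[OF equiv_pres_rel equiv_pres_rel _ assms]
    by (simp add: presented_group_def)
qed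

lemma pres_eq_inverse:
  "u \<in> words S \<Longrightarrow> pres_eq S R (rev (map (\<lambda>(s, b). (s, \<not> b)) u) @ u) []"
proof (induction u)
  case (Cons x u)
  obtain s b where x: "x = (s, b)" by force
  have s: "s \<in> S" and u: "u \<in> words S" using Cons.prems x by (auto simp: words_def)
  let ?i = "rev (map (\<lambda>(s, b). (s, \<not> b)) u)"
  have "?i \<in> words S" using u by (force simp: words_def)
  then have "pres_eq S R (?i @ [(s, \<not> b), (s, \<not> \<not> b)] @ u) (?i @ u)"
    using s u by (intro pres_eq.cancel)
  then show ?case using Cons.IH[OF u] by (auto simp: x intro: pres_eq.trans)
qed (simp add: pres_eq.refl)

lemma group_presented_group: "group (presented_group S R)"
proof (rule groupI)
  note car = presented_group_def[of S R]
  have rep: "\<exists>u\<in>words S. A = pres_rel S R `` {u}" if "A \<in> carrier (presented_group S R)" for A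
    using that by (auto simp: car elim!: quotientE)
  have cl: "pres_rel S R `` {u} \<in> carrier (presented_group S R)" if "u \<in> words S" for u
    using that by (auto simp: car intro: quotientI)
  have one: "\<one>\<^bsub>presented_group S R\<^esub> = pres_rel S R `` {[]}" by (simp add: car)
  show "\<one>\<^bsub>presented_group S R\<^esub> \<in> carrier (presented_group S R)"
    by (simp add: one cl)
  fix A assume "A \<in> carrier (presented_group S R)"
  then obtain u where u: "u \<in> words S" "A = pres_rel S R `` {u}" using rep by blast
  show "\<one>\<^bsub>presented_group S R\<^esub> \<otimes>\<^bsub>presented_group S R\<^esub> A = A"
    using u by (simp add: one presented_group_mult)
  let ?i = "rev (map (\<lambda>(s, b). (s, \<not> b)) u)"
  have i: "?i \<in> words S" using u by (force simp: words_def)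
  have "pres_rel S R `` {?i @ u} = pres_rel S R `` {[]}"
    by (rule equiv_class_eq[OF equiv_pres_rel]) (simp add: pres_rel_def pres_eq_inverse u)
  then show "\<exists>B\<in>carrier (presented_group S R).
      B \<otimes>\<^bsub>presented_group S R\<^esub> A = \<one>\<^bsub>presented_group S R\<^esub>"
    using i u by (intro bexI[of _ "pres_rel S R `` {?i}"]) (simp_all add: presented_group_mult one cl)
  fix B assume "B \<in> carrier (presented_group S R)"
  then obtain v where v: "v \<in> words S" "B = pres_rel S R `` {v}" using rep by blast
  show "A \<otimes>\<^bsub>presented_group S R\<^esub> B \<in> carrier (presented_group S R)"
    using u v by (simp add: presented_group_mult cl)
  fix C assume "C \<in> carrier (presented_group S R)"
  then obtain w where w: "w \<in> words S" "C = pres_rel S R `` {w}" using rep by blast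
  show "A \<otimes>\<^bsub>presented_group S R\<^esub> B \<otimes>\<^bsub>presented_group S R\<^esub> C =
    A \<otimes>\<^bsub>presented_group S R\<^esub> (B \<otimes>\<^bsub>presented_group S R\<^esub> C)"
    using u v w by (simp add: presented_group_mult)
qed


section \<open>Artin groups\<close>

text \<open>The defining graph is \<open>(V, E)\<close> with \<open>m e\<close> the label of the edge \<open>e\<close>; the values of
  \<open>m\<close> outside \<open>E\<close> are irrelevant.\<close>

definition defining_graph :: "'s set \<Rightarrow> 's set set \<Rightarrow> ('s set \<Rightarrow> nat) \<Rightarrow> bool" where
  "defining_graph V E m \<longleftrightarrow> finite V \<and> simple_graph V E \<and> (\<forall>e\<in>E. 2 \<le> m e)"

definition almost_large_type :: "'s set \<Rightarrow> 's set set \<Rightarrow> ('s set \<Rightarrow> nat) \<Rightarrow> bool" where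
  "almost_large_type V E m \<longleftrightarrow>
     (\<forall>cs. simple_cycle V E cs \<and> length cs = 3 \<longrightarrow> (\<forall>e\<in>cycle_edges cs. m e \<noteq> 2)) \<and>
     (\<forall>cs. simple_cycle V E cs \<and> length cs = 4 \<longrightarrow> card {e \<in> cycle_edges cs. m e = 2} < 3)"

text \<open>\<open>alt a b k\<close> is the word \<open>aba\<dots>\<close> of length \<open>k\<close>; hence \<open>rev (alt a b k)\<close> is the
  alternating word of length \<open>k\<close> that ends in \<open>a\<close>.\<close>

fun alt :: "'s \<Rightarrow> 's \<Rightarrow> nat \<Rightarrow> 's word" where
  "alt a b 0 = []"
| "alt a b (Suc k) = (a, True) # alt b a k"

definition artin_relations :: "'s set set \<Rightarrow> ('s set \<Rightarrow> nat) \<Rightarrow> ('s word \<times> 's word) set" where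
  "artin_relations E m = {(alt a b (m {a, b}), alt b a (m {a, b})) | a b. {a, b} \<in> E}"

definition artin_group :: "'s set \<Rightarrow> 's set set \<Rightarrow> ('s set \<Rightarrow> nat) \<Rightarrow> 's word set monoid" where
  "artin_group V E m = presented_group V (artin_relations E m)"

definition artin_elt :: "'s set \<Rightarrow> 's set set \<Rightarrow> ('s set \<Rightarrow> nat) \<Rightarrow> 's word \<Rightarrow> 's word set" where
  "artin_elt V E m w = pres_rel V (artin_relations E m) `` {w}"


section \<open>The complex of an Artin group\<close>

text \<open>\<open>Elt g\<close> is the vertex \<open>g\<close> of the presentation complex, and \<open>Inner g e j\<close> is the interior
  vertex \<open>g c\<^sub>j\<close> (\<open>1 \<le> j \<le> n - 2\<close>) of the cell \<open>g \<Pi>\<^sub>e\<close>, where \<open>n = m e\<close>. Precells of the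
  universal cover are indexed by pairs \<open>(g, e)\<close>.\<close>

datatype ('g, 's) cell_vertex = Elt 'g | Inner 'g "'s set" nat

type_synonym 's artin_vertex = "('s word set, 's) cell_vertex"

definition artin_vertices :: "'s set \<Rightarrow> 's set set \<Rightarrow> ('s set \<Rightarrow> nat) \<Rightarrow> 's artin_vertex set" where
  "artin_vertices V E m =
     Elt ` carrier (artin_group V E m) \<union>
     {Inner g e j | g e j. g \<in> carrier (artin_group V E m) \<and> e \<in> E \<and> j \<in> {1..m e - 2}}"

text \<open>For \<open>e = {a, b}\<close>: \<open>path_vertex V E m g a b k\<close> is the \<open>k\<close>-th vertex \<open>g x\<^sub>k\<close> on the
  boundary path of \<open>g \<Pi>\<^sub>e\<close> spelling \<open>aba\<dots>\<close>, and \<open>axis_vertex V E m g a b j\<close> is \<open>g c\<^sub>j\<close> for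
  \<open>0 \<le> j \<le> n - 1\<close>, with \<open>c\<^sub>0 = l\<close> and \<open>c\<^bsub>n-1\<^esub> = r\<close>.\<close>

definition path_vertex ::
  "'s set \<Rightarrow> 's set set \<Rightarrow> ('s set \<Rightarrow> nat) \<Rightarrow> 's word set \<Rightarrow> 's \<Rightarrow> 's \<Rightarrow> nat \<Rightarrow> 's artin_vertex" where
  "path_vertex V E m g a b k = Elt (g \<otimes>\<^bsub>artin_group V E m\<^esub> artin_elt V E m (alt a b k))"

definition axis_vertex ::
  "'s set \<Rightarrow> 's set set \<Rightarrow> ('s set \<Rightarrow> nat) \<Rightarrow> 's word set \<Rightarrow> 's \<Rightarrow> 's \<Rightarrow> nat \<Rightarrow> 's artin_vertex" where
  "axis_vertex V E m g a b j =
     (if j = 0 then Elt g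
      else if j = m {a, b} - 1 then path_vertex V E m g a b (m {a, b})
      else Inner g {a, b} j)"

text \<open>As \<open>a\<close> and \<open>b\<close> may be exchanged, both boundary paths of each cell are covered.\<close>

definition cell_triangles :: "'s set \<Rightarrow> 's set set \<Rightarrow> ('s set \<Rightarrow> nat) \<Rightarrow> 's artin_vertex set set" where
  "cell_triangles V E m =
     {{path_vertex V E m g a b k, path_vertex V E m g a b (k + 1), axis_vertex V E m g a b k}
        | g a b k. g \<in> carrier (artin_group V E m) \<and> {a, b} \<in> E \<and> k \<in> {1..m {a, b} - 2}} \<union>
     {{path_vertex V E m g a b k, axis_vertex V E m g a b (k - 1), axis_vertex V E m g a b k}
        | g a b k. g \<in> carrier (artin_group V E m) \<and> {a, b} \<in> E \<and> k \<in> {1..m {a, b} - 1}}"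

text \<open>Edges \<open>g \<rightarrow> g s\<close> of the presentation complex; they are listed separately because of
  the generators \<open>s\<close> that are isolated vertices of the defining graph.\<close>

definition cayley_edges :: "'s set \<Rightarrow> 's set set \<Rightarrow> ('s set \<Rightarrow> nat) \<Rightarrow> 's artin_vertex set set" where
  "cayley_edges V E m =
     {{Elt g, Elt (g \<otimes>\<^bsub>artin_group V E m\<^esub> artin_elt V E m [(s, True)])}
        | g s. g \<in> carrier (artin_group V E m) \<and> s \<in> V}"

definition triangulation_edges ::
  "'s set \<Rightarrow> 's set set \<Rightarrow> ('s set \<Rightarrow> nat) \<Rightarrow> 's artin_vertex set set" where
  "triangulation_edges V E m =
     cayley_edges V E m \<union>
     {{x, y} | x y t. t \<in> cell_triangles V E m \<and> x \<in> t \<and> y \<in> t \<and> x \<noteq> y}"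

text \<open>Here \<open>w\<close> is the element \<open>u\<^sub>i\<close> of the cell; exchanging \<open>a\<close> and \<open>b\<close> gives \<open>d\<^sub>i\<close>.\<close>

definition added_edges :: "'s set \<Rightarrow> 's set set \<Rightarrow> ('s set \<Rightarrow> nat) \<Rightarrow> 's artin_vertex set set" where
  "added_edges V E m =
     {{Inner g {a, b} j, Inner (g \<otimes>\<^bsub>artin_group V E m\<^esub> inv\<^bsub>artin_group V E m\<^esub> w) {a, b} (j + i)}
        | g a b i j w. g \<in> carrier (artin_group V E m) \<and> {a, b} \<in> E \<and> 3 \<le> m {a, b} \<and>
            i \<in> {1..m {a, b} - 2} \<and> w = artin_elt V E m (rev (alt a b i)) \<and>
            j \<in> {1..m {a, b} - 2 - i}} \<union>
     {{Inner g {a, b} j, Inner (g \<otimes>\<^bsub>artin_group V E m\<^esub> inv\<^bsub>artin_group V E m\<^esub> w) {a, b} (j + i - 1)}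
        | g a b i j w. g \<in> carrier (artin_group V E m) \<and> {a, b} \<in> E \<and> 3 \<le> m {a, b} \<and>
            i \<in> {1..m {a, b} - 2} \<and> w = artin_elt V E m (rev (alt a b i)) \<and>
            j \<in> {1..m {a, b} - 1 - i}}"

definition artin_complex :: "'s set \<Rightarrow> 's set set \<Rightarrow> ('s set \<Rightarrow> nat) \<Rightarrow> 's artin_vertex set set" where
  "artin_complex V E m =
     flag_complex (artin_vertices V E m) (triangulation_edges V E m \<union> added_edges V E m)"

definition artin_action ::
  "'s set \<Rightarrow> 's set set \<Rightarrow> ('s set \<Rightarrow> nat) \<Rightarrow> 's word set \<Rightarrow> 's artin_vertex \<Rightarrow> 's artin_vertex" where
  "artin_action V E m g = restrict
     (\<lambda>x. case x of
        Elt h \<Rightarrow> Elt (g \<otimes>\<^bsub>artin_group V E m\<^esub> h)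
      | Inner h e j \<Rightarrow> Inner (g \<otimes>\<^bsub>artin_group V E m\<^esub> h) e j)
     (artin_vertices V E m)"

end

theory Submission
  imports Defs
begin

text \<open>
  Artin relations are homogeneous, so word length gives a homomorphism \<open>ell\<close> from the Artin group to
  the integers, and the geometric representation of the Coxeter group shows that a two-generator
  standard subgroup is as large as it should be: its \<open>2 n\<close> alternating elements of length at most
  \<open>n\<close> stay distinct. For an edge of the defining graph with label \<open>n\<close> and Garside element \<open>D\<close>, sending the
  vertex \<open>h c\<^sub>j\<close> to \<open>h D\<^bsup>-(ell h + j)\<^esup>\<close> turns adjacency between vertices of its cells into adjacency in a
  Cayley graph with respect to the alternating elements and their inverses. The part of a vertex link
  coming from one edge is therefore a hexagon whose vertices are thickened to cliques, hence
  \<open>6\<close>-large. The link of a group element is a union of such pieces, two of which meet in vertices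
  \<open>s\<^sup>+\<close> and \<open>s\<^sup>-\<close> only; a short full cycle through several pieces would project to a triangle or a
  square of the defining graph with too many labels equal to two.

  For simple connectivity, loops are approximated by edge loops. Each vertex gets a canonical edge
  path from the identity. For every edge, the canonical path to one end followed by the edge is
  combinatorially homotopic to the canonical path to the other end, because the two halves of each
  cell boundary are homotopic through the triangulated cell; so every edge loop contracts.

  The action is free on vertices, with finitely many orbits of vertices and edges.
\<close>

section \<open>The Coxeter group and positive words\<close>

text \<open>A group element is the left end of one spine and the right end of another. The power of
  \<open>D\<close> in \<open>kap\<close> is the one for which both readings agree and a step along a
  spine becomes division by \<open>D\<close>. The alternating elements and their inverses are stable
  under conjugation by \<open>D\<close>, so adjacency can be read relative to any vertex, and
  interior vertices need no separate analysis within a block. No normal form in the Artin group is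
  used: the length leaves a single candidate for a quotient of two alternating elements, up to the
  first letter, and the action on the integers modulo \<open>2 n\<close> refutes it. Intersections
  of parabolic subgroups enter only for elements of length one and two, where one coordinate in the
  reflection representation decides. In the hexagon the cliques have nested neighbourhoods, so
  consecutive vertices of a short full cycle change corner. The vertices \<open>s\<close> with
  either sign occupy opposite corners, at distance three; since any two vertices of a cycle of
  length at most five are at distance at most two, the block changes of such a cycle belong to
  different generators. That is what turns it into a genuine cycle of the defining graph.\<close>

locale artin_graph =
  fixes V :: "'s set" and E :: "'s set set" and m :: "'s set \<Rightarrow> nat"
  assumes defining_graph: "defining_graph V E m"
begin

lemma finite_V: "finite V"
  and edge_V: "{a, b} \<in> E \<Longrightarrow> a \<in> V \<and> b \<in> V"
  and edge_neq: "{a, b} \<in> E \<Longrightarrow> a \<noteq> b"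
  and edge_label: "e \<in> E \<Longrightarrow> 2 \<le> m e"
  using defining_graph by (auto simp: defining_graph_def simple_graph_def)

lemma edge_obtain:
  assumes "e \<in> E" obtains a b where "e = {a, b}" "a \<noteq> b" "a \<in> V" "b \<in> V"
  using assms defining_graph by (metis card_2_iff defining_graph_def edge_V simple_graph_def)

abbreviation weq :: "'s word \<Rightarrow> 's word \<Rightarrow> bool" where
  "weq \<equiv> pres_eq V (artin_relations E m)"

end

definition word_exponent :: "'s word \<Rightarrow> int" where
  "word_exponent u = (\<Sum>p\<leftarrow>u. if snd p then 1 else -1)"

lemma word_exponent_simps [simp]:
  "word_exponent [] = 0"
  "word_exponent (p # u) = (if snd p then 1 else -1) + word_exponent u"
  "word_exponent (u @ v) = word_exponent u + word_exponent v"
  by (simp_all add: word_exponent_def)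

lemma word_exponent_alt [simp]: "word_exponent (alt a b k) = int k"
  by (induction a b k rule: alt.induct) auto

lemma word_exponent_rev [simp]: "word_exponent (rev u) = word_exponent u"
  by (induction u) auto

lemma (in artin_graph) weq_exponent: "weq u v \<Longrightarrow> word_exponent u = word_exponent v"
  by (induction rule: pres_eq.induct) (auto simp: artin_relations_def)

section \<open>Alternating words and the infinite dihedral group\<close>

fun alternating :: "bool \<Rightarrow> nat \<Rightarrow> bool list" where
  "alternating x 0 = []"
| "alternating x (Suc k) = x # alternating (\<not> x) k"

lemma length_alternating [simp]: "length (alternating x k) = k"
  by (induction x k rule: alternating.induct) auto

lemma alternating_Suc_end: "alternating x (Suc k) = alternating x k @ [if even k then x else \<not> x]"
  by (induction x k rule: alternating.induct) auto

lemma alternating_add: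
  "alternating x (k + l) = alternating x k @ alternating (if even k then x else \<not> x) l"
  by (induction x k rule: alternating.induct) auto

lemma rev_alternating: "rev (alternating x k) = alternating (if even k then \<not> x else x) k"
proof (induction k)
  case (Suc k)
  have "rev (alternating x (Suc k)) = (if even k then x else \<not> x) # rev (alternating x k)"
    unfolding alternating_Suc_end by simp
  then show ?case unfolding Suc by simp
qed simp

lemma alternating_rev: "alternating x k = rev (alternating (if even k then \<not> x else x) k)"
  by (simp add: rev_alternating)

text \<open>The infinite dihedral group acts on the integers so that its two standard generators are the
  involutions exchanging \<open>2k\<close> with \<open>2k + 1\<close>, respectively \<open>2k\<close> with \<open>2k - 1\<close>.\<close>

definition flip :: "bool \<Rightarrow> int \<Rightarrow> int" where
  "flip x k = (if even k = x then k + 1 else k - 1)"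

text \<open>\<open>foldr\<close> lets the last letter of the list act first, here \<open>x\<close>.
  Every further letter of an alternating word moves the point on in the same direction, and the
  parity of \<open>j\<close> against \<open>x\<close> decides which direction that is.\<close>

lemma foldr_flip_rev_alternating:
  "foldr flip (rev (alternating x k)) j = (if even j = x then j + int k else j - int k)"
proof (induction x k arbitrary: j rule: alternating.induct)
  case (2 x k)
  then show ?case by (auto simp: flip_def)
qed auto

lemma foldr_flip_near: "\<bar>foldr flip u j - j\<bar> \<le> int (length u)"
  by (induction u) (auto simp: flip_def)

lemma even_foldr_flip: "even (foldr flip u j) \<longleftrightarrow> even (j + int (length u))"
  by (induction u) (auto simp: flip_def)

definition letter :: "'s \<Rightarrow> 's \<Rightarrow> bool \<Rightarrow> 's \<times> bool" where
  "letter a b x = (if x then a else b, True)"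

lemma map_letter_alternating:
  "map (letter a b) (alternating x k) = (if x then alt a b k else alt b a k)"
  by (induction x k rule: alternating.induct) (auto simp: letter_def)

lemma word_exponent_map_letter [simp]: "word_exponent (map (letter a b) u) = int (length u)"
  by (induction u) (auto simp: letter_def)

section \<open>The reflection representation of the Coxeter group\<close>

context artin_graph
begin

text \<open>Minus twice the off-diagonal entry of the cosine form of the Coxeter group. A pair that
  is not an edge imposes no relation, so the value there is free; with 0 the two reflections
  commute.\<close>

definition bond :: "'s \<Rightarrow> 's \<Rightarrow> real" where
  "bond s t = (if {s, t} \<in> E then 2 * cos (pi / real (m {s, t})) else 0)"

definition reflect :: "'s \<Rightarrow> ('s \<Rightarrow> real) \<Rightarrow> ('s \<Rightarrow> real)" where
  "reflect s x = x(s := - x s + (\<Sum>t\<in>V - {s}. bond s t * x t))"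

text \<open>The letters act by the reflections of the geometric representation of the Coxeter group.\<close>

fun wact :: "'s word \<Rightarrow> ('s \<Rightarrow> real) \<Rightarrow> ('s \<Rightarrow> real)" where
  "wact [] x = x"
| "wact (p # u) x = reflect (fst p) (wact u x)"

lemma wact_append: "wact (u @ v) x = wact u (wact v x)"
  by (induction u) auto

lemma reflect_reflect [simp]: "reflect s (reflect s x) = x"
proof -
  have "(\<Sum>t\<in>V - {s}. bond s t * reflect s x t) = (\<Sum>t\<in>V - {s}. bond s t * x t)"
    by (rule sum.cong) (auto simp: reflect_def)
  then show ?thesis unfolding reflect_def[of s "reflect s x"] by (auto simp: reflect_def fun_eq_iff)
qed

lemma wact_rev [simp]: "wact (rev u) (wact u x) = x"
  by (induction u) (auto simp: wact_append)

lemma wact_outside: "t \<notin> fst ` set u \<Longrightarrow> wact u x t = x t"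
  by (induction u) (auto simp: reflect_def)

lemma bond_commute: "bond s t = bond t s"
  by (simp add: bond_def insert_commute)

text \<open>A window of width two sliding along a bi-infinite sequence \<open>f\<close>: the entry
  with even index is shown in coordinate \<open>a\<close>, the one with odd index in coordinate
  \<open>b\<close>, both measured from the centre \<open>(u, v)\<close>.\<close>

definition plane_point ::
  "'s \<Rightarrow> 's \<Rightarrow> ('s \<Rightarrow> real) \<Rightarrow> real \<Rightarrow> real \<Rightarrow> (int \<Rightarrow> real) \<Rightarrow> int \<Rightarrow> ('s \<Rightarrow> real)" where
  "plane_point a b x u v f k =
     x(a := u + f (if even k then k else k + 1), b := v + f (if even k then k + 1 else k))"

definition rest_sum :: "'s \<Rightarrow> 's \<Rightarrow> ('s \<Rightarrow> real) \<Rightarrow> 's \<Rightarrow> real" where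
  "rest_sum a b x s = (\<Sum>t\<in>V - {a, b}. bond s t * x t)"

lemma sum_split_pair:
  assumes "a \<in> V" "b \<in> V" "a \<noteq> b"
  shows "(\<Sum>t\<in>V - {a}. bond a t * x t) = bond a b * x b + rest_sum a b x a"
    and "(\<Sum>t\<in>V - {b}. bond b t * x t) = bond a b * x a + rest_sum a b x b"
proof -
  have "(\<Sum>t\<in>insert b (V - {a, b}). bond a t * x t) = bond a b * x b + rest_sum a b x a"
    "(\<Sum>t\<in>insert a (V - {a, b}). bond b t * x t) = bond a b * x a + rest_sum a b x b"
    using finite_V by (simp_all add: rest_sum_def bond_commute[of b a])
  moreover have "insert b (V - {a, b}) = V - {a}" "insert a (V - {a, b}) = V - {b}"
    using assms by auto
  ultimately show "(\<Sum>t\<in>V - {a}. bond a t * x t) = bond a b * x b + rest_sum a b x a"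
    and "(\<Sum>t\<in>V - {b}. bond b t * x t) = bond a b * x a + rest_sum a b x b"
    by simp_all
qed

text \<open>The assumptions on \<open>u\<close> and \<open>v\<close> say that the centre is fixed by
  both reflections while the other coordinates, collected in \<open>rest_sum\<close>, are frozen.
  Relative to the centre only the recurrence is left: a reflection replaces one entry of the window
  by the next or the previous one of the sequence, and \<open>flip\<close> records the direction of
  the slide.\<close>

lemma reflect_plane_point:
  assumes ab: "a \<in> V" "b \<in> V" "a \<noteq> b"
    and u: "2 * u = bond a b * v + rest_sum a b x a"
    and v: "2 * v = bond a b * u + rest_sum a b x b"
    and f: "\<And>k. f (k + 2) = bond a b * f (k + 1) - f k"
  shows "reflect (if z then a else b) (plane_point a b x u v f k) = plane_point a b x u v f (flip z k)"
proof -
  have r: "rest_sum a b (plane_point a b x u v f k) s = rest_sum a b x s" for s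
    unfolding rest_sum_def plane_point_def by (rule sum.cong) auto
  have f1: "f (k + 1) = bond a b * f k - f (k - 1)" using f[of "k - 1"] by (simp add: algebra_simps)
  have f3: "f (k - 1 + 1) = f k" by simp
  note f2 = f[of k]
  have ra: "reflect a (plane_point a b x u v f k) = plane_point a b x u v f (flip True k)"
    unfolding reflect_def sum_split_pair(1)[OF ab] r using ab u v f1 f2
    by (auto simp: plane_point_def flip_def fun_eq_iff algebra_simps)
  have rb: "reflect b (plane_point a b x u v f k) = plane_point a b x u v f (flip False k)"
    unfolding reflect_def sum_split_pair(2)[OF ab] r using ab u v f1 f2
    by (auto simp: plane_point_def flip_def fun_eq_iff algebra_simps)
  show ?thesis using ra rb by simp
qed

lemma wact_plane_point:
  assumes ab: "a \<in> V" "b \<in> V" "a \<noteq> b"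
    and u: "2 * u = bond a b * v + rest_sum a b x a"
    and v: "2 * v = bond a b * u + rest_sum a b x b"
    and f: "\<And>k. f (k + 2) = bond a b * f (k + 1) - f k"
  shows "wact (map (letter a b) w) (plane_point a b x u v f k) = plane_point a b x u v f (foldr flip w k)"
proof (induction w)
  case (Cons z w)
  then show ?case using reflect_plane_point[OF assms] by (simp add: letter_def)
qed simp

lemma sin_recurrence:
  fixes \<theta> :: real and k :: int
  shows "sin (\<phi> + real_of_int (k + 2) * \<theta>) = 2 * cos \<theta> * sin (\<phi> + real_of_int (k + 1) * \<theta>) - sin (\<phi> + real_of_int k * \<theta>)"
proof -
  define t where "t = \<phi> + real_of_int (k + 1) * \<theta>"
  have "\<phi> + real_of_int (k + 2) * \<theta> = t + \<theta>" "\<phi> + real_of_int k * \<theta> = t - \<theta>"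
    by (auto simp: t_def algebra_simps)
  then show ?thesis unfolding t_def[symmetric] by (simp add: sin_add sin_diff)
qed

lemma sin_label_pos: "{a, b} \<in> E \<Longrightarrow> 0 < sin (pi / real (m {a, b}))"
  using edge_label[of "{a, b}"] by (intro sin_gt_zero) (auto simp: field_simps)

text \<open>Every vector is a window on a sequence of period \<open>2 n\<close>. The two alternating
  words of length \<open>n\<close> slide it by \<open>n\<close> and by \<open>- n\<close>, which is
  the same position.\<close>

lemma wact_relation:
  assumes e: "{a, b} \<in> E"
  shows "wact (alt a b (m {a, b})) x = wact (alt b a (m {a, b})) x"
proof -
  define n where "n = m {a, b}"
  define \<theta> where "\<theta> = pi / real n"
  define c where "c = bond a b"
  define p where "p = rest_sum a b x a"
  define q where "q = rest_sum a b x b"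
  have n: "n \<ge> 2" using edge_label[OF e] n_def by auto
  have ab: "a \<in> V" "b \<in> V" "a \<noteq> b" using edge_V[OF e] edge_neq[OF e] by auto
  have c: "c = 2 * cos \<theta>" by (simp add: c_def bond_def e \<theta>_def n_def)
  have s0: "sin \<theta> \<noteq> 0" using sin_label_pos[OF e] by (simp add: \<theta>_def n_def)
  \<comment> \<open>This is the determinant of the linear system for the centre
    \<open>(u, v)\<close>; it is nonzero because the sine is.\<close>
  have "4 - c\<^sup>2 = 4 * (sin \<theta>)\<^sup>2" by (simp add: c power2_eq_square sin_squared_eq algebra_simps flip: power2_eq_square)
  then have d0: "4 - c\<^sup>2 \<noteq> 0" using s0 by simp
  define u where "u = (2 * p + c * q) / (4 - c\<^sup>2)"
  define v where "v = (2 * q + c * p) / (4 - c\<^sup>2)"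
  have u: "2 * u = c * v + p" and v: "2 * v = c * u + q"
    using d0 by (simp_all add: u_def v_def field_simps power2_eq_square)
  define y where "y = (x a - u) / sin \<theta>"
  define z where "z = (x b - v) / sin \<theta>"
  \<comment> \<open>The first summand vanishes at 1 and the second at 0, so both initial values can
    be prescribed independently.\<close>
  define f where "f k = y * sin (\<theta> + real_of_int k * (- \<theta>)) + z * sin (0 + real_of_int k * \<theta>)" for k
  have rec: "f (k + 2) = c * f (k + 1) - f k" for k
    unfolding f_def sin_recurrence c by (simp add: algebra_simps)
  have f0: "f 0 = x a - u" and f1: "f 1 = x b - v" using s0 by (simp_all add: f_def y_def z_def)
  have n\<theta>: "real n * \<theta> = pi" using n by (simp add: \<theta>_def)
  have per: "f (k + 2 * int n) = f k" for k
  proof -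
    have 1: "\<theta> + real_of_int (k + 2 * int n) * (- \<theta>) = (\<theta> + real_of_int k * (- \<theta>)) - 2 * pi"
      "0 + real_of_int (k + 2 * int n) * \<theta> = (0 + real_of_int k * \<theta>) + 2 * pi"
      using n\<theta> by (simp_all add: algebra_simps)
    have "sin (t - 2 * pi) = sin t" for t :: real by (simp add: sin_diff)
    then show ?thesis unfolding f_def 1 sin_periodic by simp
  qed
  have start: "x = plane_point a b x u v f 0"
    by (simp add: plane_point_def f0 f1)
  have act: "wact (map (letter a b) w) x = plane_point a b x u v f (foldr flip w 0)" for w
    using wact_plane_point[OF ab, of u v x f w 0] u v rec start
    by (simp add: c_def p_def q_def)
  have eq: "plane_point a b x u v f (int n) = plane_point a b x u v f (- int n)"
    using per[of "- int n"] per[of "- int n + 1"] by (auto simp: plane_point_def algebra_simps)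
  have "wact (map (letter a b) (alternating z n)) x = plane_point a b x u v f (int n)" for z
    unfolding act using eq by (subst alternating_rev) (auto simp: foldr_flip_rev_alternating)
  from this[of True] this[of False] show ?thesis
    by (simp add: map_letter_alternating n_def)
qed

lemma weq_wact: "weq u v \<Longrightarrow> wact u x = wact v x"
proof (induction arbitrary: x rule: pres_eq.induct)
  case (relation u v l r)
  then obtain a b where "{a, b} \<in> E" "l = alt a b (m {a, b})" "r = alt b a (m {a, b})"
    by (auto simp: artin_relations_def)
  then have "wact l y = wact r y" for y using wact_relation by blast
  then show ?case by (simp add: wact_append)
qed (auto simp: wact_append)

lemma wact_rev_cong:
  assumes "\<And>x. wact u x = wact v x"
  shows "wact (rev u) x = wact (rev v) x"
  by (metis assms wact_rev rev_rev_ident)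

text \<open>For the sequence of sines of the multiples of pi over \<open>n\<close>, two consecutive
  entries determine the angle, hence the position modulo \<open>2 n\<close>. Equal lengths give both
  positions the same parity, so that entries shown in the same coordinates are compared.\<close>

lemma wact_detect:
  assumes e: "{a, b} \<in> E" and len: "length u = length v"
    and eq: "\<And>x. wact (map (letter a b) u) x = wact (map (letter a b) v) x"
  shows "2 * int (m {a, b}) dvd foldr flip u 0 - foldr flip v 0"
proof -
  define n where "n = m {a, b}"
  define \<theta> where "\<theta> = pi / real n"
  define k where "k = foldr flip u 0"
  define l where "l = foldr flip v 0"
  have n: "n \<ge> 2" using edge_label[OF e] n_def by auto
  have ab: "a \<in> V" "b \<in> V" "a \<noteq> b" using edge_V[OF e] edge_neq[OF e] by auto
  have c: "bond a b = 2 * cos \<theta>" by (simp add: bond_def e \<theta>_def n_def)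
  have s0: "sin \<theta> \<noteq> 0" using sin_label_pos[OF e] by (simp add: \<theta>_def n_def)
  define f where "f j = sin (0 + real_of_int j * \<theta>)" for j
  have rec: "f (j + 2) = bond a b * f (j + 1) - f j" for j
    unfolding f_def sin_recurrence c by simp
  have act: "wact (map (letter a b) w) (plane_point a b (\<lambda>_. 0) 0 0 f 0)
      = plane_point a b (\<lambda>_. 0) 0 0 f (foldr flip w 0)" for w
    using wact_plane_point[OF ab, of 0 0 "\<lambda>_. 0" f w 0] rec by (simp add: rest_sum_def)
  have pp: "plane_point a b (\<lambda>_. 0) 0 0 f k = plane_point a b (\<lambda>_. 0) 0 0 f l"
    using eq act by (metis k_def l_def)
  have par: "even k = even l" by (simp add: k_def l_def even_foldr_flip len)
  have "f k = f l \<and> f (k + 1) = f (l + 1)"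
    using fun_cong[OF pp, of a] fun_cong[OF pp, of b] ab par
    by (auto simp: plane_point_def split: if_splits)
  then have s: "sin (real_of_int k * \<theta>) = sin (real_of_int l * \<theta>)"
    and "sin (real_of_int k * \<theta> + \<theta>) = sin (real_of_int l * \<theta> + \<theta>)"
    by (simp_all add: f_def algebra_simps)
  then have "cos (real_of_int k * \<theta>) = cos (real_of_int l * \<theta>)"
    using s0 by (simp add: sin_add)
  with s obtain j :: int where "real_of_int k * \<theta> = real_of_int l * \<theta> + 2 * pi * real_of_int j"
    by (metis sin_cos_eq_iff)
  then have "pi * real_of_int k = pi * (real_of_int l + 2 * real n * real_of_int j)"
    using n by (simp add: \<theta>_def field_simps)
  then have "real_of_int k = real_of_int (l + 2 * int n * j)"
    unfolding mult_cancel_left by simp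
  then have "k = l + 2 * int n * j"
    unfolding of_int_eq_iff .
  then show ?thesis by (simp add: k_def l_def n_def)
qed

text \<open>Letters act as involutions, so reversing a word inverts its action and the test can be
  read from either end. The reversed form lets the first letters act first, the plain form the last
  ones; a known prefix or a known suffix can thus be evaluated before an unknown rest.\<close>

lemma weq_detect:
  assumes "{a, b} \<in> E" "weq (map (letter a b) u) (map (letter a b) v)"
  shows "2 * int (m {a, b}) dvd foldr flip u 0 - foldr flip v 0"
    and "2 * int (m {a, b}) dvd foldr flip (rev u) 0 - foldr flip (rev v) 0"
proof -
  have len: "length u = length v" using weq_exponent[OF assms(2)] by simp
  show "2 * int (m {a, b}) dvd foldr flip u 0 - foldr flip v 0"
    using wact_detect[OF assms(1) len] weq_wact[OF assms(2)] by blast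
  have "wact (rev (map (letter a b) u)) x = wact (rev (map (letter a b) v)) x" for x
    by (rule wact_rev_cong) (rule weq_wact[OF assms(2)])
  then show "2 * int (m {a, b}) dvd foldr flip (rev u) 0 - foldr flip (rev v) 0"
    using wact_detect[OF assms(1), of "rev u" "rev v"] len by (simp add: rev_map)
qed

lemma wact_single_diag: "wact [(s, c)] (\<lambda>t. if t = s then 1 else 0) s = -1"
proof -
  have "(\<Sum>t\<in>V - {s}. bond s t * (if t = s then 1 else 0)) = 0" by (rule sum.neutral) auto
  then show ?thesis by (simp add: reflect_def)
qed

text \<open>A letter other than \<open>s\<close> never changes coordinate \<open>s\<close>, whereas
  the reflection at \<open>s\<close> negates the basis vector of \<open>s\<close>.\<close>

lemma weq_letter_support:
  assumes "weq u [(s, c)]" shows "s \<in> fst ` set u"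
proof (rule ccontr)
  assume "s \<notin> fst ` set u"
  then have "wact u (\<lambda>t. if t = s then 1 else 0) s = 1" by (simp add: wact_outside)
  then show False by (simp only: weq_wact[OF assms] wact_single_diag)
qed

text \<open>The letter that acts first is detected as in the case of one letter, because the other
  one leaves its coordinate alone. For the letter that acts last, pass to the inverse
  action.\<close>

lemma weq_pair_support:
  assumes eq: "weq u [(s, c), (t, d)]" and "s \<noteq> t" shows "s \<in> fst ` set u" "t \<in> fst ` set u"
proof -
  have *: "t \<in> fst ` set u" if eq: "\<And>x. wact u x = wact [(s, c), (t, d)] x" and st: "s \<noteq> t" for u s t c d
  proof (rule ccontr)
    assume "t \<notin> fst ` set u"
    then have "wact u (\<lambda>r. if r = t then 1 else 0) t = 1" by (simp add: wact_outside)
    moreover have "wact [(s, c), (t, d)] x t = wact [(t, d)] x t" for x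
      using st by (simp add: reflect_def)
    ultimately show False by (simp only: eq wact_single_diag)
  qed
  show "t \<in> fst ` set u" using * weq_wact[OF eq] \<open>s \<noteq> t\<close> by blast
  have "wact (rev u) x = wact (rev [(s, c), (t, d)]) x" for x
    using wact_rev_cong weq_wact[OF eq] by blast
  then show "s \<in> fst ` set u" using *[of "rev u" t d s c] \<open>s \<noteq> t\<close> by simp
qed

end

section \<open>Dihedral pairs\<close>

text \<open>A code \<open>(g, x, k)\<close> with \<open>1 \<le> k \<le> n\<close> stands for the alternating element of length \<open>k\<close>
  starting with the letter \<open>x\<close> if \<open>g\<close> holds, and for the inverse of the one ending with \<open>x\<close>
  otherwise; for \<open>k = n\<close> the letter \<open>x\<close> is irrelevant. The relation below is that of a hexagon whose
  vertices are thickened to cliques.\<close>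

fun code_adj :: "nat \<Rightarrow> bool \<times> bool \<times> nat \<Rightarrow> bool \<times> bool \<times> nat \<Rightarrow> bool" where
  "code_adj n (g, x, k) (g', x', k') \<longleftrightarrow>
     (if g = g' then k \<noteq> k' \<and> (x = x' \<or> k = n \<or> k' = n) else x \<noteq> x' \<and> k + k' \<le> n)"

fun code_eq :: "nat \<Rightarrow> bool \<times> bool \<times> nat \<Rightarrow> bool \<times> bool \<times> nat \<Rightarrow> bool" where
  "code_eq n (g, x, k) (g', x', k') \<longleftrightarrow> g = g' \<and> k = k' \<and> (x = x' \<or> k = n)"

definition valid_code :: "nat \<Rightarrow> bool \<times> bool \<times> nat \<Rightarrow> bool" where
  "valid_code n c \<longleftrightarrow> 1 \<le> snd (snd c) \<and> snd (snd c) \<le> n"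

definition hexagon_step :: "nat \<Rightarrow> nat \<Rightarrow> bool" where
  "hexagon_step p q \<longleftrightarrow> (p, q) \<in> {(0, 1), (1, 2), (2, 3), (3, 4), (4, 5), (5, 0)}"

text \<open>Corners in cyclic order: 0 is the Garside element, 1 and 5 are the shorter positive
  elements sorted by first letter, 3 is the inverse of the Garside element, 2 and 4 are the shorter
  inverses. The neighbouring corners 1 and 2, and likewise 4 and 5, carry different letters: only
  then can a quotient be one longer alternating word.\<close>

fun hexagon_pos :: "nat \<Rightarrow> bool \<times> bool \<times> nat \<Rightarrow> nat" where
  "hexagon_pos n (g, x, k) =
     (if g then (if k = n then 0 else if x then 1 else 5) else (if k = n then 3 else if x then 4 else 2))"

lemma code_adj_sym: "code_adj n c d \<Longrightarrow> code_adj n d c"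
  by (cases c; cases d) (auto split: if_splits)

lemma code_eq_sym: "code_eq n c d \<Longrightarrow> code_eq n d c"
  by (cases c; cases d) auto

lemma code_adj_pos:
  assumes "code_adj n c d" "valid_code n c" "valid_code n d"
  shows "hexagon_pos n c = hexagon_pos n d \<or> hexagon_step (hexagon_pos n c) (hexagon_pos n d) \<or>
    hexagon_step (hexagon_pos n d) (hexagon_pos n c)"
  using assms by (cases c; cases d) (auto simp: hexagon_step_def valid_code_def split: if_splits)

lemma same_pos:
  assumes "hexagon_pos n c = hexagon_pos n d" shows "code_adj n c d \<or> code_eq n c d"
  using assms by (cases c; cases d) (auto split: if_splits)

lemma hexagon_pos_eqD:
  "hexagon_pos n (g, x, k) = hexagon_pos n (h, y, l) \<Longrightarrow> g = h \<and> (k = n \<longleftrightarrow> l = n) \<and> (k = n \<or> x = y)"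
  by (auto split: if_splits)

text \<open>Inside one corner the shorter code dominates: the bound on the sum of lengths for
  neighbours of the other sign only gets weaker, and neighbours of the same sign are decided by the
  letter, up to equality.\<close>

lemma nested_neighbours:
  assumes pos: "hexagon_pos n c = hexagon_pos n d" and le: "snd (snd d) \<le> snd (snd c)"
    and adj: "code_adj n c e" and valid: "valid_code n e"
  shows "code_adj n d e \<or> code_eq n d e"
proof -
  obtain g x k h y l f z r where c: "c = (g, x, k)" "d = (h, y, l)" "e = (f, z, r)"
    by (metis surj_pair)
  have *: "g = h" "k = n \<longleftrightarrow> l = n" "k = n \<or> x = y" using hexagon_pos_eqD pos unfolding c by blast+
  have r: "1 \<le> r" "l \<le> k" using valid le by (simp_all add: c valid_code_def)
  show ?thesis
  proof (cases "f = g")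
    case True
    then have "x = z \<or> k = n \<or> r = n" using adj by (simp add: c)
    then have "y = z \<or> l = n \<or> r = n" using * by blast
    then show ?thesis using True * by (cases "r = l") (auto simp: c)
  next
    case False
    then have "x \<noteq> z" "k + r \<le> n" using adj by (auto simp: c split: if_splits)
    then have "y \<noteq> z" "l + r \<le> n" using * r by auto
    then show ?thesis using False * by (auto simp: c)
  qed
qed

text \<open>If the two middle vertices of an induced path shared a corner, the shorter one would
  also be joined to the outer neighbour of the longer one, and that is a chord.\<close>

lemma induced_path_pos:
  assumes "code_adj n b c" "code_adj n c d" "code_adj n d e" "\<not> code_adj n b d" "\<not> code_adj n c e"
    "\<not> code_eq n b d" "\<not> code_eq n c e"
    "valid_code n b" "valid_code n e"
  shows "hexagon_pos n c \<noteq> hexagon_pos n d"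
proof
  assume *: "hexagon_pos n c = hexagon_pos n d"
  show False
  proof (cases "snd (snd d) \<le> snd (snd c)")
    case True
    have "code_adj n d b \<or> code_eq n d b"
      by (rule nested_neighbours[OF * True code_adj_sym[OF assms(1)] assms(8)])
    then show False using assms(4,6) code_adj_sym code_eq_sym by blast
  next
    case False
    then have "code_adj n c e \<or> code_eq n c e"
      by (intro nested_neighbours[OF *[symmetric] _ assms(3) assms(9)]) simp
    then show False using assms(5,7) by blast
  qed
qed

lemma hexagon_no_square:
  assumes "hexagon_step p q \<or> hexagon_step q p" "hexagon_step q r \<or> hexagon_step r q"
    "hexagon_step r s \<or> hexagon_step s r" "hexagon_step s p \<or> hexagon_step p s" "p \<noteq> r" "q \<noteq> s"
  shows False
proof -
  have "hexagon_step p q \<longleftrightarrow> p < 6 \<and> q = (if p = 5 then 0 else p + 1)" for p q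
    by (auto simp: hexagon_step_def)
  then show False using assms by (elim disjE) (simp_all split: if_splits)
qed

lemma no_induced_code_square:
  assumes valid: "valid_code n c0" "valid_code n c1" "valid_code n c2" "valid_code n c3"
    and adj: "code_adj n c0 c1" "code_adj n c1 c2" "code_adj n c2 c3" "code_adj n c3 c0"
    and nadj: "\<not> code_adj n c0 c2" "\<not> code_adj n c1 c3"
    and neq: "\<not> code_eq n c0 c2" "\<not> code_eq n c1 c3"
  shows False
proof -
  have nadj': "\<not> code_adj n c2 c0" "\<not> code_adj n c3 c1" "\<not> code_eq n c2 c0" "\<not> code_eq n c3 c1"
    using nadj neq code_adj_sym code_eq_sym by blast+
  let ?p = "hexagon_pos n"
  have "?p c0 \<noteq> ?p c2" "?p c1 \<noteq> ?p c3" using same_pos nadj neq by blast+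
  moreover have "?p c0 \<noteq> ?p c1" by (rule induced_path_pos[of n c3 c0 c1 c2]) (use assms nadj' in auto)
  moreover have "?p c1 \<noteq> ?p c2" by (rule induced_path_pos[of n c0 c1 c2 c3]) (use assms nadj' in auto)
  moreover have "?p c2 \<noteq> ?p c3" by (rule induced_path_pos[of n c1 c2 c3 c0]) (use assms nadj' in auto)
  moreover have "?p c3 \<noteq> ?p c0" by (rule induced_path_pos[of n c2 c3 c0 c1]) (use assms nadj' in auto)
  ultimately show False
    using hexagon_no_square[of "?p c0" "?p c1" "?p c2" "?p c3"]
      adj[THEN code_adj_pos] valid by metis
qed

text \<open>Each of the five edges moves to an adjacent corner, so the parity of the corner would
  alternate around an odd cycle.\<close>

lemma no_induced_code_pentagon:
  assumes valid: "valid_code n c0" "valid_code n c1" "valid_code n c2" "valid_code n c3" "valid_code n c4"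
    and adj: "code_adj n c0 c1" "code_adj n c1 c2" "code_adj n c2 c3" "code_adj n c3 c4" "code_adj n c4 c0"
    and nadj: "\<not> code_adj n c0 c2" "\<not> code_adj n c1 c3" "\<not> code_adj n c2 c4" "\<not> code_adj n c3 c0"
      "\<not> code_adj n c4 c1"
    and neq: "\<not> code_eq n c0 c2" "\<not> code_eq n c1 c3" "\<not> code_eq n c2 c4" "\<not> code_eq n c3 c0"
      "\<not> code_eq n c4 c1"
  shows False
proof -
  let ?p = "hexagon_pos n"
  have step: "hexagon_step (?p c) (?p d) \<or> hexagon_step (?p d) (?p c)"
    if "code_adj n b c" "code_adj n c d" "code_adj n d e" "\<not> code_adj n b d" "\<not> code_adj n c e"
    "\<not> code_eq n b d" "\<not> code_eq n c e"
    "valid_code n b" "valid_code n e" "valid_code n c" "valid_code n d" for b c d e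
    using induced_path_pos[OF that(1-9)] code_adj_pos[OF that(2) that(10,11)] by blast
  have odd_step: "odd q \<noteq> odd r" if "hexagon_step q r \<or> hexagon_step r q" for q r
    using that by (auto simp: hexagon_step_def)
  have "odd (?p c0) \<noteq> odd (?p c1)" by (rule odd_step, rule step[of c4 c0 c1 c2]) (use assms in auto)
  moreover have "odd (?p c1) \<noteq> odd (?p c2)" by (rule odd_step, rule step[of c0 c1 c2 c3]) (use assms in auto)
  moreover have "odd (?p c2) \<noteq> odd (?p c3)" by (rule odd_step, rule step[of c1 c2 c3 c4]) (use assms in auto)
  moreover have "odd (?p c3) \<noteq> odd (?p c4)" by (rule odd_step, rule step[of c2 c3 c4 c0]) (use assms in auto)
  moreover have "odd (?p c4) \<noteq> odd (?p c0)" by (rule odd_step, rule step[of c3 c4 c0 c1]) (use assms in auto)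
  ultimately show False by blast
qed

section \<open>Alternating elements of a group generated by a dihedral pair\<close>

definition pair_eval :: "('g, 'b) monoid_scheme \<Rightarrow> 'g \<Rightarrow> 'g \<Rightarrow> bool list \<Rightarrow> 'g" where
  "pair_eval G a b u = foldr (\<lambda>x g. (if x then a else b) \<otimes>\<^bsub>G\<^esub> g) u \<one>\<^bsub>G\<^esub>"

text \<open>The test by \<open>detect\<close> works in one direction only: it shows that two
  products differ, which is what non-adjacency requires. Adjacency itself always comes from
  \<open>pair_relation\<close> by multiplying words.\<close>

locale dihedral_pair = group G for G (structure) +
  fixes a b :: 'a and n :: nat and ell :: "'a \<Rightarrow> int"
  assumes a_closed [simp]: "a \<in> carrier G" and b_closed [simp]: "b \<in> carrier G" and n_ge_2: "2 \<le> n"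
    and ell_mult: "x \<in> carrier G \<Longrightarrow> y \<in> carrier G \<Longrightarrow> ell (x \<otimes> y) = ell x + ell y"
    and ell_a: "ell a = 1" and ell_b: "ell b = 1"
    and pair_relation: "pair_eval G a b (alternating True n) = pair_eval G a b (alternating False n)"
    and detect: "pair_eval G a b u = pair_eval G a b v \<Longrightarrow> 2 * int n dvd foldr flip u 0 - foldr flip v 0"
    and detect_rev: "pair_eval G a b u = pair_eval G a b v \<Longrightarrow>
      2 * int n dvd foldr flip (rev u) 0 - foldr flip (rev v) 0"
begin

abbreviation ev where "ev \<equiv> pair_eval G a b"

definition lt :: "bool \<Rightarrow> 'a" where "lt x = (if x then a else b)"

lemma lt_closed [simp]: "lt x \<in> carrier G" by (simp add: lt_def)

lemma ev_Nil [simp]: "ev [] = \<one>" and ev_Cons [simp]: "ev (x # u) = lt x \<otimes> ev u"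
  by (simp_all add: pair_eval_def lt_def)

lemma ev_closed [simp]: "ev u \<in> carrier G" by (induction u) auto

lemma ev_append: "ev (u @ v) = ev u \<otimes> ev v" by (induction u) (auto simp: m_assoc)

lemma ell_one [simp]: "ell \<one> = 0" using ell_mult[of \<one> \<one>] by simp

lemma ell_inv: "x \<in> carrier G \<Longrightarrow> ell (inv x) = - ell x"
  using ell_mult[of x "inv x"] by simp

lemma ell_ev [simp]: "ell (ev u) = int (length u)"
  by (induction u) (auto simp: ell_mult lt_def ell_a ell_b)

text \<open>\<open>sim x k\<close> begins with \<open>x\<close>, whereas \<open>sir x k\<close> ends
  with it. Both name the same family of elements; the two notations serve products that extend a
  word on the right and on the left.\<close>

definition sim :: "bool \<Rightarrow> nat \<Rightarrow> 'a" where "sim x k = ev (alternating x k)"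
definition sir :: "bool \<Rightarrow> nat \<Rightarrow> 'a" where "sir x k = ev (rev (alternating x k))"

definition D :: 'a where "D = ev (alternating True n)"

lemma D_closed [simp]: "D \<in> carrier G" and ell_D [simp]: "ell D = int n"
  by (simp_all add: D_def)

lemma sim_closed [simp]: "sim x k \<in> carrier G" and sir_closed [simp]: "sir x k \<in> carrier G"
  and ell_sim [simp]: "ell (sim x k) = int k" and ell_sir [simp]: "ell (sir x k) = int k"
  by (simp_all add: sim_def sir_def)

lemma sim_0 [simp]: "sim x 0 = \<one>" and sir_0 [simp]: "sir x 0 = \<one>"
  by (simp_all add: sim_def sir_def)

lemma sim_n: "sim x n = D" using pair_relation by (cases x) (auto simp: sim_def D_def)

lemma sir_sim: "sir x k = sim (if even k then \<not> x else x) k"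
  by (simp add: sim_def sir_def rev_alternating)

lemma sim_sir: "sim x k = sir (if even k then \<not> x else x) k"
  by (simp add: sir_sim)

lemma sir_n: "sir x n = D" by (simp add: sir_sim sim_n)

lemma sim_add: "sim x (k + l) = sim x k \<otimes> sim (if even k then x else \<not> x) l"
  by (simp add: sim_def alternating_add ev_append)

lemma sir_sim_mult: "x \<noteq> x' \<Longrightarrow> sir x k \<otimes> sim x' l = sim (if even k then \<not> x else x) (k + l)"
  by (auto simp: sim_add sir_sim)

lemma sir_add: "sir x (k + l) = sir (if even k then x else \<not> x) l \<otimes> sir x k"
  by (simp add: sir_def alternating_add ev_append)

lemma lt_sim: "lt x \<otimes> sim (\<not> x) k = sim x (Suc k)" by (simp add: sim_def)
lemma sir_lt: "sir (\<not> x) k \<otimes> lt x = sir x (Suc k)" by (simp add: sir_def ev_append)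

lemma sim_Suc: "sim x (Suc k) = sim x k \<otimes> lt (if even k then x else \<not> x)"
  unfolding sim_def alternating_Suc_end ev_append by simp

definition simples :: "'a set" where "simples = {sim x k | x k. 1 \<le> k \<and> k \<le> n}"
definition S :: "'a set" where "S = simples \<union> m_inv G ` simples"

lemma simples_closed: "s \<in> simples \<Longrightarrow> s \<in> carrier G"
  and S_closed: "s \<in> S \<Longrightarrow> s \<in> carrier G"
  by (auto simp: simples_def S_def)

lemma sim_simples: "1 \<le> k \<Longrightarrow> k \<le> n \<Longrightarrow> sim x k \<in> simples" by (auto simp: simples_def)
lemma sir_simples: "1 \<le> k \<Longrightarrow> k \<le> n \<Longrightarrow> sir x k \<in> simples" by (simp add: sir_sim sim_simples)

lemma S_inv: "s \<in> S \<Longrightarrow> inv s \<in> S"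
  using simples_closed by (auto simp: S_def)

lemma S_inv_iff: "s \<in> carrier G \<Longrightarrow> inv s \<in> S \<longleftrightarrow> s \<in> S"
  using S_inv inv_inv by metis

lemma S_sym: "x \<in> carrier G \<Longrightarrow> y \<in> carrier G \<Longrightarrow> inv x \<otimes> y \<in> S \<longleftrightarrow> inv y \<otimes> x \<in> S"
  using S_inv_iff[of "inv x \<otimes> y"] by (simp add: inv_mult_group)

lemma S_ell: "s \<in> S \<Longrightarrow> ell s \<noteq> 0 \<and> \<bar>ell s\<bar> \<le> int n"
  by (auto simp: S_def simples_def ell_inv)

lemma S_pos: "s \<in> S \<Longrightarrow> ell s = int q \<Longrightarrow> \<exists>z. s = sim z q \<and> q \<le> n"
  by (auto simp: S_def simples_def ell_inv)

text \<open>In both cases the letter of the code is the first letter of the element up to sign,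
  since the inverse of a word ending in \<open>x\<close> begins with the inverse of
  \<open>x\<close>.\<close>

definition cel :: "bool \<Rightarrow> bool \<Rightarrow> nat \<Rightarrow> 'a" where
  "cel g x k = (if g then sim x k else inv (sir x k))"

lemma cel_closed [simp]: "cel g x k \<in> carrier G" by (simp add: cel_def)

lemma S_code:
  assumes "s \<in> S" obtains g x k where "s = cel g x k" "1 \<le> k" "k \<le> n"
proof -
  from assms consider x k where "s = sim x k" "1 \<le> k" "k \<le> n" | x k where "s = inv (sim x k)" "1 \<le> k" "k \<le> n"
    by (auto simp: S_def simples_def)
  then show ?thesis
  proof cases
    case 1 then show ?thesis using that[of True] by (simp add: cel_def)
  next
    case 2 then show ?thesis using that[of False] by (simp add: cel_def sim_sir)
  qed
qed

lemma small_multiple: "2 * int n dvd t \<Longrightarrow> \<bar>t\<bar> < 2 * int n \<Longrightarrow> t = 0"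
  using dvd_imp_le_int[of t "2 * int n"] by auto

lemma no_small_multiple:
  "2 * int n dvd t - c \<Longrightarrow> t \<noteq> c \<Longrightarrow> \<bar>t - c\<bar> < 2 * int n \<Longrightarrow> False"
  using small_multiple by fastforce

text \<open>By its length the quotient would be positive, so \<open>sim x k\<close> would be a left
  factor of \<open>sim (\<not> x) k'\<close>. On the integers the prefix runs to distance
  \<open>k\<close> on one side of 0, the other word to distance \<open>k'\<close> on the other side,
  and \<open>k' - k\<close> further letters leave a gap between \<open>2 k\<close> and
  \<open>2 k'\<close>. This is no multiple of \<open>2 n\<close>.\<close>

lemma sim_cross_nonadj:
  assumes "1 \<le> k" "k < k'" "k' < n"
  shows "inv (sim x k) \<otimes> sim (\<not> x) k' \<notin> S"
proof
  assume "inv (sim x k) \<otimes> sim (\<not> x) k' \<in> S"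
  then obtain z where "inv (sim x k) \<otimes> sim (\<not> x) k' = sim z (k' - k)"
    using S_pos[of "inv (sim x k) \<otimes> sim (\<not> x) k'" "k' - k"] assms by (simp add: ell_mult ell_inv of_nat_diff) blast
  then have "sim x k \<otimes> sim z (k' - k) = sim (\<not> x) k'"
    using inv_solve_left[of "sim z (k' - k)" "sim x k" "sim (\<not> x) k'"] by simp
  then have "ev (alternating x k @ alternating z (k' - k)) = ev (alternating (\<not> x) k')"
    by (simp add: sim_def ev_append)
  from detect_rev[OF this]
  have d: "2 * int n dvd foldr flip (rev (alternating z (k' - k))) (if x then int k else - int k)
      - (if x then - int k' else int k')"
    by (cases x) (simp_all add: foldr_flip_rev_alternating)
  have "\<bar>foldr flip (rev (alternating z (k' - k))) (if x then int k else - int k)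
      - (if x then int k else - int k)\<bar> \<le> int k' - int k"
    using foldr_flip_near[of "rev (alternating z (k' - k))" "if x then int k else - int k"] assms
    by (simp only: length_rev length_alternating of_nat_diff)
  then show False
    using assms by (intro no_small_multiple[OF d]; cases x; simp only: if_True if_False; arith)
qed

lemma sir_cross_nonadj:
  assumes "1 \<le> k'" "k' < k" "k < n"
  shows "sir x k \<otimes> inv (sir (\<not> x) k') \<notin> S"
proof
  assume "sir x k \<otimes> inv (sir (\<not> x) k') \<in> S"
  then obtain z where "sir x k \<otimes> inv (sir (\<not> x) k') = sim z (k - k')"
    using S_pos[of "sir x k \<otimes> inv (sir (\<not> x) k')" "k - k'"] assms by (simp add: ell_mult ell_inv of_nat_diff) blast
  then have "sir x k = sim z (k - k') \<otimes> sir (\<not> x) k'"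
    using inv_solve_right[of "sim z (k - k')" "sir x k" "sir (\<not> x) k'"] by simp
  then have "ev (rev (alternating x k)) = ev (alternating z (k - k') @ rev (alternating (\<not> x) k'))"
    by (simp add: sim_def sir_def ev_append)
  from detect[OF this]
  have d: "2 * int n dvd (if x then int k else - int k)
      - foldr flip (alternating z (k - k')) (if x then - int k' else int k')"
    by (cases x) (simp_all add: foldr_flip_rev_alternating)
  have "\<bar>foldr flip (alternating z (k - k')) (if x then - int k' else int k')
      - (if x then - int k' else int k')\<bar> \<le> int k - int k'"
    using foldr_flip_near[of "alternating z (k - k')" "if x then - int k' else int k'"] assms
    by (simp only: length_rev length_alternating of_nat_diff)
  then show False
    using assms by (intro no_small_multiple[OF d]; cases x; simp only: if_True if_False; arith)
qed

lemma flip_flip [simp]: "flip x (flip x y) = y" by (auto simp: flip_def)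

text \<open>The two factors meet in the same letter \<open>x\<close>, whose two occurrences cancel
  on the integers. The product moves 0 by at most \<open>k + k' - 2\<close>, an alternating word of
  the same length by exactly \<open>k + k'\<close>, so the results differ by a positive number below
  \<open>2 n\<close>.\<close>

lemma sir_sim_nonadj:
  assumes "1 \<le> k" "1 \<le> k'" "k + k' \<le> n"
  shows "sir x k' \<otimes> sim x k \<notin> S"
proof
  assume "sir x k' \<otimes> sim x k \<in> S"
  then obtain z where z: "sir x k' \<otimes> sim x k = sim z (k + k')"
    using S_pos[of "sir x k' \<otimes> sim x k" "k + k'"] by (simp add: ell_mult) blast
  obtain i j where ij: "k = Suc i" "k' = Suc j" using assms by (metis Suc_le_D One_nat_def)
  have "ev (rev (alternating x k') @ alternating x k) = ev (rev (alternating (if even (k + k') then \<not> z else z) (k + k')))"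
    using z by (simp add: sim_def sir_def ev_append rev_alternating)
  from detect[OF this]
  have d: "2 * int n dvd foldr flip (rev (alternating (\<not> x) j)) (foldr flip (alternating (\<not> x) i) 0)
      - foldr flip (rev (alternating (if even (k + k') then \<not> z else z) (k + k'))) 0"
    by (simp add: ij)
  define w where "w = (if even (k + k') then \<not> z else z)"
  have "\<bar>foldr flip (rev (alternating (\<not> x) j)) (foldr flip (alternating (\<not> x) i) 0)\<bar> \<le> int i + int j"
    using foldr_flip_near[of "rev (alternating (\<not> x) j)" "foldr flip (alternating (\<not> x) i) 0"]
      foldr_flip_near[of "alternating (\<not> x) i" 0] by simp
  moreover have d': "2 * int n dvd foldr flip (rev (alternating (\<not> x) j)) (foldr flip (alternating (\<not> x) i) 0)
      - (if w then int (k + k') else - int (k + k'))"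
    using d unfolding w_def[symmetric] foldr_flip_rev_alternating by (cases w) simp_all
  ultimately show False
    using assms unfolding ij
    by (intro no_small_multiple[OF d'[unfolded ij]]; cases w; simp only: if_True if_False; arith)
qed

lemma not_S_ell: "ell s = 0 \<or> \<bar>ell s\<bar> > int n \<Longrightarrow> s \<notin> S"
  using S_ell by force

lemma sim_adj_less:
  assumes "1 \<le> k" "k < k'" "k' \<le> n"
  shows "inv (sim x k) \<otimes> sim x' k' \<in> S \<longleftrightarrow> x = x' \<or> k' = n"
proof -
  have "inv (sim x k) \<otimes> sim x k' \<in> S" for x
  proof -
    have "sim x k' = sim x k \<otimes> sim (if even k then x else \<not> x) (k' - k)"
      using sim_add[of x k "k' - k"] assms by simp
    then have "inv (sim x k) \<otimes> sim x k' = sim (if even k then x else \<not> x) (k' - k)"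
      using inv_solve_left'[of "sim (if even k then x else \<not> x) (k' - k)" "sim x k" "sim x k'"] by simp
    then show ?thesis using sim_simples[of "k' - k"] assms by (auto simp: S_def)
  qed
  note same = this
  show ?thesis
  proof (cases "k' = n")
    case True
    have "sim x' k' = sim x k'" unfolding True by (simp only: sim_n sir_n)
    with same[of x] True show ?thesis by simp
  next
    case False
    show ?thesis
    proof (cases "x = x'")
      case True then show ?thesis using same[of x] by simp
    next
      case neq: False
      then have "x' = (\<not> x)" by blast
      then show ?thesis using sim_cross_nonadj[of k k' x] False assms by simp
    qed
  qed
qed

lemma sir_adj_less:
  assumes "1 \<le> k'" "k' < k" "k \<le> n"
  shows "sir x k \<otimes> inv (sir x' k') \<in> S \<longleftrightarrow> x = x' \<or> k = n"
proof -
  have "sir x k \<otimes> inv (sir x k') \<in> S" for x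
  proof -
    have "sir x k = sir (if even k' then x else \<not> x) (k - k') \<otimes> sir x k'"
      using sir_add[of x k' "k - k'"] assms by simp
    then have "sir x k \<otimes> inv (sir x k') = sir (if even k' then x else \<not> x) (k - k')"
      by (simp add: m_assoc)
    then show ?thesis using sir_simples[of "k - k'"] assms by (auto simp: S_def)
  qed
  note same = this
  show ?thesis
  proof (cases "k = n")
    case True
    have "sir x' k = sir x k" unfolding True by (simp only: sim_n sir_n)
    with same[of x'] True show ?thesis by simp
  next
    case False
    show ?thesis
    proof (cases "x = x'")
      case True then show ?thesis using same[of x] by simp
    next
      case neq: False
      then have "x' = (\<not> x)" by blast
      then show ?thesis using sir_cross_nonadj[of k' k x] False assms by simp
    qed
  qed
qed

lemma opposite_adj:
  assumes "1 \<le> k" "1 \<le> k'"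
  shows "sir x k \<otimes> sim x' k' \<in> S \<longleftrightarrow> x \<noteq> x' \<and> k + k' \<le> n"
proof (cases "k + k' \<le> n")
  case True
  then show ?thesis
    using sir_sim_nonadj[of k' k x] sir_sim_mult[of x x' k k'] sim_simples[of "k + k'"] assms
    by (auto simp: S_def)
next
  case False
  then have "sir x k \<otimes> sim x' k' \<notin> S" by (intro not_S_ell) (simp add: ell_mult)
  with False show ?thesis by simp
qed

text \<open>After this translation of the Cayley graph into the relation on codes, the search for
  short full cycles is purely combinatorial.\<close>

lemma cel_adj:
  assumes k: "1 \<le> k" "k \<le> n" and k': "1 \<le> k'" "k' \<le> n"
  shows "inv (cel g x k) \<otimes> cel g' x' k' \<in> S \<longleftrightarrow> code_adj n (g, x, k) (g', x', k')"
proof -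
  have pos: "inv (sim x k) \<otimes> sim x' k' \<in> S \<longleftrightarrow> code_adj n (True, x, k) (True, x', k')"
  proof (cases k k' rule: linorder_cases)
    case equal then show ?thesis by (auto intro!: not_S_ell simp: ell_mult ell_inv)
  next
    case less then show ?thesis using sim_adj_less[of k k' x x'] k k' by auto
  next
    case greater
    then show ?thesis using sim_adj_less[of k' k x' x] k k' S_sym[of "sim x k" "sim x' k'"] by auto
  qed
  have neg: "sir x k \<otimes> inv (sir x' k') \<in> S \<longleftrightarrow> code_adj n (False, x, k) (False, x', k')"
  proof (cases k k' rule: linorder_cases)
    case equal then show ?thesis by (auto intro!: not_S_ell simp: ell_mult ell_inv)
  next
    case greater then show ?thesis using sir_adj_less[of k' k x x'] k k' by auto
  next
    case less
    then show ?thesis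
      using sir_adj_less[of k k' x' x] k k' S_sym[of "inv (sir x k)" "inv (sir x' k')"] by auto
  qed
  have mix: "sir x k \<otimes> sim x' k' \<in> S \<longleftrightarrow> code_adj n (False, x, k) (True, x', k')"
    using opposite_adj k k' by auto
  have mix': "inv (sim x k) \<otimes> inv (sir x' k') \<in> S \<longleftrightarrow> code_adj n (True, x, k) (False, x', k')"
    using opposite_adj[of k' k x' x] k k' S_inv_iff[of "sir x' k' \<otimes> sim x k"]
    by (auto simp: inv_mult_group)
  show ?thesis using pos neg mix mix' by (cases g; cases g') (simp_all add: cel_def del: code_adj.simps)
qed

lemma cel_eq: "code_eq n (g, x, k) (g', x', k') \<Longrightarrow> cel g x k = cel g' x' k'"
  by (auto simp: cel_def sim_n sir_n)

definition adjS :: "'a \<Rightarrow> 'a \<Rightarrow> bool" where "adjS s t \<longleftrightarrow> inv s \<otimes> t \<in> S"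

lemma adjS_sym: "x \<in> carrier G \<Longrightarrow> y \<in> carrier G \<Longrightarrow> adjS x y \<longleftrightarrow> adjS y x"
  using S_sym by (simp add: adjS_def)

lemma no_induced_square:
  assumes S: "s0 \<in> S" "s1 \<in> S" "s2 \<in> S" "s3 \<in> S"
    and adj: "adjS s0 s1" "adjS s1 s2" "adjS s2 s3" "adjS s3 s0"
    and nadj: "\<not> adjS s0 s2" "\<not> adjS s1 s3" and neq: "s0 \<noteq> s2" "s1 \<noteq> s3"
  shows False
proof -
  obtain g0 x0 k0 where 0: "s0 = cel g0 x0 k0" "1 \<le> k0" "k0 \<le> n" using S(1) by (rule S_code)
  obtain g1 x1 k1 where 1: "s1 = cel g1 x1 k1" "1 \<le> k1" "k1 \<le> n" using S(2) by (rule S_code)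
  obtain g2 x2 k2 where 2: "s2 = cel g2 x2 k2" "1 \<le> k2" "k2 \<le> n" using S(3) by (rule S_code)
  obtain g3 x3 k3 where 3: "s3 = cel g3 x3 k3" "1 \<le> k3" "k3 \<le> n" using S(4) by (rule S_code)
  have v: "valid_code n (g0, x0, k0)" "valid_code n (g1, x1, k1)" "valid_code n (g2, x2, k2)" "valid_code n (g3, x3, k3)"
    using 0 1 2 3 by (simp_all add: valid_code_def)
  have ne: "\<not> code_eq n (g0, x0, k0) (g2, x2, k2)" "\<not> code_eq n (g1, x1, k1) (g3, x3, k3)"
    using neq 0 1 2 3 cel_eq by blast+
  show ?thesis
    by (rule no_induced_code_square[OF v _ _ _ _ _ _ ne])
      (use adj nadj in \<open>simp_all only: adjS_def 0 1 2 3 cel_adj not_False_eq_True\<close>)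
qed

lemma no_induced_pentagon:
  assumes S: "s0 \<in> S" "s1 \<in> S" "s2 \<in> S" "s3 \<in> S" "s4 \<in> S"
    and adj: "adjS s0 s1" "adjS s1 s2" "adjS s2 s3" "adjS s3 s4" "adjS s4 s0"
    and nadj: "\<not> adjS s0 s2" "\<not> adjS s1 s3" "\<not> adjS s2 s4" "\<not> adjS s3 s0" "\<not> adjS s4 s1"
    and neq: "s0 \<noteq> s2" "s1 \<noteq> s3" "s2 \<noteq> s4" "s3 \<noteq> s0" "s4 \<noteq> s1"
  shows False
proof -
  obtain g0 x0 k0 where 0: "s0 = cel g0 x0 k0" "1 \<le> k0" "k0 \<le> n" using S(1) by (rule S_code)
  obtain g1 x1 k1 where 1: "s1 = cel g1 x1 k1" "1 \<le> k1" "k1 \<le> n" using S(2) by (rule S_code)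
  obtain g2 x2 k2 where 2: "s2 = cel g2 x2 k2" "1 \<le> k2" "k2 \<le> n" using S(3) by (rule S_code)
  obtain g3 x3 k3 where 3: "s3 = cel g3 x3 k3" "1 \<le> k3" "k3 \<le> n" using S(4) by (rule S_code)
  obtain g4 x4 k4 where 4: "s4 = cel g4 x4 k4" "1 \<le> k4" "k4 \<le> n" using S(5) by (rule S_code)
  have v: "valid_code n (g0, x0, k0)" "valid_code n (g1, x1, k1)" "valid_code n (g2, x2, k2)"
    "valid_code n (g3, x3, k3)" "valid_code n (g4, x4, k4)"
    using 0 1 2 3 4 by (simp_all add: valid_code_def)
  have ne: "\<not> code_eq n (g0, x0, k0) (g2, x2, k2)" "\<not> code_eq n (g1, x1, k1) (g3, x3, k3)"
    "\<not> code_eq n (g2, x2, k2) (g4, x4, k4)" "\<not> code_eq n (g3, x3, k3) (g0, x0, k0)"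
    "\<not> code_eq n (g4, x4, k4) (g1, x1, k1)"
    using neq 0 1 2 3 4 cel_eq by blast+
  show ?thesis
    by (rule no_induced_code_pentagon[OF v _ _ _ _ _ _ _ _ _ _ ne])
      (use adj nadj in \<open>simp_all only: adjS_def 0 1 2 3 4 cel_adj not_False_eq_True\<close>)
qed

text \<open>This and the next code will be the neighbours of a group element reached by the letter
  \<open>x\<close>, forwards and backwards.\<close>

lemma out_code: "lt x \<otimes> inv D = cel False (\<not> x) (n - 1)"
proof -
  have "D = sir (\<not> x) (n - 1) \<otimes> lt x" using sir_lt[of x "n - 1"] n_ge_2 by (simp add: sir_n)
  then show ?thesis by (simp add: cel_def inv_mult_group) (simp flip: m_assoc)
qed

lemma in_code: "inv (lt x) \<otimes> D = cel True (\<not> x) (n - 1)"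
proof -
  have "D = lt x \<otimes> sim (\<not> x) (n - 1)" using lt_sim[of x "n - 1"] n_ge_2 by (simp add: sim_n)
  then show ?thesis by (simp add: cel_def flip: m_assoc)
qed

text \<open>The two codes have the same letter and opposite signs, so they lie at opposite corners
  of the hexagon, at distance three.\<close>

lemma in_out_no_common:
  assumes "y \<in> S" "adjS y (inv (lt x) \<otimes> D)" "adjS y (lt x \<otimes> inv D)" shows False
proof -
  obtain g z k where y: "y = cel g z k" "1 \<le> k" "k \<le> n" using assms(1) by (rule S_code)
  have "code_adj n (g, z, k) (True, \<not> x, n - 1)" "code_adj n (g, z, k) (False, \<not> x, n - 1)"
    using assms(2,3) n_ge_2 y unfolding adjS_def out_code in_code by (simp_all add: cel_adj del: code_adj.simps)
  then show False using y n_ge_2 by (cases g; cases x; cases z) auto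
qed

text \<open>Both sides are the alternating word of length \<open>n + 1\<close>, because
  \<open>D\<close> may be written beginning with either letter. Conjugation by \<open>D\<close>
  fixes or exchanges the letters according to the parity of \<open>n\<close>.\<close>

lemma lt_D: "lt x \<otimes> D = D \<otimes> lt (if even n then x else \<not> x)"
proof -
  have "lt x \<otimes> D = sim x (Suc n)" using lt_sim[of x n] by (simp add: sim_n)
  also have "\<dots> = D \<otimes> lt (if even n then x else \<not> x)" by (simp only: sim_Suc sim_n)
  finally show ?thesis .
qed

lemma sim_D: "sim x k \<otimes> D = D \<otimes> sim (if even n then x else \<not> x) k"
proof (induction x k rule: alternating.induct)
  case (2 x k)
  have "sim x (Suc k) \<otimes> D = lt x \<otimes> (sim (\<not> x) k \<otimes> D)"
    by (simp only: flip: lt_sim) (simp add: m_assoc)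
  also have "\<dots> = (lt x \<otimes> D) \<otimes> sim (if even n then \<not> x else x) k"
    using 2 by (simp add: m_assoc)
  also have "\<dots> = D \<otimes> (lt (if even n then x else \<not> x) \<otimes> sim (if even n then \<not> x else x) k)"
    by (simp add: lt_D m_assoc)
  also have "\<dots> = D \<otimes> sim (if even n then x else \<not> x) (Suc k)"
    using lt_sim[of "if even n then x else \<not> x" k] by auto
  finally show ?case .
qed simp

lemma simples_conj_D: "s \<in> simples \<Longrightarrow> inv D \<otimes> s \<otimes> D \<in> simples"
  and simples_conj_D': "s \<in> simples \<Longrightarrow> D \<otimes> s \<otimes> inv D \<in> simples"
proof -
  assume "s \<in> simples"
  then obtain x k where s: "s = sim x k" "1 \<le> k" "k \<le> n" by (auto simp: simples_def)
  have "inv D \<otimes> s \<otimes> D = sim (if even n then x else \<not> x) k"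
    by (simp add: s m_assoc sim_D) (simp flip: m_assoc)
  then show "inv D \<otimes> s \<otimes> D \<in> simples" using s by (simp add: sim_simples)
  have "D \<otimes> s = sim (if even n then x else \<not> x) k \<otimes> D"
    by (simp add: s sim_D)
  then have "D \<otimes> s \<otimes> inv D = sim (if even n then x else \<not> x) k"
    by (simp add: m_assoc)
  then show "D \<otimes> s \<otimes> inv D \<in> simples" using s by (simp add: sim_simples)
qed

lemma S_conj_D: "s \<in> S \<Longrightarrow> inv D \<otimes> s \<otimes> D \<in> S"
  and S_conj_D': "s \<in> S \<Longrightarrow> D \<otimes> s \<otimes> inv D \<in> S"
proof -
  have *: "inv D \<otimes> inv s \<otimes> D = inv (inv D \<otimes> s \<otimes> D)" "D \<otimes> inv s \<otimes> inv D = inv (D \<otimes> s \<otimes> inv D)"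
    if "s \<in> carrier G" for s using that by (simp_all add: inv_mult_group m_assoc)
  show "s \<in> S \<Longrightarrow> inv D \<otimes> s \<otimes> D \<in> S" "s \<in> S \<Longrightarrow> D \<otimes> s \<otimes> inv D \<in> S"
    using simples_conj_D simples_conj_D' by (auto simp: S_def * simples_closed)
qed

text \<open>This invariance allows the vertices of a block to be shifted by different powers of
  \<open>D\<close> and still be compared through \<open>S\<close>.\<close>

lemma S_conj_pow: "s \<in> S \<Longrightarrow> D [^] (z::int) \<otimes> s \<otimes> D [^] (- z) \<in> S"
proof (induction z rule: int_induct[where k = 0])
  case base then show ?case using S_closed by (simp)
next
  case (step1 i)
  have "D [^] (i + 1) = D \<otimes> D [^] i" "D [^] (- (i + 1)) = D [^] (- i) \<otimes> inv D"
    using int_pow_mult[of D 1 i] int_pow_mult[of D "- i" "- 1"] by (simp_all add: add.commute int_pow_neg)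
  then show ?case using S_conj_D'[OF step1(2)[OF step1(3)]] S_closed[OF step1(3)] by (simp add: m_assoc)
next
  case (step2 i)
  have "D [^] (i - 1) = inv D \<otimes> D [^] i" "D [^] (- (i - 1)) = D [^] (- i) \<otimes> D"
    using int_pow_mult[of D "- 1" i] int_pow_mult[of D "- i" 1] by (simp_all add: int_pow_neg)
  then show ?case using S_conj_D[OF step2(2)[OF step2(3)]] S_closed[OF step2(3)] by (simp add: m_assoc)
qed

lemma S_conj_pow_iff:
  assumes "s \<in> carrier G" shows "D [^] (z::int) \<otimes> s \<otimes> D [^] (- z) \<in> S \<longleftrightarrow> s \<in> S"
proof
  assume "D [^] z \<otimes> s \<otimes> D [^] (- z) \<in> S"
  then have "D [^] (- z) \<otimes> (D [^] z \<otimes> s \<otimes> D [^] (- z)) \<otimes> D [^] (- (- z)) \<in> S" by (rule S_conj_pow)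
  also have "D [^] (- z) \<otimes> (D [^] z \<otimes> s \<otimes> D [^] (- z)) \<otimes> D [^] (- (- z)) = s"
    using assms by (simp add: int_pow_neg m_assoc) (simp flip: m_assoc)
  finally show "s \<in> S" .
qed (rule S_conj_pow)

end

lemma (in group) inv_cancel_left:
  assumes "x \<in> carrier G" "y \<in> carrier G"
  shows "inv x \<otimes> (x \<otimes> y) = y" "x \<otimes> (inv x \<otimes> y) = y"
  using assms by (simp_all flip: m_assoc)

lemma (in dihedral_pair) simples_conj_pow: "s \<in> simples \<Longrightarrow> D [^] (z::int) \<otimes> s \<otimes> D [^] (- z) \<in> simples"
proof (induction z rule: int_induct[where k = 0])
  case base then show ?case using simples_closed by simp
next
  case (step1 i)
  have "D [^] (i + 1) = D \<otimes> D [^] i" "D [^] (- (i + 1)) = D [^] (- i) \<otimes> inv D"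
    using int_pow_mult[of D 1 i] int_pow_mult[of D "- i" "- 1"] by (simp_all add: add.commute int_pow_neg)
  then show ?case using simples_conj_D'[OF step1(2)[OF step1(3)]] simples_closed[OF step1(3)] by (simp add: m_assoc)
next
  case (step2 i)
  have "D [^] (i - 1) = inv D \<otimes> D [^] i" "D [^] (- (i - 1)) = D [^] (- i) \<otimes> D"
    using int_pow_mult[of D "- 1" i] int_pow_mult[of D "- i" 1] by (simp_all add: int_pow_neg)
  then show ?case using simples_conj_D[OF step2(2)[OF step2(3)]] simples_closed[OF step2(3)] by (simp add: m_assoc)
qed

lemma (in dihedral_pair) D_split: "k \<le> n \<Longrightarrow> \<exists>z. D = sim x k \<otimes> sim z (n - k)"
  using sim_add[of x k "n - k"] sim_n[of x] by auto

lemma (in dihedral_pair) D_split': "k \<le> n \<Longrightarrow> \<exists>z. D = sim z (n - k) \<otimes> sim x k"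
  using sir_add[of "if even k then \<not> x else x" k "n - k"] sir_n
  by (auto simp: sim_sir[of x k] sir_sim[of _ "n - k"])

text \<open>The complement of \<open>sim x k\<close> in \<open>D\<close> is again alternating, and
  the quotient is its inverse.\<close>

lemma (in dihedral_pair) sim_inv_D_S: assumes "k < n" shows "sim x k \<otimes> inv D \<in> S"
proof -
  obtain z where z: "D = sim z (n - k) \<otimes> sim x k" using D_split'[of k x] assms by auto
  have "sim x k \<otimes> inv D = inv (sim z (n - k))"
    unfolding z by (simp add: inv_mult_group inv_cancel_left)
  then show ?thesis using assms sim_simples[of "n - k"] by (auto simp: S_def)
qed

lemma (in dihedral_pair) inv_sim_D_S: assumes "k < n" shows "inv (sim x k) \<otimes> D \<in> S"
proof -
  obtain z where z: "D = sim x k \<otimes> sim z (n - k)" using D_split[of k x] assms by auto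
  have "inv (sim x k) \<otimes> D = sim z (n - k)" unfolding z by (simp add: inv_cancel_left)
  then show ?thesis using assms sim_simples[of "n - k"] by (auto simp: S_def)
qed

section \<open>Elements, length and generators of the Artin group\<close>

context artin_graph
begin

abbreviation AG where "AG \<equiv> artin_group V E m"
abbreviation el where "el \<equiv> artin_elt V E m"
abbreviation gmult (infixl \<open>\<cdot>\<close> 70) where "x \<cdot> y \<equiv> x \<otimes>\<^bsub>AG\<^esub> y"

lemma AG_group: "group AG"
  unfolding artin_group_def by (rule group_presented_group)

sublocale AG: group "artin_group V E m" by (rule AG_group)

lemma el_closed [simp]: "w \<in> words V \<Longrightarrow> el w \<in> carrier AG"
  by (auto simp: artin_elt_def artin_group_def presented_group_def intro: quotientI)

lemma el_mult: "u \<in> words V \<Longrightarrow> v \<in> words V \<Longrightarrow> el u \<cdot> el v = el (u @ v)"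
  by (simp add: artin_elt_def artin_group_def presented_group_mult)

lemma el_Nil: "el [] = \<one>\<^bsub>AG\<^esub>"
  by (simp add: artin_elt_def artin_group_def presented_group_def)

lemma carrier_el:
  assumes "g \<in> carrier AG" obtains w where "w \<in> words V" "g = el w"
  using assms by (auto simp: artin_elt_def artin_group_def presented_group_def elim!: quotientE)

lemma el_eq_iff: "u \<in> words V \<Longrightarrow> v \<in> words V \<Longrightarrow> el u = el v \<longleftrightarrow> weq u v"
  unfolding artin_elt_def using eq_equiv_class_iff[OF equiv_pres_rel, of u V v]
  by (simp add: pres_rel_def)

definition ell :: "'s word set \<Rightarrow> int" where
  "ell g = word_exponent (SOME w. w \<in> words V \<and> g = el w)"

lemma ell_el [simp]: assumes "w \<in> words V" shows "ell (el w) = word_exponent w"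
proof -
  have "\<exists>u. u \<in> words V \<and> el w = el u" using assms by blast
  from someI_ex[OF this] have u: "(SOME u. u \<in> words V \<and> el w = el u) \<in> words V"
    "weq w (SOME u. u \<in> words V \<and> el w = el u)"
    using assms el_eq_iff by blast+
  show ?thesis unfolding ell_def using weq_exponent[OF u(2)] by simp
qed

lemma ell_mult: "g \<in> carrier AG \<Longrightarrow> h \<in> carrier AG \<Longrightarrow> ell (g \<cdot> h) = ell g + ell h"
  by (metis carrier_el el_mult ell_el word_exponent_simps(3) words_append)

lemma single_word [simp]: "[(s, c)] \<in> words V \<longleftrightarrow> s \<in> V"
  by (simp add: words_def)

lemma words_Cons: "p # u \<in> words V \<longleftrightarrow> fst p \<in> V \<and> u \<in> words V"
  by (cases p) (auto simp: words_def)

definition gen :: "'s \<Rightarrow> 's word set" where "gen s = el [(s, True)]"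

lemma gen_closed [simp]: "s \<in> V \<Longrightarrow> gen s \<in> carrier AG" by (simp add: gen_def)

lemma ell_gen [simp]: "s \<in> V \<Longrightarrow> ell (gen s) = 1" by (simp add: gen_def)

lemma el_inverse_letter: "s \<in> V \<Longrightarrow> el [(s, False)] = inv\<^bsub>AG\<^esub> gen s"
proof -
  assume s: "s \<in> V"
  have "weq ([] @ [(s, False), (s, \<not> False)] @ []) ([] @ [])"
    using s by (intro pres_eq.cancel) auto
  then have "el [(s, False)] \<cdot> gen s = \<one>\<^bsub>AG\<^esub>"
    using s by (simp add: gen_def el_mult words_Cons el_eq_iff flip: el_Nil)
  then show ?thesis using s AG.inv_equality[of "el [(s, False)]" "gen s"] by simp
qed

lemma pair_eval_el:
  assumes "a \<in> V" "b \<in> V"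
  shows "map (letter a b) u \<in> words V \<and> pair_eval AG (gen a) (gen b) u = el (map (letter a b) u)"
proof (induction u)
  case Nil show ?case by (simp add: pair_eval_def el_Nil)
next
  case (Cons x u)
  have 1: "[letter a b x] \<in> words V" using assms by (auto simp: letter_def)
  have "el [letter a b x] = (if x then gen a else gen b)" by (auto simp: letter_def gen_def)
  then show ?case using Cons el_mult[OF 1, of "map (letter a b) u"] 1
    by (auto simp: pair_eval_def words_Cons)
qed

end

section \<open>The block of an edge\<close>

locale artin_edge = artin_graph V E m for V :: "'s set" and E m +
  fixes a b :: 's
  assumes ab: "{a, b} \<in> E"
begin

lemma a_V [simp]: "a \<in> V" and b_V [simp]: "b \<in> V" and a_neq_b: "a \<noteq> b"
  using edge_V[OF ab] edge_neq[OF ab] by auto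

abbreviation n where "n \<equiv> m {a, b}"

lemma alt_words: "alt a b k \<in> words V \<and> alt b a k \<in> words V"
  by (induction k) (auto simp: words_Cons)

sublocale dihedral_pair "artin_group V E m" "gen a" "gen b" "m {a, b}" ell
proof
  note pe = pair_eval_el[OF a_V b_V]
  show "2 \<le> m {a, b}" using edge_label[OF ab] .
  have "weq ([] @ alt a b n @ []) ([] @ alt b a n @ [])"
    using ab by (intro pres_eq.relation) (auto simp: artin_relations_def alt_words)
  then show "pair_eval AG (gen a) (gen b) (alternating True n) = pair_eval AG (gen a) (gen b) (alternating False n)"
    using pe by (simp add: map_letter_alternating el_eq_iff alt_words)
  show "2 * int n dvd foldr flip u 0 - foldr flip v 0"
    "2 * int n dvd foldr flip (rev u) 0 - foldr flip (rev v) 0"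
    if "pair_eval AG (gen a) (gen b) u = pair_eval AG (gen a) (gen b) v" for u v
  proof -
    have "weq (map (letter a b) u) (map (letter a b) v)" using that pe by (simp add: el_eq_iff)
    then show "2 * int n dvd foldr flip u 0 - foldr flip v 0"
      "2 * int n dvd foldr flip (rev u) 0 - foldr flip (rev v) 0" using weq_detect[OF ab] by blast+
  qed
qed (simp_all add: ell_mult)

lemma sim_el: "sim x k = el (if x then alt a b k else alt b a k)"
  using pair_eval_el[of a b] by (simp add: sim_def map_letter_alternating)

lemma sir_el: "sir x k = el (rev (if x then alt a b k else alt b a k))"
  using pair_eval_el[of a b "rev (alternating x k)"] map_letter_alternating[of a b x k]
  by (simp add: sir_def flip: rev_map)

text \<open>The Boolean selects one of the two boundary paths by its first letter, so that both
  halves of a cell are treated at once.\<close>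

definition rim :: "bool \<Rightarrow> 's word set \<Rightarrow> nat \<Rightarrow> 's artin_vertex" where
  "rim x g k = Elt (g \<cdot> sim x k)"

lemma rim_vertex: "path_vertex V E m g a b k = rim True g k" "path_vertex V E m g b a k = rim False g k"
  by (simp_all add: path_vertex_def rim_def sim_el)

definition spine :: "'s word set \<Rightarrow> nat \<Rightarrow> 's artin_vertex" where
  "spine g j = (if j = 0 then Elt g else if j = n - 1 then Elt (g \<cdot> D) else Inner g {a, b} j)"

lemma spine_vertex: "axis_vertex V E m g a b j = spine g j" "axis_vertex V E m g b a j = spine g j"
  by (simp_all add: axis_vertex_def spine_def rim_vertex rim_def sim_n insert_commute)

definition block :: "'s artin_vertex set" where
  "block = Elt ` carrier AG \<union> {Inner g {a, b} j | g j. g \<in> carrier AG \<and> 1 \<le> j \<and> j \<le> n - 2}"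

lemma spine_block: "g \<in> carrier AG \<Longrightarrow> j \<le> n - 1 \<Longrightarrow> spine g j \<in> block"
  by (auto simp: spine_def block_def)

lemma rim_block: "g \<in> carrier AG \<Longrightarrow> rim x g k \<in> block"
  by (auto simp: rim_def block_def)

lemma rim_spine: "rim x g k = spine (g \<cdot> sim x k) 0"
  by (simp add: rim_def spine_def)

text \<open>The edges inside a block are those of the Cayley graph with respect to the simple elements,
  once \<open>c\<^sub>j\<close> of the cell \<open>h \<Pi>\<close> is sent to \<open>h D\<close> to the power \<open>- (ell h + j)\<close>.\<close>

fun kap :: "'s artin_vertex \<Rightarrow> 's word set" where
  "kap (Elt v) = v \<cdot> D [^]\<^bsub>AG\<^esub> (- ell v)"
| "kap (Inner h e j) = h \<cdot> D [^]\<^bsub>AG\<^esub> (- (ell h + int j))"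

lemma Dpow_add: "D [^]\<^bsub>AG\<^esub> (i + j :: int) = D [^]\<^bsub>AG\<^esub> i \<cdot> D [^]\<^bsub>AG\<^esub> j"
  by (rule AG.int_pow_mult) simp

lemma Dpow_merge: "y \<in> carrier AG \<Longrightarrow>
    D [^]\<^bsub>AG\<^esub> (i :: int) \<cdot> (D [^]\<^bsub>AG\<^esub> (j :: int) \<cdot> y) = D [^]\<^bsub>AG\<^esub> (i + j) \<cdot> y"
  by (simp add: Dpow_add AG.m_assoc)

lemma Dpow_one: "D \<cdot> D [^]\<^bsub>AG\<^esub> (j :: int) = D [^]\<^bsub>AG\<^esub> (j + 1)" "inv\<^bsub>AG\<^esub> D \<cdot> D [^]\<^bsub>AG\<^esub> (j :: int) = D [^]\<^bsub>AG\<^esub> (j - 1)"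
  using Dpow_add[of 1 j] Dpow_add[of "-1" j] by (simp_all add: add.commute AG.int_pow_neg)

lemma inv_Dpow: "inv\<^bsub>AG\<^esub> (D [^]\<^bsub>AG\<^esub> (i :: int)) = D [^]\<^bsub>AG\<^esub> (- i)"
  by (simp add: AG.int_pow_neg)

lemma ell_Dpow: "ell (D [^]\<^bsub>AG\<^esub> (z :: int)) = int n * z"
proof (induction z rule: int_induct[where k = 0])
  case (step1 i) then show ?case using Dpow_one(1)[of i] ell_mult[of D "D [^]\<^bsub>AG\<^esub> i"] by (simp add: algebra_simps)
next
  case (step2 i) then show ?case using Dpow_one(2)[of i] ell_mult[of "inv\<^bsub>AG\<^esub> D" "D [^]\<^bsub>AG\<^esub> i"]
    by (simp add: algebra_simps ell_inv)
qed simp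

text \<open>One formula covers the whole spine, ends included: the right end is \<open>h D\<close>,
  whose length exceeds that of \<open>h\<close> by \<open>n\<close>, and its factor \<open>D\<close>
  absorbs one of these \<open>n\<close> units of the exponent, leaving \<open>n - 1\<close>.\<close>

lemma kap_spine:
  assumes h: "h \<in> carrier AG"
  shows "kap (spine h j) = h \<cdot> D [^]\<^bsub>AG\<^esub> (- (ell h + int j))"
proof (cases "j = n - 1 \<and> j \<noteq> 0")
  case True
  have "kap (spine h j) = h \<cdot> (D \<cdot> D [^]\<^bsub>AG\<^esub> (- (ell h + int n)))"
    using True h n_ge_2 by (simp add: spine_def ell_mult AG.m_assoc)
  also have "D \<cdot> D [^]\<^bsub>AG\<^esub> (- (ell h + int n)) = D [^]\<^bsub>AG\<^esub> (- (ell h + int j))"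
    using True n_ge_2 by (simp add: Dpow_one of_nat_diff algebra_simps)
  finally show ?thesis .
next
  case False
  then have "j = 0 \<or> j \<noteq> n - 1" by blast
  then show ?thesis by (cases "j = 0") (simp_all add: spine_def)
qed

lemma kap_closed: "x \<in> block \<Longrightarrow> kap x \<in> carrier AG"
  by (auto simp: block_def)

text \<open>Group elements are taken as right ends of spines. Admitting \<open>j = 0\<close> would
  describe them a second time and spoil the uniqueness needed for injectivity of
  \<open>kap\<close>.\<close>

lemma block_spine:
  assumes "x \<in> block" obtains h j where "h \<in> carrier AG" "1 \<le> j" "j \<le> n - 1" "x = spine h j"
proof -
  from assms consider v where "v \<in> carrier AG" "x = Elt v"
    | g j where "g \<in> carrier AG" "1 \<le> j" "j \<le> n - 2" "x = Inner g {a, b} j"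
    by (auto simp: block_def)
  then show ?thesis
  proof cases
    case 1
    then show ?thesis using that[of "v \<cdot> inv\<^bsub>AG\<^esub> D" "n - 1"] n_ge_2
      by (simp add: spine_def AG.m_assoc)
  next
    case 2
    then show ?thesis using that[of g j] n_ge_2 by (simp add: spine_def)
  qed
qed

text \<open>The length of the image determines \<open>j\<close> modulo \<open>n - 1\<close>, and the
  range from 1 to \<open>n - 1\<close> contains each residue once. Then \<open>ell h\<close> and
  finally \<open>h\<close> can be recovered.\<close>

lemma kap_inj:
  assumes "x \<in> block" "y \<in> block" "kap x = kap y" shows "x = y"
proof -
  obtain h j where x: "h \<in> carrier AG" "1 \<le> j" "j \<le> n - 1" "x = spine h j" using assms(1) by (rule block_spine)
  obtain g i where y: "g \<in> carrier AG" "1 \<le> i" "i \<le> n - 1" "y = spine g i" using assms(2) by (rule block_spine)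
  have eq: "h \<cdot> D [^]\<^bsub>AG\<^esub> (- (ell h + int j)) = g \<cdot> D [^]\<^bsub>AG\<^esub> (- (ell g + int i))"
    using assms(3) x y by (simp add: kap_spine)
  have "ell h - int n * (ell h + int j) = ell g - int n * (ell g + int i)"
    using arg_cong[OF eq, of ell] x y by (simp add: ell_mult ell_Dpow algebra_simps)
  then have "(int n - 1) * (ell h + int j - ell g - int i) = int i - int j" by (simp add: algebra_simps)
  then have "int n - 1 dvd int i - int j" by (metis dvd_triv_left)
  moreover have "\<bar>int i - int j\<bar> < int n - 1" using x y n_ge_2 by linarith
  ultimately have ij: "i = j" using dvd_imp_le_int[of "int i - int j" "int n - 1"] by auto
  with \<open>(int n - 1) * _ = _\<close> have "ell h = ell g" using n_ge_2 by auto
  then have "h = g" using eq ij x y by simp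
  then show ?thesis using ij x y by simp
qed

definition bedge :: "'s artin_vertex \<Rightarrow> 's artin_vertex \<Rightarrow> bool" where
  "bedge x y \<longleftrightarrow> x \<in> block \<and> y \<in> block \<and> adjS (kap x) (kap y)"

lemma bedge_sym: "bedge x y \<Longrightarrow> bedge y x"
  unfolding bedge_def using adjS_sym kap_closed by blast

lemma bedge_neq: "bedge x y \<Longrightarrow> x \<noteq> y"
  using S_ell[of "\<one>\<^bsub>AG\<^esub>"] by (auto simp: bedge_def adjS_def kap_closed)

lemma kap_spine_relative:
  assumes h: "h \<in> carrier AG" and y: "y \<in> carrier AG"
  shows "inv\<^bsub>AG\<^esub> (kap (spine h j)) \<cdot> y =
    D [^]\<^bsub>AG\<^esub> (ell h + int j) \<cdot> (inv\<^bsub>AG\<^esub> h \<cdot> y \<cdot> D [^]\<^bsub>AG\<^esub> (ell h + int j)) \<cdot> D [^]\<^bsub>AG\<^esub> (- (ell h + int j))"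
  using assms by (simp add: kap_spine AG.inv_mult_group inv_Dpow AG.m_assoc add.commute flip: Dpow_add)

text \<open>The powers of \<open>D\<close> are collected at one end, as the invariance of
  \<open>S\<close> under conjugation permits, and only the difference of the two exponents survives.
  For the edges treated next this difference is -1, 0 or 1.\<close>

lemma bedge_spine:
  assumes h: "h \<in> carrier AG" "j \<le> n - 1" and g: "g \<in> carrier AG" "i \<le> n - 1"
  shows "bedge (spine h j) (spine g i) \<longleftrightarrow>
    inv\<^bsub>AG\<^esub> h \<cdot> g \<cdot> D [^]\<^bsub>AG\<^esub> (ell h + int j - ell g - int i) \<in> S"
proof -
  have "inv\<^bsub>AG\<^esub> (kap (spine h j)) \<cdot> kap (spine g i) \<in> S \<longleftrightarrow>
      inv\<^bsub>AG\<^esub> h \<cdot> kap (spine g i) \<cdot> D [^]\<^bsub>AG\<^esub> (ell h + int j) \<in> S"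
    unfolding kap_spine_relative[OF h(1) kap_closed[OF spine_block[OF g]]]
    using h kap_closed[OF spine_block[OF g]] by (intro S_conj_pow_iff) simp
  also have "inv\<^bsub>AG\<^esub> h \<cdot> kap (spine g i) \<cdot> D [^]\<^bsub>AG\<^esub> (ell h + int j) =
      inv\<^bsub>AG\<^esub> h \<cdot> g \<cdot> D [^]\<^bsub>AG\<^esub> (ell h + int j - ell g - int i)"
    using h g by (simp add: kap_spine AG.m_assoc algebra_simps flip: Dpow_add)
  finally show ?thesis using spine_block h g by (simp add: bedge_def adjS_def)
qed

lemma bedge_rim_spine:
  assumes h: "h \<in> carrier AG" and k: "1 \<le> k" "k \<le> n - 1"
  shows "bedge (rim x h k) (spine h k)" "bedge (rim x h k) (spine h (k - 1))" "bedge (spine h (k - 1)) (spine h k)"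
proof -
  have "bedge (spine h k) (rim x h k)"
    unfolding rim_spine using h k sim_simples[of k x] n_ge_2
    by (subst bedge_spine) (auto simp: ell_mult S_def AG.inv_cancel_left)
  then show "bedge (rim x h k) (spine h k)" by (rule bedge_sym)
  have "bedge (spine h (k - 1)) (rim x h k)"
    unfolding rim_spine using h k sim_inv_D_S[of k x] n_ge_2
    by (subst bedge_spine) (auto simp: ell_mult AG.inv_cancel_left AG.int_pow_neg of_nat_diff)
  then show "bedge (rim x h k) (spine h (k - 1))" by (rule bedge_sym)
  have "bedge (spine h k) (spine h (k - 1))"
    using h k sim_simples[of n True] n_ge_2 by (subst bedge_spine) (auto simp: of_nat_diff S_def sim_n)
  then show "bedge (spine h (k - 1)) (spine h k)" by (rule bedge_sym)
qed

lemma bedge_cayley: "h \<in> carrier AG \<Longrightarrow> bedge (Elt h) (Elt (h \<cdot> lt x))"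
  using bedge_spine[of h 0 "h \<cdot> lt x" 0] sim_inv_D_S[of 1 x] n_ge_2
  by (auto simp: spine_def ell_mult AG.inv_cancel_left AG.int_pow_neg lt_def sim_def)

text \<open>The two index shifts of the added edges are those for which the exponent difference
  becomes 0 and 1; the quotients are the inverse of \<open>sir x i\<close>, and that inverse times
  \<open>D\<close>.\<close>

lemma bedge_added:
  assumes h: "h \<in> carrier AG" and i: "1 \<le> i" "i \<le> n - 1"
  shows "j + i \<le> n - 1 \<Longrightarrow> bedge (spine h j) (spine (h \<cdot> inv\<^bsub>AG\<^esub> sir x i) (j + i))"
    "j + i - 1 \<le> n - 1 \<Longrightarrow> j \<le> n - 1 \<Longrightarrow> bedge (spine h j) (spine (h \<cdot> inv\<^bsub>AG\<^esub> sir x i) (j + i - 1))"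
proof -
  have "inv\<^bsub>AG\<^esub> sir x i \<in> S" using sir_simples[of i x] i by (auto simp: S_def)
  then show "j + i \<le> n - 1 \<Longrightarrow> bedge (spine h j) (spine (h \<cdot> inv\<^bsub>AG\<^esub> sir x i) (j + i))"
    using h i by (subst bedge_spine) (auto simp: ell_mult ell_inv AG.inv_cancel_left)
  have "inv\<^bsub>AG\<^esub> sir x i \<cdot> D \<in> S" unfolding sir_sim by (rule inv_sim_D_S) (use i n_ge_2 in auto)
  then show "j + i - 1 \<le> n - 1 \<Longrightarrow> j \<le> n - 1 \<Longrightarrow> bedge (spine h j) (spine (h \<cdot> inv\<^bsub>AG\<^esub> sir x i) (j + i - 1))"
    using h i by (subst bedge_spine) (auto simp: ell_mult ell_inv AG.inv_cancel_left of_nat_diff)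
qed

end

section \<open>Standard parabolic subgroups\<close>

context artin_graph
begin

abbreviation Edges :: "'s artin_vertex set set" where
  "Edges \<equiv> triangulation_edges V E m \<union> added_edges V E m"

text \<open>The standard parabolic subgroup on \<open>T\<close>, given by words because membership
  is refuted by reading letters.\<close>

definition supported :: "'s set \<Rightarrow> 's word set set" where
  "supported T = {el w | w. w \<in> words V \<and> fst ` set w \<subseteq> T}"

lemma supported_closed: "g \<in> supported T \<Longrightarrow> g \<in> carrier AG"
  by (auto simp: supported_def)

lemma supported_mult: "g \<in> supported T \<Longrightarrow> h \<in> supported T \<Longrightarrow> g \<cdot> h \<in> supported T"
proof -
  assume "g \<in> supported T" "h \<in> supported T"
  then obtain u v where "u \<in> words V" "fst ` set u \<subseteq> T" "g = el u" "v \<in> words V" "fst ` set v \<subseteq> T" "h = el v"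
    by (auto simp: supported_def)
  then show "g \<cdot> h \<in> supported T" unfolding supported_def
    by (intro CollectI exI[of _ "u @ v"]) (auto simp: el_mult)
qed

lemma supported_inv: "g \<in> supported T \<Longrightarrow> inv\<^bsub>AG\<^esub> g \<in> supported T"
proof -
  assume "g \<in> supported T"
  then obtain u where u: "u \<in> words V" "fst ` set u \<subseteq> T" "g = el u"
    by (auto simp: supported_def)
  let ?i = "rev (map (\<lambda>(s, b). (s, \<not> b)) u)"
  have i: "?i \<in> words V" using u(1) by (force simp: words_def)
  have "el ?i \<cdot> el u = \<one>\<^bsub>AG\<^esub>"
    using u i pres_eq_inverse[OF u(1)] by (simp add: el_mult el_eq_iff flip: el_Nil)
  then have "inv\<^bsub>AG\<^esub> g = el ?i" using u i AG.inv_equality by simp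
  moreover have "fst ` set ?i \<subseteq> T" using u(2) by force
  ultimately show ?thesis using i unfolding supported_def by blast
qed

lemma gen_supportedD: "gen s \<in> supported T \<Longrightarrow> s \<in> V \<Longrightarrow> s \<in> T"
proof -
  assume "gen s \<in> supported T" and s: "s \<in> V"
  then obtain w where w: "w \<in> words V" "fst ` set w \<subseteq> T" "gen s = el w" by (auto simp: supported_def)
  then have "weq w [(s, True)]" using el_eq_iff[of w "[(s, True)]"] s by (simp add: gen_def)
  then show "s \<in> T" using weq_letter_support w(2) by blast
qed

lemma gen2_supportedD:
  assumes "gen s \<cdot> gen t \<in> supported T" "s \<in> V" "t \<in> V" "s \<noteq> t" shows "s \<in> T" "t \<in> T"
proof -
  obtain w where w: "w \<in> words V" "fst ` set w \<subseteq> T" "gen s \<cdot> gen t = el w"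
    using assms by (auto simp: supported_def)
  then have "weq w [(s, True), (t, True)]"
    using el_eq_iff[of w "[(s, True), (t, True)]"] assms by (simp add: gen_def el_mult words_Cons)
  then show "s \<in> T" "t \<in> T" using weq_pair_support assms(4) w(2) by blast+
qed

end

lemma cell_triangle_pairs:
  "{{x, y} | x y t. t \<in> cell_triangles V E m \<and> x \<in> t \<and> y \<in> t \<and> x \<noteq> y} \<subseteq> triangulation_edges V E m"
  by (auto simp: triangulation_edges_def)

lemma Collect_negated_argument: "{f (\<not> x) k | x k. P k} = {f x k | x k. P k}"
proof (intro equalityI subsetI)
  fix y assume "y \<in> {f x k | x k. P k}"
  then obtain x k where y: "y = f x k" "P k" by auto
  then show "y \<in> {f (\<not> x) k | x k. P k}"
    by (intro CollectI exI[of _ "\<not> x"] exI[of _ k]) simp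
next
  fix y assume "y \<in> {f (\<not> x) k | x k. P k}"
  then obtain x k where y: "y = f (\<not> x) k" "P k" by auto
  then show "y \<in> {f x k | x k. P k}"
    by (intro CollectI exI[of _ "\<not> x"] exI[of _ k]) simp
qed

lemma added_edgesI:
  assumes "g \<in> carrier (artin_group V E m)" "{c, d} \<in> E" "3 \<le> m {c, d}" "i \<in> {1..m {c, d} - 2}"
    "w = artin_elt V E m (rev (alt c d i))"
  shows "j \<in> {1..m {c, d} - 2 - i} \<Longrightarrow>
      {Inner g {c, d} j, Inner (g \<otimes>\<^bsub>artin_group V E m\<^esub> inv\<^bsub>artin_group V E m\<^esub> w) {c, d} (j + i)} \<in> added_edges V E m"
    "j \<in> {1..m {c, d} - 1 - i} \<Longrightarrow>
      {Inner g {c, d} j, Inner (g \<otimes>\<^bsub>artin_group V E m\<^esub> inv\<^bsub>artin_group V E m\<^esub> w) {c, d} (j + i - 1)} \<in> added_edges V E m"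
  unfolding added_edges_def
  by (rule UnI1, rule CollectI, rule exI[of _ g], rule exI[of _ c], rule exI[of _ d], rule exI[of _ i],
      rule exI[of _ j], rule exI[of _ w], use assms in simp)
    (rule UnI2, rule CollectI, rule exI[of _ g], rule exI[of _ c], rule exI[of _ d], rule exI[of _ i],
      rule exI[of _ j], rule exI[of _ w], use assms in simp)

context artin_edge
begin

lemma S_supported: "g \<in> S \<Longrightarrow> g \<in> supported {a, b}"
proof -
  have "fst ` set (alt a b k) \<subseteq> {a, b} \<and> fst ` set (alt b a k) \<subseteq> {a, b}" for k
    by (induction k) auto
  then have "sim x k \<in> supported {a, b}" for x k
    unfolding sim_el supported_def using alt_words[of k]
    by (intro CollectI exI[of _ "if x then alt a b k else alt b a k"]) simp
  then show "g \<in> S \<Longrightarrow> g \<in> supported {a, b}"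
    by (auto simp: S_def simples_def supported_inv)
qed

lemma D_supported: "D \<in> supported {a, b}"
  using S_supported sim_simples[of n True] n_ge_2 by (auto simp: S_def sim_n)

lemma Dpow_supported: "D [^]\<^bsub>AG\<^esub> (z :: int) \<in> supported {a, b}"
proof (induction z rule: int_induct[where k = 0])
  case base show ?case unfolding int_pow_0 by (auto simp: supported_def intro!: exI[of _ "[]"] el_Nil[symmetric])
next
  case (step1 i) then show ?case using Dpow_one(1)[of i] supported_mult[OF D_supported] by (metis)
next
  case (step2 i) then show ?case using Dpow_one(2)[of i] supported_mult[OF supported_inv[OF D_supported]] by (metis)
qed

lemma sim_swap: "dihedral_pair.sim AG (gen b) (gen a) x k = sim (\<not> x) k"
proof -
  have "{b, a} \<in> E" using ab by (simp add: insert_commute)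
  then interpret sw: artin_edge V E m b a by unfold_locales
  show ?thesis by (simp add: sw.sim_el sim_el)
qed

text \<open>A block belongs to the unordered pair: exchanging the generators negates the Boolean of
  every alternating element but changes neither \<open>D\<close> nor the set
  \<open>S\<close>.\<close>

lemma bedge_swap: "artin_edge.bedge V E m b a x y \<longleftrightarrow> bedge x y"
proof -
  have "{b, a} \<in> E" using ab by (simp add: insert_commute)
  then interpret sw: artin_edge V E m b a by unfold_locales
  have n: "m {b, a} = n" by (simp add: insert_commute)
  have D: "sw.D = D" using sim_swap[of True n] sim_n sw.sim_n n by metis
  have simples: "sw.simples = simples"
  proof -
    have "sw.simples = {sim (\<not> x) k | x k. 1 \<le> k \<and> k \<le> m {b, a}}"
      unfolding sw.simples_def sim_swap ..
    also have "\<dots> = simples" unfolding simples_def n by (rule Collect_negated_argument)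
    finally show ?thesis .
  qed
  have S: "sw.S = S" unfolding sw.S_def S_def simples ..
  have kap: "sw.kap x = kap x" for x by (cases x) (simp_all only: sw.kap.simps kap.simps D)
  have block: "sw.block = block" unfolding sw.block_def block_def by (simp add: insert_commute)
  show ?thesis
    unfolding sw.bedge_def bedge_def kap block sw.adjS_def adjS_def S ..
qed

lemma triangle2:
  assumes "h \<in> carrier AG" "1 \<le> k" "k \<le> n - 1"
  shows "{rim x h k, spine h (k - 1), spine h k} \<in> cell_triangles V E m"
proof -
  have *: "{path_vertex V E m h c d k, axis_vertex V E m h c d (k - 1), axis_vertex V E m h c d k} \<in> cell_triangles V E m"
    if "{c, d} = {a, b}" for c d
    unfolding cell_triangles_def using that assms ab by (intro UnI2) (auto simp only: mem_Collect_eq atLeastAtMost_iff, metis)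
  show ?thesis using *[of a b] *[of b a] by (cases x) (simp_all add: rim_vertex spine_vertex insert_commute[of b a])
qed

lemma triangle_edgeI:
  "t \<in> cell_triangles V E m \<Longrightarrow> x \<in> t \<Longrightarrow> y \<in> t \<Longrightarrow> x \<noteq> y \<Longrightarrow> {x, y} \<in> Edges"
  using cell_triangle_pairs by blast

lemma edge_rim_spine:
  assumes "h \<in> carrier AG" "1 \<le> k" "k \<le> n - 1"
  shows "{rim x h k, spine h k} \<in> Edges" "{rim x h k, spine h (k - 1)} \<in> Edges"
    "{spine h (k - 1), spine h k} \<in> Edges"
  using bedge_rim_spine[OF assms, THEN bedge_neq] triangle_edgeI[OF triangle2[OF assms]] by simp_all

lemma edge_added1:
  assumes h: "h \<in> carrier AG" and i: "1 \<le> i" and j: "1 \<le> j" "j + i \<le> n - 2"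
  shows "{spine h j, spine (h \<cdot> inv\<^bsub>AG\<^esub> sir x i) (j + i)} \<in> Edges"
proof -
  have s: "spine h j = Inner h {a, b} j"
    "spine (h \<cdot> inv\<^bsub>AG\<^esub> sir x i) (j + i) = Inner (h \<cdot> inv\<^bsub>AG\<^esub> sir x i) {a, b} (j + i)"
    using i j by (auto simp: spine_def)
  have r: "\<exists>c d. {c, d} = {a, b} \<and> sir x i = el (rev (alt c d i))"
    unfolding sir_el by (cases x) auto
  then obtain c d where cd: "{c, d} = {a, b}" "sir x i = el (rev (alt c d i))" by blast
  show ?thesis unfolding s using h i j ab added_edgesI(1)[of h V E m c d i "sir x i" j] cd by auto
qed

lemma edge_added2:
  assumes h: "h \<in> carrier AG" and i: "1 \<le> i" and j: "1 \<le> j" "j + i \<le> n - 1"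
  shows "{spine h j, spine (h \<cdot> inv\<^bsub>AG\<^esub> sir x i) (j + i - 1)} \<in> Edges"
proof -
  have s: "spine h j = Inner h {a, b} j"
    "spine (h \<cdot> inv\<^bsub>AG\<^esub> sir x i) (j + i - 1) = Inner (h \<cdot> inv\<^bsub>AG\<^esub> sir x i) {a, b} (j + i - 1)"
    using i j by (auto simp: spine_def)
  have r: "\<exists>c d. {c, d} = {a, b} \<and> sir x i = el (rev (alt c d i))"
    unfolding sir_el by (cases x) auto
  then obtain c d where cd: "{c, d} = {a, b}" "sir x i = el (rev (alt c d i))" by blast
  show ?thesis unfolding s using h i j ab added_edgesI(2)[of h V E m c d i "sir x i" j] cd by auto
qed

text \<open>Every positive element of \<open>S\<close> at a block vertex is realized by an edge of
  the complex. If \<open>q \<le> j\<close>, the image is found on the spine at \<open>h\<close>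
  times \<open>sim z q\<close> with index \<open>j - q\<close>. Otherwise that index would be
  negative, and dividing the base point by \<open>D\<close> raises it by
  \<open>n - 1\<close>.\<close>

lemma kap_step:
  assumes h: "h \<in> carrier AG" and j: "1 \<le> j" "j \<le> n - 1" and q: "1 \<le> q" "q \<le> n"
  shows "\<exists>y\<in>block. {spine h j, y} \<in> Edges \<and> kap y = h \<cdot> sim z q \<cdot> D [^]\<^bsub>AG\<^esub> (- (ell h + int j))"
proof (cases "q \<le> j")
  case True
  let ?g = "h \<cdot> sim z q"
  let ?y = "spine ?g (j - q)"
  have g: "?g \<in> carrier AG" using h by simp
  have k: "kap ?y = h \<cdot> sim z q \<cdot> D [^]\<^bsub>AG\<^esub> (- (ell h + int j))"
    using True h by (simp add: kap_spine ell_mult of_nat_diff)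
  have hg: "h = ?g \<cdot> inv\<^bsub>AG\<^esub> sim z q" using h by (simp add: AG.m_assoc)
  have "{spine h j, ?y} \<in> Edges"
  proof (cases "q = j")
    case True
    then have "?y = rim z h j" by (simp add: rim_spine)
    then show ?thesis using edge_rim_spine(1)[OF h j, of z] by (simp add: insert_commute)
  next
    case qj: False
    show ?thesis
    proof (cases "j = n - 1")
      case False
      then have "{spine ?g (j - q), spine (?g \<cdot> inv\<^bsub>AG\<^esub> sir (if even q then \<not> z else z) q) (j - q + q)} \<in> Edges"
        using True qj j q by (intro edge_added1[OF g]) auto
      then show ?thesis
        unfolding sim_sir[of z q, symmetric] hg[symmetric] using True by (simp add: insert_commute)
    next
      case jn: True
      \<comment> \<open>The starting vertex is the right end \<open>h D\<close>; it also lies on the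
        boundary of the cell at \<open>?g\<close>, at distance \<open>n - q\<close> from the left
        end of that cell.\<close>
      obtain w where w: "D = sim z q \<cdot> sim w (n - q)" using D_split q by blast
      have "spine h j = rim w ?g (n - q)"
        using h n_ge_2 by (simp add: spine_def jn rim_def AG.m_assoc flip: w)
      moreover have "n - q - 1 = j - q" using jn by simp
      ultimately show ?thesis using edge_rim_spine(2)[OF g, of "n - q" w] q jn qj True by simp
    qed
  qed
  then show ?thesis using k spine_block[OF g, of "j - q"] j by auto
next
  case False
  let ?g = "h \<cdot> sim z q \<cdot> inv\<^bsub>AG\<^esub> D"
  let ?y = "spine ?g (j + (n - q) - 1)"
  have g: "?g \<in> carrier AG" using h by simp
  have "kap ?y = h \<cdot> sim z q \<cdot> (inv\<^bsub>AG\<^esub> D \<cdot> D [^]\<^bsub>AG\<^esub> (- (ell h + int j - 1)))"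
    using False h j q by (simp add: kap_spine ell_mult ell_inv of_nat_diff AG.m_assoc algebra_simps)
  then have k: "kap ?y = h \<cdot> sim z q \<cdot> D [^]\<^bsub>AG\<^esub> (- (ell h + int j))"
    using h by (simp add: Dpow_one)
  \<comment> \<open>The complement of \<open>sim z q\<close> turns the division by \<open>D\<close>
    into division by an alternating element of length \<open>n - q\<close>, the shape of the second
    family of added edges.\<close>
  obtain w where w: "D = sim w (n - q) \<cdot> sim z q" using D_split' q by blast
  have gw: "?g = h \<cdot> inv\<^bsub>AG\<^esub> sim w (n - q)"
    unfolding w using h by (simp add: AG.inv_mult_group AG.m_assoc AG.inv_cancel_left)
  have "{spine h j, ?y} \<in> Edges"
  proof (cases "q = n")
    case True
    then show ?thesis using gw h edge_rim_spine(3)[OF h j] by (simp add: insert_commute)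
  next
    case qn: False
    have "{spine h j, spine (h \<cdot> inv\<^bsub>AG\<^esub> sir (if even (n - q) then \<not> w else w) (n - q)) (j + (n - q) - 1)} \<in> Edges"
      using False qn j q by (intro edge_added2[OF h]) auto
    then show ?thesis unfolding gw sim_sir[of w "n - q", symmetric] .
  qed
  then show ?thesis using k spine_block[OF g, of "j + (n - q) - 1"] j q False by auto
qed

lemma bedge_Edges: assumes "bedge x y" shows "{x, y} \<in> Edges"
proof -
  have *: "{x, y} \<in> Edges" if x: "x \<in> block" and y: "y \<in> block" and s: "inv\<^bsub>AG\<^esub> kap x \<cdot> kap y \<in> simples" for x y
  proof -
    obtain h j where h: "h \<in> carrier AG" "1 \<le> j" "j \<le> n - 1" "x = spine h j" using x by (rule block_spine)
    define k where "k = ell h + int j"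
    have kx: "kap x = h \<cdot> D [^]\<^bsub>AG\<^esub> (- k)" using h by (simp add: kap_spine k_def)
    have "D [^]\<^bsub>AG\<^esub> (- k) \<cdot> (inv\<^bsub>AG\<^esub> kap x \<cdot> kap y) \<cdot> D [^]\<^bsub>AG\<^esub> (- (- k)) \<in> simples"
      by (rule simples_conj_pow[OF s])
    then obtain z q where q: "1 \<le> q" "q \<le> n" and eq: "D [^]\<^bsub>AG\<^esub> (- k) \<cdot> (inv\<^bsub>AG\<^esub> kap x \<cdot> kap y) \<cdot> D [^]\<^bsub>AG\<^esub> (- (- k)) = sim z q"
      by (auto simp: simples_def)
    have "sim z q = inv\<^bsub>AG\<^esub> h \<cdot> kap y \<cdot> D [^]\<^bsub>AG\<^esub> k"
      unfolding eq[symmetric] kx using h kap_closed[OF y]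
      by (simp add: AG.inv_mult_group inv_Dpow AG.m_assoc Dpow_merge)
    then have ky: "kap y = h \<cdot> sim z q \<cdot> D [^]\<^bsub>AG\<^esub> (- k)"
      using h kap_closed[OF y] by (simp add: AG.m_assoc AG.inv_cancel_left flip: Dpow_add)
    obtain y' where "y' \<in> block" "{x, y'} \<in> Edges" "kap y' = kap y"
      using kap_step[OF h(1-3) q, of z] unfolding ky k_def h(4) by blast
    then show ?thesis using kap_inj[OF _ y] by metis
  qed
  have "x \<in> block" "y \<in> block" "inv\<^bsub>AG\<^esub> kap x \<cdot> kap y \<in> S" using assms by (auto simp: bedge_def adjS_def)
  moreover then consider "inv\<^bsub>AG\<^esub> kap x \<cdot> kap y \<in> simples" | s where "s \<in> simples" "inv\<^bsub>AG\<^esub> kap x \<cdot> kap y = inv\<^bsub>AG\<^esub> s"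
    by (auto simp: S_def)
  then show ?thesis
  proof cases
    case 1 then show ?thesis using * calculation by blast
  next
    case 2
    have "inv\<^bsub>AG\<^esub> (inv\<^bsub>AG\<^esub> kap x \<cdot> kap y) = inv\<^bsub>AG\<^esub> kap y \<cdot> kap x"
      using calculation kap_closed by (simp add: AG.inv_mult_group)
    then have "inv\<^bsub>AG\<^esub> kap y \<cdot> kap x \<in> simples" using 2 simples_closed by simp
    then show ?thesis using *[of y x] calculation by (simp add: insert_commute)
  qed
qed

lemma block_vertices: "x \<in> block \<Longrightarrow> x \<in> artin_vertices V E m"
  using ab by (auto simp: block_def artin_vertices_def)

text \<open>If the lengths differ by \<open>d\<close>, the quotient has length
  \<open>- d (n - 1)\<close>, while elements of \<open>S\<close> have nonzero length of absolute
  value at most \<open>n\<close>. This leaves \<open>d = 1\<close>, and \<open>d = 2\<close> only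
  for \<open>n = 2\<close>: the diagonal of a square cell.\<close>

lemma bedge_Elt:
  assumes v: "v \<in> carrier AG" "v' \<in> carrier AG" and e: "bedge (Elt v) (Elt v')"
  shows "(\<exists>x. v' = v \<cdot> lt x \<or> v = v' \<cdot> lt x) \<or> n = 2 \<and> (v' = v \<cdot> D \<or> v = v' \<cdot> D)"
proof -
  have *: "(\<exists>x. v' = v \<cdot> lt x) \<or> n = 2 \<and> v' = v \<cdot> D"
    if v: "v \<in> carrier AG" "v' \<in> carrier AG" and e: "bedge (Elt v) (Elt v')" and le: "ell v \<le> ell v'" for v v'
  proof -
    define d where "d = ell v' - ell v"
    define z where "z = inv\<^bsub>AG\<^esub> v \<cdot> v' \<cdot> D [^]\<^bsub>AG\<^esub> (- d)"
    have z: "z \<in> S" using e bedge_spine[of v 0 v' 0] v by (simp add: spine_def z_def d_def)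
    have zc: "z \<in> carrier AG" using z by (rule S_closed)
    have "ell z = d - int n * d" using v by (simp add: z_def ell_mult ell_inv ell_Dpow d_def algebra_simps)
    then have ez: "- ell z = d * (int n - 1)" by (simp add: algebra_simps)
    have d0: "d \<ge> 1" using S_ell[OF z] ez le by (cases "d = 0") (auto simp: d_def)
    have dn: "d * (int n - 1) \<le> int n" using S_ell[OF z] ez by linarith
    have d2: "d \<le> 2"
    proof (rule ccontr)
      assume "\<not> d \<le> 2"
      then have "3 * (int n - 1) \<le> d * (int n - 1)" using n_ge_2 by (intro mult_right_mono) auto
      then have "3 * (int n - 1) \<le> int n" using dn by (rule order_trans)
      then show False using n_ge_2 by simp
    qed
    have iz: "inv\<^bsub>AG\<^esub> z \<in> S" using z by (rule S_inv)
    have vz: "v' = v \<cdot> z \<cdot> D [^]\<^bsub>AG\<^esub> d"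
      using v by (simp add: z_def AG.m_assoc AG.inv_cancel_left flip: Dpow_add)
    show ?thesis
    proof (cases "d = 1")
      case True
      have "ell (inv\<^bsub>AG\<^esub> z) = int (n - 1)" using ez True n_ge_2 zc by (simp add: ell_inv of_nat_diff)
      then obtain y where y: "inv\<^bsub>AG\<^esub> z = sim y (n - 1)" using S_pos[OF iz] by blast
      define l where "l = (if even (n - 1) then y else \<not> y)"
      have "Suc (n - 1) = n" using n_ge_2 by simp
      then have "D = inv\<^bsub>AG\<^esub> z \<cdot> lt l"
        using sim_Suc[of y "n - 1"] sim_n[of y] unfolding y l_def by metis
      then have "z \<cdot> D = lt l"
        using AG.inv_cancel_left(2)[of z "lt l"] zc by simp
      then have "v' = v \<cdot> lt l"
        using vz True v zc by (simp add: AG.m_assoc)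
      then show ?thesis by blast
    next
      case False
      then have d: "d = 2" using d0 d2 by simp
      then have n: "n = 2" using dn n_ge_2 by simp
      have "ell (inv\<^bsub>AG\<^esub> z) = int n" using ez d n zc by (simp add: ell_inv)
      then obtain y where "inv\<^bsub>AG\<^esub> z = sim y n" using S_pos[OF iz] by blast
      then have "inv\<^bsub>AG\<^esub> z = D" by (simp add: sim_n)
      then have zD: "z = inv\<^bsub>AG\<^esub> D" using zc AG.inv_inv by metis
      have "D [^]\<^bsub>AG\<^esub> d = D \<cdot> D" using Dpow_add[of 1 1] d by simp
      then have "v' = v \<cdot> D" using vz v by (simp add: zD AG.m_assoc AG.inv_cancel_left)
      then show ?thesis using n by simp
    qed
  qed
  show ?thesis
    using *[OF v e] *[OF v(2,1) bedge_sym[OF e]] by (cases "ell v \<le> ell v'") auto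
qed

lemma gen_lt: "gen a = lt True" "gen b = lt False" by (simp_all add: lt_def)

lemma bedge_gen: assumes v: "v \<in> carrier AG" and s: "s \<in> {a, b}" shows "bedge (Elt v) (Elt (v \<cdot> gen s))"
proof -
  from s have "s = a \<or> s = b" by blast
  then show ?thesis
  proof
    assume "s = a" then show ?thesis using bedge_cayley[OF v, of True] gen_lt(1) by metis
  next
    assume "s = b" then show ?thesis using bedge_cayley[OF v, of False] gen_lt(2) by metis
  qed
qed
end

section \<open>Edges of the complex sorted by blocks\<close>

context artin_graph
begin

lemma artin_edgeI: "{a, b} \<in> E \<Longrightarrow> artin_edge V E m a b"
  by (rule artin_edge.intro[OF artin_graph_axioms]) (rule artin_edge_axioms.intro)

definition block_edge :: "'s set \<Rightarrow> 's artin_vertex \<Rightarrow> 's artin_vertex \<Rightarrow> bool" where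
  "block_edge e x y \<longleftrightarrow> (\<exists>a b. e = {a, b} \<and> e \<in> E \<and> artin_edge.bedge V E m a b x y)"

lemma block_edge_iff: assumes "{a, b} \<in> E" shows "block_edge {a, b} x y \<longleftrightarrow> artin_edge.bedge V E m a b x y"
proof -
  interpret artin_edge V E m a b using assms by (rule artin_edgeI)
  show ?thesis
  proof
    assume "block_edge {a, b} x y"
    then obtain c d where cd: "{a, b} = {c, d}" "artin_edge.bedge V E m c d x y"
      unfolding block_edge_def by blast
    from cd(1) have "c = a \<and> d = b \<or> c = b \<and> d = a" by (auto simp: doubleton_eq_iff)
    then show "bedge x y" using cd(2) bedge_swap by blast
  next
    assume "bedge x y" then show "block_edge {a, b} x y" unfolding block_edge_def using ab by blast
  qed
qed

lemma block_edge_sym: "block_edge e x y \<Longrightarrow> block_edge e y x"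
  unfolding block_edge_def using artin_edge.bedge_sym artin_edgeI by metis

lemma block_edge_Edges: "block_edge e x y \<Longrightarrow> {x, y} \<in> Edges"
  unfolding block_edge_def using artin_edge.bedge_Edges artin_edgeI by metis

lemma triangulation_edge_cases:
  assumes "t \<in> cell_triangles V E m" "x \<in> t" "y \<in> t" "x \<noteq> y"
  shows "\<exists>e. block_edge e x y"
proof -
  from assms(1) consider
    (1) g a b k where "g \<in> carrier AG" "{a, b} \<in> E" "k \<in> {1..m {a, b} - 2}"
      "t = {path_vertex V E m g a b k, path_vertex V E m g a b (k + 1), axis_vertex V E m g a b k}"
  | (2) g a b k where "g \<in> carrier AG" "{a, b} \<in> E" "k \<in> {1..m {a, b} - 1}"
      "t = {path_vertex V E m g a b k, axis_vertex V E m g a b (k - 1), axis_vertex V E m g a b k}"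
    unfolding cell_triangles_def by blast
  then show ?thesis
  proof cases
    case 1
    interpret artin_edge V E m a b using 1(2) by (rule artin_edgeI)
    have k: "1 \<le> k" "k \<le> n - 1" "1 \<le> k + 1" "k + 1 \<le> n - 1" using 1(3) by auto
    have t: "t = {rim True g k, rim True g (k + 1), spine g k}" using 1(4) by (simp add: rim_vertex spine_vertex)
    have "bedge (rim True g k) (spine g k)" "bedge (rim True g (k + 1)) (spine g k)"
      using bedge_rim_spine(1)[OF 1(1) k(1,2)] bedge_rim_spine(2)[OF 1(1) k(3,4)] by simp_all
    moreover have "bedge (rim True g k) (rim True g (k + 1))"
      using bedge_cayley[of "g \<cdot> sim True k"] 1(1) sim_Suc[of True k] by (simp add: rim_def AG.m_assoc)
    ultimately have "bedge x y" using assms(2-4) bedge_sym unfolding t by blast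
    then show ?thesis using 1(2) unfolding block_edge_def by blast
  next
    case 2
    interpret artin_edge V E m a b using 2(2) by (rule artin_edgeI)
    have k: "1 \<le> k" "k \<le> n - 1" using 2(3) by auto
    have t: "t = {rim True g k, spine g (k - 1), spine g k}" using 2(4) by (simp add: rim_vertex spine_vertex)
    have "bedge x y" using assms(2-4) bedge_sym bedge_rim_spine[OF 2(1) k] unfolding t by blast
    then show ?thesis using 2(2) unfolding block_edge_def by blast
  qed
qed

lemma added_edge_cases:
  assumes "{x, y} \<in> added_edges V E m"
  shows "\<exists>e. block_edge e x y"
proof -
  from assms obtain g a b i j j' where *: "g \<in> carrier AG" "{a, b} \<in> E" "i \<in> {1..m {a, b} - 2}"
      "{x, y} = {Inner g {a, b} j, Inner (g \<cdot> inv\<^bsub>AG\<^esub> el (rev (alt a b i))) {a, b} j'}"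
      "j' = j + i \<and> j \<in> {1..m {a, b} - 2 - i} \<or> j' = j + i - 1 \<and> j \<in> {1..m {a, b} - 1 - i}"
    unfolding added_edges_def by auto
  interpret artin_edge V E m a b using *(2) by (rule artin_edgeI)
  have ij: "1 \<le> i" "i \<le> n - 2" "1 \<le> j" "j \<le> n - 2" "1 \<le> j'" "j' \<le> n - 2" using *(3,5) by auto
  have s: "Inner h {a, b} l = spine h l" if "1 \<le> l" "l \<le> n - 2" for h l using that by (auto simp: spine_def)
  have r: "el (rev (alt a b i)) = sir True i" by (simp add: sir_el)
  have eq: "{x, y} = {spine g j, spine (g \<cdot> inv\<^bsub>AG\<^esub> sir True i) j'}"
    using *(4) ij by (simp add: s r)
  have "bedge (spine g j) (spine (g \<cdot> inv\<^bsub>AG\<^esub> sir True i) j')"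
    using bedge_added[OF *(1), of i j True] *(3,5) by auto
  then have "bedge x y" using eq bedge_sym by (metis doubleton_eq_iff)
  then show ?thesis using *(2) unfolding block_edge_def by blast
qed

lemma Edges_cases:
  assumes "{x, y} \<in> Edges"
  obtains (cayley) h s where "h \<in> carrier AG" "s \<in> V" "{x, y} = {Elt h, Elt (h \<cdot> gen s)}"
  | (block) e where "block_edge e x y"
proof -
  from assms consider "{x, y} \<in> cayley_edges V E m"
    | u v t where "t \<in> cell_triangles V E m" "u \<in> t" "v \<in> t" "u \<noteq> v" "{x, y} = {u, v}"
    | "{x, y} \<in> added_edges V E m"
    unfolding triangulation_edges_def by blast
  then show ?thesis
  proof cases
    case 1
    then show ?thesis using cayley unfolding cayley_edges_def gen_def by blast
  next
    case 2
    then show ?thesis using block triangulation_edge_cases block_edge_sym by (metis doubleton_eq_iff)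
  next
    case 3
    then show ?thesis using block added_edge_cases by blast
  qed
qed

lemma block_edgeD:
  assumes "block_edge e x y"
  shows "e \<in> E" "x \<noteq> y" "x \<in> artin_vertices V E m" "y \<in> artin_vertices V E m"
proof -
  obtain a b where oab: "e = {a, b}" "{a, b} \<in> E" "artin_edge.bedge V E m a b x y"
    using assms unfolding block_edge_def by blast
  interpret artin_edge V E m a b using oab(2) by (rule artin_edgeI)
  show "e \<in> E" "x \<noteq> y" "x \<in> artin_vertices V E m" "y \<in> artin_vertices V E m"
    using oab bedge_neq[OF oab(3)] block_vertices by (auto simp: bedge_def)
qed

lemma cayley_neq: "h \<in> carrier AG \<Longrightarrow> s \<in> V \<Longrightarrow> h \<noteq> h \<cdot> gen s"
  using ell_mult[of h "gen s"] by force

lemma EdgesD: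
  assumes "{x, y} \<in> Edges"
  shows "x \<noteq> y" "x \<in> artin_vertices V E m" "y \<in> artin_vertices V E m"
proof -
  from assms have "x \<noteq> y \<and> x \<in> artin_vertices V E m \<and> y \<in> artin_vertices V E m"
  proof (cases rule: Edges_cases)
    case (cayley h s)
    have "Elt h \<noteq> Elt (h \<cdot> gen s)" using cayley_neq cayley by simp
    moreover have "Elt h \<in> artin_vertices V E m" "Elt (h \<cdot> gen s) \<in> artin_vertices V E m"
      using cayley by (simp_all add: artin_vertices_def)
    ultimately show ?thesis using cayley(3) unfolding doubleton_eq_iff by blast
  next
    case (block e)
    then show ?thesis using block_edgeD by blast
  qed
  then show "x \<noteq> y" "x \<in> artin_vertices V E m" "y \<in> artin_vertices V E m" by blast+
qed

lemma cayley_Edges: "h \<in> carrier AG \<Longrightarrow> s \<in> V \<Longrightarrow> {Elt h, Elt (h \<cdot> gen s)} \<in> Edges"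
  unfolding triangulation_edges_def cayley_edges_def gen_def
  by (rule UnI1, rule UnI1, rule CollectI, rule exI[of _ h], rule exI[of _ s]) simp

text \<open>The name of an interior vertex contains its edge of the defining graph, and it lies in
  no block of another edge. Its whole link therefore belongs to one block.\<close>

lemma Inner_block_edge:
  assumes "{Inner g e j, y} \<in> Edges" shows "block_edge e (Inner g e j) y"
  using assms
proof (cases rule: Edges_cases)
  case (block e')
  then obtain a b where oab: "e' = {a, b}" "{a, b} \<in> E" "artin_edge.bedge V E m a b (Inner g e j) y"
    unfolding block_edge_def by blast
  interpret artin_edge V E m a b using oab(2) by (rule artin_edgeI)
  have "e = {a, b}" using oab(3) by (auto simp: bedge_def block_def)
  then show ?thesis using block oab by simp
qed (auto simp: doubleton_eq_iff)

end

context artin_edge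
begin

lemma supported_cancel:
  assumes "g \<in> supported T" "h \<in> supported T" "z \<in> carrier AG" "g \<cdot> z \<cdot> h \<in> supported T"
  shows "z \<in> supported T"
proof -
  have "inv\<^bsub>AG\<^esub> g \<cdot> (g \<cdot> z \<cdot> h) \<cdot> inv\<^bsub>AG\<^esub> h \<in> supported T"
    using assms supported_mult supported_inv by meson
  also have "inv\<^bsub>AG\<^esub> g \<cdot> (g \<cdot> z \<cdot> h) \<cdot> inv\<^bsub>AG\<^esub> h = z"
    using assms(3) supported_closed[OF assms(1)] supported_closed[OF assms(2)]
    by (simp add: AG.m_assoc AG.inv_cancel_left)
  finally show ?thesis .
qed

lemma D_gen: "n = 2 \<Longrightarrow> D = gen a \<cdot> gen b"
proof -
  assume "n = 2"
  then have "alternating True n = [True, False]" by (simp add: numeral_2_eq_2)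
  then have "D = ev [True, False]" by (simp only: D_def)
  then show ?thesis by (simp add: lt_def)
qed

text \<open>Two vertices of a block can only be joined by an edge of that block if they lie in the same
  coset of the parabolic subgroup.\<close>

lemma supported_Edges_bedge:
  assumes y: "y \<in> block" "y' \<in> block" and sup: "inv\<^bsub>AG\<^esub> kap y \<cdot> kap y' \<in> supported {a, b}" and e: "{y, y'} \<in> Edges"
  shows "bedge y y'"
proof -
  have *: "bedge y y'" if "y = Inner g {a, b} j" "{y, y'} \<in> Edges" for y y' g j
    using Inner_block_edge[of g "{a, b}" j y'] that block_edge_iff[OF ab] by simp
  consider g j where "y = Inner g {a, b} j" | g j where "y' = Inner g {a, b} j"
    | v v' where "y = Elt v" "y' = Elt v'" "v \<in> carrier AG" "v' \<in> carrier AG"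
    using y unfolding block_def by blast
  then show ?thesis
  proof cases
    case 1 then show ?thesis using * e by blast
  next
    case 2 then show ?thesis using *[of y' g j y] e bedge_sym by (simp add: insert_commute)
  next
    case 3
    have c: "inv\<^bsub>AG\<^esub> v \<cdot> v' \<in> carrier AG" using 3 by simp
    have "inv\<^bsub>AG\<^esub> kap y \<cdot> kap y' = D [^]\<^bsub>AG\<^esub> (ell v) \<cdot> (inv\<^bsub>AG\<^esub> v \<cdot> v') \<cdot> D [^]\<^bsub>AG\<^esub> (- ell v')"
      using 3 by (simp add: AG.inv_mult_group inv_Dpow AG.m_assoc)
    then have sv: "inv\<^bsub>AG\<^esub> v \<cdot> v' \<in> supported {a, b}"
      using supported_cancel[OF Dpow_supported Dpow_supported c] sup by simp
    have sv': "inv\<^bsub>AG\<^esub> v' \<cdot> v \<in> supported {a, b}"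
      using supported_inv[OF sv] 3 by (simp add: AG.inv_mult_group)
    have gen_case: "bedge (Elt v) (Elt v')"
      if "s \<in> V" "v' = v \<cdot> gen s" "inv\<^bsub>AG\<^esub> v \<cdot> v' \<in> supported {a, b}" "v \<in> carrier AG" for s v v'
    proof -
      have "gen s \<in> supported {a, b}" using that by (simp add: AG.inv_cancel_left)
      then have "s \<in> {a, b}" using gen_supportedD that by blast
      then show ?thesis using bedge_gen that by simp
    qed
    from e show ?thesis
    proof (cases rule: Edges_cases)
      case (cayley h s)
      then have "v' = v \<cdot> gen s \<or> v = v' \<cdot> gen s" using 3 by (auto simp: doubleton_eq_iff)
      then show ?thesis using gen_case[of s v' v] gen_case[of s v v'] cayley(2) 3 sv sv' bedge_sym by auto
    next
      case (block e')
      then obtain c d where cd: "e' = {c, d}" "{c, d} \<in> E" "artin_edge.bedge V E m c d y y'"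
        unfolding block_edge_def by blast
      interpret cd: artin_edge V E m c d using cd(2) by (rule artin_edgeI)
      have ltc: "\<exists>s\<in>V. cd.lt x = gen s" for x by (cases x) (auto simp: cd.lt_def)
      \<comment> \<open>A diagonal of a square cell is the product of both generators of its edge;
        if it lies in the parabolic subgroup of \<open>a\<close> and \<open>b\<close>, the two edges
        coincide.\<close>
      have "{c, d} = {a, b}" if m2: "cd.n = 2" and D: "cd.D \<in> supported {a, b}"
      proof -
        have "gen c \<cdot> gen d \<in> supported {a, b}" using cd.D_gen[OF m2] D by simp
        then have "c \<in> {a, b}" "d \<in> {a, b}" using gen2_supportedD[OF _ cd.a_V cd.b_V cd.a_neq_b] by blast+
        then show ?thesis using cd.a_neq_b by blast
      qed
      then have D_case: "bedge y y'" if "cd.n = 2" "cd.D \<in> supported {a, b}"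
        using that cd block_edge_iff[OF ab] block_edge_iff[OF cd(2)] by metis
      consider x where "v' = v \<cdot> cd.lt x" | x where "v = v' \<cdot> cd.lt x" | "cd.n = 2" "v' = v \<cdot> cd.D" | "cd.n = 2" "v = v' \<cdot> cd.D"
        using cd.bedge_Elt[OF 3(3,4)] cd(3) 3 by blast
      then show ?thesis
      proof cases
        case 1 then show ?thesis using ltc[of x] gen_case[of _ v' v] sv 3 by metis
      next
        case 2 then show ?thesis using ltc[of x] gen_case[of _ v v'] sv' 3 bedge_sym by metis
      next
        case a: 3
        have "inv\<^bsub>AG\<^esub> v \<cdot> v' = cd.D" unfolding a(2) by (rule AG.inv_cancel_left(1)[OF 3(3) cd.D_closed])
        then show ?thesis using D_case[OF a(1)] sv by (simp only:)
      next
        case a: 4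
        have "inv\<^bsub>AG\<^esub> v' \<cdot> v = cd.D" unfolding a(2) by (rule AG.inv_cancel_left(1)[OF 3(4) cd.D_closed])
        then show ?thesis using D_case[OF a(1)] sv' by (simp only:)
      qed
    qed
  qed
qed

lemma bedge_supported: "bedge x y \<Longrightarrow> inv\<^bsub>AG\<^esub> kap x \<cdot> kap y \<in> supported {a, b}"
  using S_supported by (simp add: bedge_def adjS_def)

text \<open>Two neighbours of \<open>x\<close> in a block lie in one coset of its parabolic
  subgroup, so an edge between them is an edge of that block wherever it comes from. The part of a
  link given by one block is thus a full subgraph.\<close>

lemma bedge_common_Edges:
  assumes "bedge x y" "bedge x y'" "{y, y'} \<in> Edges" shows "bedge y y'"
proof -
  have b: "x \<in> block" "y \<in> block" "y' \<in> block" using assms by (auto simp: bedge_def)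
  have "inv\<^bsub>AG\<^esub> kap y \<cdot> kap x \<cdot> (inv\<^bsub>AG\<^esub> kap x \<cdot> kap y') \<in> supported {a, b}"
    using assms bedge_sym bedge_supported supported_mult by blast
  also have "inv\<^bsub>AG\<^esub> kap y \<cdot> kap x \<cdot> (inv\<^bsub>AG\<^esub> kap x \<cdot> kap y') = inv\<^bsub>AG\<^esub> kap y \<cdot> kap y'"
    using b[THEN kap_closed] by (simp add: AG.m_assoc AG.inv_cancel_left)
  finally show ?thesis using supported_Edges_bedge b assms(3) by blast
qed

lemma adjS_translate:
  assumes "z \<in> carrier AG" "x \<in> carrier AG" "y \<in> carrier AG"
  shows "adjS (inv\<^bsub>AG\<^esub> z \<cdot> x) (inv\<^bsub>AG\<^esub> z \<cdot> y) \<longleftrightarrow> adjS x y"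
  using assms by (simp add: adjS_def AG.inv_mult_group AG.m_assoc AG.inv_cancel_left)

text \<open>Left division by \<open>kap x\<close> carries the neighbours of \<open>x\<close> in the
  block into \<open>S\<close> and preserves adjacency.\<close>

lemma no_block_square:
  assumes x: "bedge x y0" "bedge x y1" "bedge x y2" "bedge x y3"
    and adj: "bedge y0 y1" "bedge y1 y2" "bedge y2 y3" "bedge y3 y0"
    and nadj: "\<not> bedge y0 y2" "\<not> bedge y1 y3" and neq: "y0 \<noteq> y2" "y1 \<noteq> y3"
  shows False
proof -
  have b: "x \<in> block" "y0 \<in> block" "y1 \<in> block" "y2 \<in> block" "y3 \<in> block" using x by (auto simp: bedge_def)
  note k = b[THEN kap_closed]
  let ?p = "\<lambda>y. inv\<^bsub>AG\<^esub> kap x \<cdot> kap y"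
  have inj: "?p y \<noteq> ?p y'" if "y \<noteq> y'" "y \<in> block" "y' \<in> block" for y y'
    using kap_inj that k(1) kap_closed by (metis AG.inv_cancel_left(2))
  show False
    by (rule no_induced_square[of "?p y0" "?p y1" "?p y2" "?p y3"])
      (use x adj nadj neq b inj in \<open>simp_all only: adjS_translate k, simp_all add: bedge_def flip: adjS_def\<close>)
qed

lemma no_block_pentagon:
  assumes x: "bedge x y0" "bedge x y1" "bedge x y2" "bedge x y3" "bedge x y4"
    and adj: "bedge y0 y1" "bedge y1 y2" "bedge y2 y3" "bedge y3 y4" "bedge y4 y0"
    and nadj: "\<not> bedge y0 y2" "\<not> bedge y1 y3" "\<not> bedge y2 y4" "\<not> bedge y3 y0" "\<not> bedge y4 y1"
    and neq: "y0 \<noteq> y2" "y1 \<noteq> y3" "y2 \<noteq> y4" "y3 \<noteq> y0" "y4 \<noteq> y1"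
  shows False
proof -
  have b: "x \<in> block" "y0 \<in> block" "y1 \<in> block" "y2 \<in> block" "y3 \<in> block" "y4 \<in> block" using x by (auto simp: bedge_def)
  note k = b[THEN kap_closed]
  let ?p = "\<lambda>y. inv\<^bsub>AG\<^esub> kap x \<cdot> kap y"
  have inj: "?p y \<noteq> ?p y'" if "y \<noteq> y'" "y \<in> block" "y' \<in> block" for y y'
    using kap_inj that k(1) kap_closed by (metis AG.inv_cancel_left(2))
  show False
    by (rule no_induced_pentagon[of "?p y0" "?p y1" "?p y2" "?p y3" "?p y4"])
      (use x adj nadj neq b inj in \<open>simp_all only: adjS_translate k, simp_all add: bedge_def flip: adjS_def\<close>)
qed

end

lemma cycle_edges_image: "cycle_edges xs = (\<lambda>i. {xs ! i, xs ! (Suc i mod length xs)}) ` {..<length xs}"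
  unfolding cycle_edges_def image_def by (rule Collect_cong) (simp add: Bex_def conj_commute)

lemma cycle_edges_explicit:
  "cycle_edges [a, b, c] = {{a, b}, {b, c}, {c, a}}"
  "cycle_edges [a, b, c, d] = {{a, b}, {b, c}, {c, d}, {d, a}}"
  "cycle_edges [a, b, c, d, e] = {{a, b}, {b, c}, {c, d}, {d, e}, {e, a}}"
  unfolding cycle_edges_image list.size lessThan_Suc add_0_right add_Suc_right lessThan_0 image_insert image_empty
  by (simp_all add: insert_commute del: insert_iff)

lemma six_largeI:
  assumes sq: "\<And>v0 v1 v2 v3. \<lbrakk>distinct [v0, v1, v2, v3]; {v0, v1} \<in> E; {v1, v2} \<in> E; {v2, v3} \<in> E; {v3, v0} \<in> E;
      {v0, v2} \<notin> E; {v1, v3} \<notin> E\<rbrakk> \<Longrightarrow> False"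
    and pent: "\<And>v0 v1 v2 v3 v4. \<lbrakk>distinct [v0, v1, v2, v3, v4]; {v0, v1} \<in> E; {v1, v2} \<in> E; {v2, v3} \<in> E;
      {v3, v4} \<in> E; {v4, v0} \<in> E; {v0, v2} \<notin> E; {v1, v3} \<notin> E; {v2, v4} \<notin> E; {v3, v0} \<notin> E; {v4, v1} \<notin> E\<rbrakk> \<Longrightarrow> False"
  shows "six_large V E"
  unfolding six_large_def
proof (intro allI impI notI)
  fix cs :: "'a list"
  assume cs: "simple_cycle V E cs \<and> length cs \<in> {4, 5}" and eq: "induced_edges E (set cs) = cycle_edges cs"
  then have d: "distinct cs" and sub: "cycle_edges cs \<subseteq> E" by (auto simp: simple_cycle_def)
  have chord: "{x, y} \<notin> E" if "x \<in> set cs" "y \<in> set cs" "{x, y} \<notin> cycle_edges cs" for x y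
    using that eq by (auto simp: induced_edges_def)
  consider v0 v1 v2 v3 where "cs = [v0, v1, v2, v3]" | v0 v1 v2 v3 v4 where "cs = [v0, v1, v2, v3, v4]"
    using cs by (auto simp: length_Suc_conv eval_nat_numeral)
  then show False
  proof cases
    case 1
    have ce: "cycle_edges cs = {{v0, v1}, {v1, v2}, {v2, v3}, {v3, v0}}" unfolding 1 by (rule cycle_edges_explicit)
    show False
    proof (rule sq[of v0 v1 v2 v3])
      have n: "{v0, v2} \<notin> cycle_edges cs" "{v1, v3} \<notin> cycle_edges cs"
        using d unfolding ce by (auto simp: 1 doubleton_eq_iff)
      show "{v0, v2} \<notin> E" "{v1, v3} \<notin> E" using chord n by (simp_all add: 1)
      show "distinct [v0, v1, v2, v3]" using d by (simp only: 1)
      show "{v0, v1} \<in> E" "{v1, v2} \<in> E" "{v2, v3} \<in> E" "{v3, v0} \<in> E"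
        using sub unfolding ce by blast+
    qed
  next
    case 2
    have ce: "cycle_edges cs = {{v0, v1}, {v1, v2}, {v2, v3}, {v3, v4}, {v4, v0}}" unfolding 2 by (rule cycle_edges_explicit)
    show False
    proof (rule pent[of v0 v1 v2 v3 v4])
      have n: "{v0, v2} \<notin> cycle_edges cs" "{v1, v3} \<notin> cycle_edges cs" "{v2, v4} \<notin> cycle_edges cs"
        "{v3, v0} \<notin> cycle_edges cs" "{v4, v1} \<notin> cycle_edges cs"
        using d unfolding ce by (auto simp: 2 doubleton_eq_iff)
      show "{v0, v2} \<notin> E" "{v1, v3} \<notin> E" "{v2, v4} \<notin> E" "{v3, v0} \<notin> E" "{v4, v1} \<notin> E"
        using chord n by (simp_all add: 2)
      show "distinct [v0, v1, v2, v3, v4]" using d by (simp only: 2)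
      show "{v0, v1} \<in> E" "{v1, v2} \<in> E" "{v2, v3} \<in> E" "{v3, v4} \<in> E" "{v4, v0} \<in> E"
        using sub unfolding ce by blast+
    qed
  qed
qed

section \<open>Links\<close>

text \<open>A graph that is a union of blocks indexed by the edges of the defining graph, where two blocks
  meet only in the vertices \<open>gv s True\<close> and \<open>gv s False\<close>. A short induced cycle that runs through
  several blocks projects to a short cycle in the defining graph, whose labels are too large for
  that.\<close>

locale block_graph =
  fixes V :: "'s set" and E :: "'s set set" and m :: "'s set \<Rightarrow> nat"
    and adj :: "'v \<Rightarrow> 'v \<Rightarrow> bool" and Lk :: "'s set \<Rightarrow> 'v set" and gv :: "'s \<Rightarrow> bool \<Rightarrow> 'v"
  assumes large: "almost_large_type V E m" and graph: "simple_graph V E"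
    and adj_sym: "adj y y' \<Longrightarrow> adj y' y"
    and adj_block: "adj y y' \<Longrightarrow> \<exists>e\<in>E. y \<in> Lk e \<and> y' \<in> Lk e"
    and block_meet: "\<lbrakk>e \<in> E; e' \<in> E; e \<noteq> e'; y \<in> Lk e; y \<in> Lk e'\<rbrakk> \<Longrightarrow> \<exists>s g. s \<in> e \<and> s \<in> e' \<and> y = gv s g"
    and gv_nonadj: "s \<in> V \<Longrightarrow> t \<in> V \<Longrightarrow> \<not> adj (gv s g) (gv t g)"
    and gv_opposite: "s \<in> V \<Longrightarrow> \<not> adj (gv s g) (gv s (\<not> g))"
    and gv_common: "\<lbrakk>e \<in> E; s \<in> V; y \<in> Lk e; gv s True \<in> Lk e; gv s False \<in> Lk e; adj y (gv s True); adj y (gv s False)\<rbrakk> \<Longrightarrow> False"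
    and gv_label: "s \<in> V \<Longrightarrow> t \<in> V \<Longrightarrow> adj (gv s g) (gv t h) \<Longrightarrow> m {s, t} = 2"
    and block_square: "\<And>v0 v1 v2 v3. \<lbrakk>e \<in> E; {v0, v1, v2, v3} \<subseteq> Lk e; distinct [v0, v1, v2, v3];
      adj v0 v1; adj v1 v2; adj v2 v3; adj v3 v0; \<not> adj v0 v2; \<not> adj v1 v3\<rbrakk> \<Longrightarrow> False"
    and block_pentagon: "\<And>v0 v1 v2 v3 v4. \<lbrakk>e \<in> E; {v0, v1, v2, v3, v4} \<subseteq> Lk e; distinct [v0, v1, v2, v3, v4];
      adj v0 v1; adj v1 v2; adj v2 v3; adj v3 v4; adj v4 v0; \<not> adj v0 v2; \<not> adj v1 v3; \<not> adj v2 v4; \<not> adj v3 v0; \<not> adj v4 v1\<rbrakk> \<Longrightarrow> False"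
begin

lemma edge_sub: "e \<in> E \<Longrightarrow> s \<in> e \<Longrightarrow> s \<in> V"
  using graph by (auto simp: simple_graph_def)

lemma edge_pair: "e \<in> E \<Longrightarrow> s \<in> e \<Longrightarrow> t \<in> e \<Longrightarrow> s \<noteq> t \<Longrightarrow> e = {s, t}"
  using graph unfolding simple_graph_def by (metis card_2_iff insertE insert_commute singletonD)

text \<open>Distance at most two. Any two vertices of a cycle of length at most five are this close,
  whichever of them turn out to be the places where the block changes.\<close>

definition close :: "'v \<Rightarrow> 'v \<Rightarrow> bool" where
  "close u w \<longleftrightarrow> adj u w \<or> (\<exists>y. adj u y \<and> adj y w)"

lemma close_adj: "adj u w \<Longrightarrow> close u w" by (simp add: close_def)
lemma close_adj2: "adj u y \<Longrightarrow> adj y w \<Longrightarrow> close u w" by (auto simp: close_def)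

text \<open>\<open>gv s True\<close> and \<open>gv s False\<close> have no common neighbour. Within
  one block this is \<open>gv_common\<close>; a common neighbour reached through two blocks would
  itself be some \<open>gv t k\<close> and share its sign with one of the two.\<close>

lemma close_gv:
  assumes "close (gv s g) (gv t h)" "s \<in> V" "t \<in> V" "gv s g \<noteq> gv t h" shows "s \<noteq> t"
proof
  assume st: "s = t"
  then have h: "h = (\<not> g)" using assms(4) by (cases h; cases g) auto
  then obtain y where y: "adj (gv s g) y" "adj y (gv s (\<not> g))"
    using assms(1,2) gv_opposite st unfolding close_def by blast
  obtain e where e: "e \<in> E" "gv s g \<in> Lk e" "y \<in> Lk e" using adj_block[OF y(1)] by blast
  obtain e' where e': "e' \<in> E" "y \<in> Lk e'" "gv s (\<not> g) \<in> Lk e'" using adj_block[OF y(2)] by blast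
  show False
  proof (cases "e = e'")
    case True
    then show False using gv_common[OF e(1) assms(2) e(3)] e e' y adj_sym by (cases g) auto
  next
    case False
    then obtain t k where t: "t \<in> e" "y = gv t k" using block_meet e e' by blast
    then have "t \<in> V" using edge_sub e(1) by blast
    then show False using gv_nonadj[of s t k] gv_nonadj[of t s k] assms(2) y t(2) by (cases "k = g") auto
  qed
qed

text \<open>The two vertices belong to different generators, both of which lie in \<open>X\<close>
  and in \<open>Y\<close>; an edge of the defining graph is determined by its ends.\<close>

lemma close_two_blocks:
  assumes "close u w" "u \<noteq> w" "X \<in> E" "Y \<in> E" "u \<in> Lk X" "u \<in> Lk Y" "w \<in> Lk X" "w \<in> Lk Y"
  shows "X = Y"
proof (rule ccontr)
  assume XY: "X \<noteq> Y"
  obtain s g where s: "s \<in> X" "s \<in> Y" "u = gv s g" using block_meet[OF assms(3,4) XY assms(5,6)] by blast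
  obtain t h where t: "t \<in> X" "t \<in> Y" "w = gv t h" using block_meet[OF assms(3,4) XY assms(7,8)] by blast
  have "s \<noteq> t" using close_gv assms(1,2) s t edge_sub[OF assms(3)] by blast
  then show False using edge_pair assms(3,4) s t XY by metis
qed

text \<open>Three blocks that meet cyclically yield three generators spanning a triangle of the
  defining graph. As \<open>u\<close> and \<open>v\<close> are adjacent, one of its edges has label
  two.\<close>

lemma close_triangle:
  assumes "close u v" "close v w" "close w u" "adj u v" "distinct [u, v, w]"
    "X \<in> E" "Y \<in> E" "Z \<in> E" "u \<in> Lk X" "v \<in> Lk X" "v \<in> Lk Y" "w \<in> Lk Y" "w \<in> Lk Z" "u \<in> Lk Z"
    "X \<noteq> Y" "Y \<noteq> Z" "Z \<noteq> X"
  shows False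
proof -
  obtain s g where s: "s \<in> X" "s \<in> Z" "u = gv s g" using block_meet[of X Z u] assms by metis
  obtain t h where t: "t \<in> X" "t \<in> Y" "v = gv t h" using block_meet[of X Y v] assms by metis
  obtain r k where r: "r \<in> Y" "r \<in> Z" "w = gv r k" using block_meet[of Y Z w] assms by metis
  have V: "s \<in> V" "t \<in> V" "r \<in> V" using s t r edge_sub assms(6-8) by blast+
  have d: "s \<noteq> t" "t \<noteq> r" "r \<noteq> s"
    using close_gv[of s g t h] close_gv[of t h r k] close_gv[of r k s g] assms(1-3,5) s(3) t(3) r(3) V by auto
  have e: "X = {s, t}" "Y = {t, r}" "Z = {r, s}" using edge_pair assms(6-8) s t r d by blast+
  note ce = cycle_edges_explicit(1)[of s t r]
  have "simple_cycle V E [s, t, r]" unfolding simple_cycle_def ce using d V e assms(6-8) by auto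
  moreover have "length [s, t, r] = 3" by simp
  ultimately have "\<forall>e\<in>cycle_edges [s, t, r]. m e \<noteq> 2" using large unfolding almost_large_type_def by blast
  then have "m {s, t} \<noteq> 2" unfolding ce by simp
  then show False using gv_label assms(4) s t V by blast
qed

text \<open>The four blocks form a square of the defining graph, and the three adjacent pairs give
  it three edges with label two.\<close>

lemma close_square:
  assumes cl: "close u v" "close v w" "close w x" "close x u" "close u w" "close v x"
    and adj: "adj u v" "adj v w" "adj w x" and di: "distinct [u, v, w, x]"
    and E: "X \<in> E" "Y \<in> E" "Z \<in> E" "T \<in> E"
    and Lk: "u \<in> Lk X" "v \<in> Lk X" "v \<in> Lk Y" "w \<in> Lk Y" "w \<in> Lk Z" "x \<in> Lk Z" "x \<in> Lk T" "u \<in> Lk T"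
    and ne: "X \<noteq> Y" "Y \<noteq> Z" "Z \<noteq> T" "T \<noteq> X"
  shows False
proof -
  obtain s g where s: "s \<in> X" "s \<in> T" "u = gv s g" using block_meet[of X T u] E Lk ne by metis
  obtain t h where t: "t \<in> X" "t \<in> Y" "v = gv t h" using block_meet[of X Y v] E Lk ne by metis
  obtain r k where r: "r \<in> Y" "r \<in> Z" "w = gv r k" using block_meet[of Y Z w] E Lk ne by metis
  obtain q l where q: "q \<in> Z" "q \<in> T" "x = gv q l" using block_meet[of Z T x] E Lk ne by metis
  have V: "s \<in> V" "t \<in> V" "r \<in> V" "q \<in> V" using s t r q edge_sub E by blast+
  have d: "s \<noteq> t" "t \<noteq> r" "r \<noteq> q" "q \<noteq> s" "s \<noteq> r" "t \<noteq> q"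
    using close_gv[of s g t h] close_gv[of t h r k] close_gv[of r k q l] close_gv[of q l s g]
      close_gv[of s g r k] close_gv[of t h q l] cl di s(3) t(3) r(3) q(3) V by auto
  have e: "X = {s, t}" "Y = {t, r}" "Z = {r, q}" "T = {q, s}" using edge_pair E s t r q d by blast+
  note ce = cycle_edges_explicit(2)[of s t r q]
  have cyc: "simple_cycle V E [s, t, r, q]" unfolding simple_cycle_def ce using d V e E by auto
  have m: "m {s, t} = 2" "m {t, r} = 2" "m {r, q} = 2" using gv_label adj s t r q V by blast+
  have "{{s, t}, {t, r}, {r, q}} \<subseteq> {e \<in> cycle_edges [s, t, r, q]. m e = 2}" using m by (auto simp: ce)
  moreover have "card {{s, t}, {t, r}, {r, q}} = 3" using d by (auto simp: doubleton_eq_iff card_insert_if)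
  moreover have "finite {e \<in> cycle_edges [s, t, r, q]. m e = 2}" by (simp add: ce)
  ultimately have "3 \<le> card {e \<in> cycle_edges [s, t, r, q]. m e = 2}"
    using card_mono[of "{e \<in> cycle_edges [s, t, r, q]. m e = 2}" "{{s, t}, {t, r}, {r, q}}"] by linarith
  moreover have "length [s, t, r, q] = 4" by simp
  then have "card {e \<in> cycle_edges [s, t, r, q]. m e = 2} < 3"
    using large cyc unfolding almost_large_type_def by blast
  ultimately show False by simp
qed

lemma gv_sign: "adj (gv s g) (gv t h) \<Longrightarrow> s \<in> V \<Longrightarrow> t \<in> V \<Longrightarrow> g \<noteq> h"
  using gv_nonadj by blast

text \<open>Adjacent vertices of this kind have opposite signs, and signs cannot alternate around an
  odd cycle.\<close>

lemma gv_pentagon: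
  assumes "adj u v" "adj v w" "adj w x" "adj x y" "adj y u"
    "X \<in> E" "Y \<in> E" "Z \<in> E" "T \<in> E" "U \<in> E"
    "u \<in> Lk X" "v \<in> Lk X" "v \<in> Lk Y" "w \<in> Lk Y" "w \<in> Lk Z" "x \<in> Lk Z" "x \<in> Lk T" "y \<in> Lk T" "y \<in> Lk U" "u \<in> Lk U"
    "X \<noteq> Y" "Y \<noteq> Z" "Z \<noteq> T" "T \<noteq> U" "U \<noteq> X"
  shows False
proof -
  obtain s0 g0 where 0: "s0 \<in> X" "u = gv s0 g0" using block_meet[of X U u] assms by metis
  obtain s1 g1 where 1: "s1 \<in> X" "v = gv s1 g1" using block_meet[of X Y v] assms by metis
  obtain s2 g2 where 2: "s2 \<in> Y" "w = gv s2 g2" using block_meet[of Y Z w] assms by metis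
  obtain s3 g3 where 3: "s3 \<in> Z" "x = gv s3 g3" using block_meet[of Z T x] assms by metis
  obtain s4 g4 where 4: "s4 \<in> T" "y = gv s4 g4" using block_meet[of T U y] assms by metis
  have V: "s0 \<in> V" "s1 \<in> V" "s2 \<in> V" "s3 \<in> V" "s4 \<in> V" using 0 1 2 3 4 edge_sub assms(6-10) by blast+
  have "g0 \<noteq> g1" "g1 \<noteq> g2" "g2 \<noteq> g3" "g3 \<noteq> g4" "g4 \<noteq> g0"
    using gv_sign[of s0 g0 s1 g1] gv_sign[of s1 g1 s2 g2] gv_sign[of s2 g2 s3 g3] gv_sign[of s3 g3 s4 g4]
      gv_sign[of s4 g4 s0 g0] assms(1-5) 0(2) 1(2) 2(2) 3(2) 4(2) V by simp_all
  then show False by blast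
qed

lemma no_induced_square:
  assumes di: "distinct [v0, v1, v2, v3]"
    and adj: "adj v0 v1" "adj v1 v2" "adj v2 v3" "adj v3 v0"
    and nadj: "\<not> adj v0 v2" "\<not> adj v1 v3"
  shows False
proof -
  obtain e0 where e0: "e0 \<in> E" "v0 \<in> Lk e0" "v1 \<in> Lk e0" using adj_block[OF adj(1)] by blast
  obtain e1 where e1: "e1 \<in> E" "v1 \<in> Lk e1" "v2 \<in> Lk e1" using adj_block[OF adj(2)] by blast
  obtain e2 where e2: "e2 \<in> E" "v2 \<in> Lk e2" "v3 \<in> Lk e2" using adj_block[OF adj(3)] by blast
  obtain e3 where e3: "e3 \<in> E" "v3 \<in> Lk e3" "v0 \<in> Lk e3" using adj_block[OF adj(4)] by blast
  note adj' = adj adj[THEN adj_sym]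
  have cl: "close v0 v1" "close v0 v2" "close v0 v3" "close v1 v0" "close v1 v2" "close v1 v3" "close v2 v0" "close v2 v1" "close v2 v3" "close v3 v0" "close v3 v1" "close v3 v2"
    using adj' by (auto intro: close_adj close_adj2)
  note E = e0 e1 e2 e3
  \<comment> \<open>The block changes at a vertex if the edges before and after it are assigned to
    different blocks. A single change is impossible around a cycle; the cases are the patterns with
    two, three and four changes, and only the pattern without changes remains.\<close>
  have c1: False if "e3 \<noteq> e0" "e0 \<noteq> e1" "e1 = e2" "e2 = e3"
    using close_two_blocks[of v0 v1 e0 e1] that E di adj' cl by auto
  have c2: False if "e3 \<noteq> e0" "e0 = e1" "e1 \<noteq> e2" "e2 = e3"
    using close_two_blocks[of v0 v2 e0 e2] that E di adj' cl by auto
  have c3: False if "e3 \<noteq> e0" "e0 = e1" "e1 = e2" "e2 \<noteq> e3"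
    using close_two_blocks[of v0 v3 e0 e3] that E di adj' cl by auto
  have c4: False if "e3 = e0" "e0 \<noteq> e1" "e1 \<noteq> e2" "e2 = e3"
    using close_two_blocks[of v1 v2 e1 e2] that E di adj' cl by auto
  have c5: False if "e3 = e0" "e0 \<noteq> e1" "e1 = e2" "e2 \<noteq> e3"
    using close_two_blocks[of v1 v3 e1 e3] that E di adj' cl by auto
  have c6: False if "e3 = e0" "e0 = e1" "e1 \<noteq> e2" "e2 \<noteq> e3"
    using close_two_blocks[of v2 v3 e2 e3] that E di adj' cl by auto
  have c7: False if "e3 \<noteq> e0" "e0 \<noteq> e1" "e1 \<noteq> e2" "e2 = e3"
    using close_triangle[of v0 v1 v2 e0 e1 e2] that E di adj' cl by auto
  have c8: False if "e3 \<noteq> e0" "e0 \<noteq> e1" "e1 = e2" "e2 \<noteq> e3"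
    using close_triangle[of v0 v1 v3 e0 e1 e3] that E di adj' cl by auto
  have c9: False if "e3 \<noteq> e0" "e0 = e1" "e1 \<noteq> e2" "e2 \<noteq> e3"
    using close_triangle[of v2 v3 v0 e2 e3 e0] that E di adj' cl by auto
  have c10: False if "e3 = e0" "e0 \<noteq> e1" "e1 \<noteq> e2" "e2 \<noteq> e3"
    using close_triangle[of v1 v2 v3 e1 e2 e3] that E di adj' cl by auto
  have c11: False if "e3 \<noteq> e0" "e0 \<noteq> e1" "e1 \<noteq> e2" "e2 \<noteq> e3"
    using close_square[of v1 v2 v3 v0 e1 e2 e3 e0] that E di adj' cl by auto
  have "e1 = e0 \<and> e2 = e0 \<and> e3 = e0"
    using c1 c2 c3 c4 c5 c6 c7 c8 c9 c10 c11 by (smt (verit))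
  then have "{v0, v1, v2, v3} \<subseteq> Lk e0" using E by auto
  then show False using block_square[of e0 v0 v1 v2 v3] e0 di adj nadj by blast
qed

lemma no_induced_pentagon:
  assumes di: "distinct [v0, v1, v2, v3, v4]"
    and adj: "adj v0 v1" "adj v1 v2" "adj v2 v3" "adj v3 v4" "adj v4 v0"
    and nadj: "\<not> adj v0 v2" "\<not> adj v1 v3" "\<not> adj v2 v4" "\<not> adj v3 v0" "\<not> adj v4 v1"
  shows False
proof -
  obtain e0 where e0: "e0 \<in> E" "v0 \<in> Lk e0" "v1 \<in> Lk e0" using adj_block[OF adj(1)] by blast
  obtain e1 where e1: "e1 \<in> E" "v1 \<in> Lk e1" "v2 \<in> Lk e1" using adj_block[OF adj(2)] by blast
  obtain e2 where e2: "e2 \<in> E" "v2 \<in> Lk e2" "v3 \<in> Lk e2" using adj_block[OF adj(3)] by blast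
  obtain e3 where e3: "e3 \<in> E" "v3 \<in> Lk e3" "v4 \<in> Lk e3" using adj_block[OF adj(4)] by blast
  obtain e4 where e4: "e4 \<in> E" "v4 \<in> Lk e4" "v0 \<in> Lk e4" using adj_block[OF adj(5)] by blast
  note adj' = adj adj[THEN adj_sym]
  have cl: "close v0 v1" "close v0 v2" "close v0 v3" "close v0 v4" "close v1 v0" "close v1 v2" "close v1 v3" "close v1 v4" "close v2 v0" "close v2 v1" "close v2 v3" "close v2 v4" "close v3 v0" "close v3 v1" "close v3 v2" "close v3 v4" "close v4 v0" "close v4 v1" "close v4 v2" "close v4 v3"
    using adj' by (auto intro: close_adj close_adj2)
  note E = e0 e1 e2 e3 e4
  \<comment> \<open>Among three changes on five vertices two are consecutive, and among four changes
    there are three consecutive pairs. The arguments of the triangle and square lemmas are rotated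
    so that these adjacencies come first. Five changes fall to the sign argument.\<close>
  have c1: False if "e4 \<noteq> e0" "e0 \<noteq> e1" "e1 = e2" "e2 = e3" "e3 = e4"
    using close_two_blocks[of v0 v1 e0 e1] that E di adj' cl by auto
  have c2: False if "e4 \<noteq> e0" "e0 = e1" "e1 \<noteq> e2" "e2 = e3" "e3 = e4"
    using close_two_blocks[of v0 v2 e0 e2] that E di adj' cl by auto
  have c3: False if "e4 \<noteq> e0" "e0 = e1" "e1 = e2" "e2 \<noteq> e3" "e3 = e4"
    using close_two_blocks[of v0 v3 e0 e3] that E di adj' cl by auto
  have c4: False if "e4 \<noteq> e0" "e0 = e1" "e1 = e2" "e2 = e3" "e3 \<noteq> e4"
    using close_two_blocks[of v0 v4 e0 e4] that E di adj' cl by auto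
  have c5: False if "e4 = e0" "e0 \<noteq> e1" "e1 \<noteq> e2" "e2 = e3" "e3 = e4"
    using close_two_blocks[of v1 v2 e1 e2] that E di adj' cl by auto
  have c6: False if "e4 = e0" "e0 \<noteq> e1" "e1 = e2" "e2 \<noteq> e3" "e3 = e4"
    using close_two_blocks[of v1 v3 e1 e3] that E di adj' cl by auto
  have c7: False if "e4 = e0" "e0 \<noteq> e1" "e1 = e2" "e2 = e3" "e3 \<noteq> e4"
    using close_two_blocks[of v1 v4 e1 e4] that E di adj' cl by auto
  have c8: False if "e4 = e0" "e0 = e1" "e1 \<noteq> e2" "e2 \<noteq> e3" "e3 = e4"
    using close_two_blocks[of v2 v3 e2 e3] that E di adj' cl by auto
  have c9: False if "e4 = e0" "e0 = e1" "e1 \<noteq> e2" "e2 = e3" "e3 \<noteq> e4"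
    using close_two_blocks[of v2 v4 e2 e4] that E di adj' cl by auto
  have c10: False if "e4 = e0" "e0 = e1" "e1 = e2" "e2 \<noteq> e3" "e3 \<noteq> e4"
    using close_two_blocks[of v3 v4 e3 e4] that E di adj' cl by auto
  have c11: False if "e4 \<noteq> e0" "e0 \<noteq> e1" "e1 \<noteq> e2" "e2 = e3" "e3 = e4"
    using close_triangle[of v0 v1 v2 e0 e1 e2] that E di adj' cl by auto
  have c12: False if "e4 \<noteq> e0" "e0 \<noteq> e1" "e1 = e2" "e2 \<noteq> e3" "e3 = e4"
    using close_triangle[of v0 v1 v3 e0 e1 e3] that E di adj' cl by auto
  have c13: False if "e4 \<noteq> e0" "e0 \<noteq> e1" "e1 = e2" "e2 = e3" "e3 \<noteq> e4"
    using close_triangle[of v0 v1 v4 e0 e1 e4] that E di adj' cl by auto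
  have c14: False if "e4 \<noteq> e0" "e0 = e1" "e1 \<noteq> e2" "e2 \<noteq> e3" "e3 = e4"
    using close_triangle[of v2 v3 v0 e2 e3 e0] that E di adj' cl by auto
  have c15: False if "e4 \<noteq> e0" "e0 = e1" "e1 \<noteq> e2" "e2 = e3" "e3 \<noteq> e4"
    using close_triangle[of v4 v0 v2 e4 e0 e2] that E di adj' cl by auto
  have c16: False if "e4 \<noteq> e0" "e0 = e1" "e1 = e2" "e2 \<noteq> e3" "e3 \<noteq> e4"
    using close_triangle[of v3 v4 v0 e3 e4 e0] that E di adj' cl by auto
  have c17: False if "e4 = e0" "e0 \<noteq> e1" "e1 \<noteq> e2" "e2 \<noteq> e3" "e3 = e4"
    using close_triangle[of v1 v2 v3 e1 e2 e3] that E di adj' cl by auto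
  have c18: False if "e4 = e0" "e0 \<noteq> e1" "e1 \<noteq> e2" "e2 = e3" "e3 \<noteq> e4"
    using close_triangle[of v1 v2 v4 e1 e2 e4] that E di adj' cl by auto
  have c19: False if "e4 = e0" "e0 \<noteq> e1" "e1 = e2" "e2 \<noteq> e3" "e3 \<noteq> e4"
    using close_triangle[of v3 v4 v1 e3 e4 e1] that E di adj' cl by auto
  have c20: False if "e4 = e0" "e0 = e1" "e1 \<noteq> e2" "e2 \<noteq> e3" "e3 \<noteq> e4"
    using close_triangle[of v2 v3 v4 e2 e3 e4] that E di adj' cl by auto
  have c21: False if "e4 \<noteq> e0" "e0 \<noteq> e1" "e1 \<noteq> e2" "e2 \<noteq> e3" "e3 = e4"
    using close_square[of v0 v1 v2 v3 e0 e1 e2 e3] that E di adj' cl by auto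
  have c22: False if "e4 \<noteq> e0" "e0 \<noteq> e1" "e1 \<noteq> e2" "e2 = e3" "e3 \<noteq> e4"
    using close_square[of v4 v0 v1 v2 e4 e0 e1 e2] that E di adj' cl by auto
  have c23: False if "e4 \<noteq> e0" "e0 \<noteq> e1" "e1 = e2" "e2 \<noteq> e3" "e3 \<noteq> e4"
    using close_square[of v3 v4 v0 v1 e3 e4 e0 e1] that E di adj' cl by auto
  have c24: False if "e4 \<noteq> e0" "e0 = e1" "e1 \<noteq> e2" "e2 \<noteq> e3" "e3 \<noteq> e4"
    using close_square[of v2 v3 v4 v0 e2 e3 e4 e0] that E di adj' cl by auto
  have c25: False if "e4 = e0" "e0 \<noteq> e1" "e1 \<noteq> e2" "e2 \<noteq> e3" "e3 \<noteq> e4"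
    using close_square[of v1 v2 v3 v4 e1 e2 e3 e4] that E di adj' cl by auto
  have c26: False if "e4 \<noteq> e0" "e0 \<noteq> e1" "e1 \<noteq> e2" "e2 \<noteq> e3" "e3 \<noteq> e4"
    using gv_pentagon[of v0 v1 v2 v3 v4 e0 e1 e2 e3 e4] that E di adj' cl by auto
  have "e1 = e0 \<and> e2 = e0 \<and> e3 = e0 \<and> e4 = e0"
    using c1 c2 c3 c4 c5 c6 c7 c8 c9 c10 c11 c12 c13 c14 c15 c16 c17 c18 c19 c20 c21 c22 c23 c24 c25 c26 by (smt (verit))
  then have "{v0, v1, v2, v3, v4} \<subseteq> Lk e0" using E by auto
  then show False using block_pentagon[of e0 v0 v1 v2 v3 v4] e0 di adj nadj by blast
qed

end

section \<open>The link of a group element\<close>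

context artin_edge
begin

lemma bedge_Elt_supported:
  assumes v: "v \<in> carrier AG" "p \<in> carrier AG" and e: "bedge (Elt v) (Elt p)"
  shows "inv\<^bsub>AG\<^esub> v \<cdot> p \<in> supported {a, b}"
proof -
  have "inv\<^bsub>AG\<^esub> v \<cdot> p \<cdot> D [^]\<^bsub>AG\<^esub> (ell v - ell p) \<in> S"
    using bedge_spine[of v 0 p 0] v e by (simp add: spine_def)
  then have "\<one>\<^bsub>AG\<^esub> \<cdot> (inv\<^bsub>AG\<^esub> v \<cdot> p) \<cdot> D [^]\<^bsub>AG\<^esub> (ell v - ell p) \<in> supported {a, b}"
    using S_supported v by simp
  moreover have "\<one>\<^bsub>AG\<^esub> \<in> supported {a, b}" using Dpow_supported[of 0] by simp
  ultimately show ?thesis using supported_cancel Dpow_supported v by blast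
qed

text \<open>Carries the neighbours of \<open>v\<close> in the block into \<open>S\<close>. It is
  left division by \<open>kap (Elt v)\<close> followed by conjugation by a power of
  \<open>D\<close>, which undoes the possible exchange of the two letters.\<close>

definition psi :: "'s word set \<Rightarrow> 's artin_vertex \<Rightarrow> 's word set" where
  "psi v y = inv\<^bsub>AG\<^esub> v \<cdot> kap y \<cdot> D [^]\<^bsub>AG\<^esub> (ell v)"

lemma psi_S:
  assumes v: "v \<in> carrier AG" and e: "bedge (Elt v) y" shows "psi v y \<in> S"
proof -
  have y: "kap y \<in> carrier AG" and s: "inv\<^bsub>AG\<^esub> kap (Elt v) \<cdot> kap y \<in> S"
    using e kap_closed by (auto simp: bedge_def adjS_def)
  have "D [^]\<^bsub>AG\<^esub> (- ell v) \<cdot> (inv\<^bsub>AG\<^esub> kap (Elt v) \<cdot> kap y) \<cdot> D [^]\<^bsub>AG\<^esub> (- (- ell v)) \<in> S"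
    using s by (rule S_conj_pow)
  also have "D [^]\<^bsub>AG\<^esub> (- ell v) \<cdot> (inv\<^bsub>AG\<^esub> kap (Elt v) \<cdot> kap y) \<cdot> D [^]\<^bsub>AG\<^esub> (- (- ell v)) = psi v y"
    using v y by (simp add: psi_def AG.inv_mult_group inv_Dpow AG.m_assoc Dpow_merge)
  finally show ?thesis .
qed

lemma psi_adjS:
  assumes v: "v \<in> carrier AG" and e: "bedge y z" shows "adjS (psi v y) (psi v z)"
proof -
  have y: "kap y \<in> carrier AG" "kap z \<in> carrier AG" and s: "inv\<^bsub>AG\<^esub> kap y \<cdot> kap z \<in> S"
    using e kap_closed by (auto simp: bedge_def adjS_def)
  have "D [^]\<^bsub>AG\<^esub> (- ell v) \<cdot> (inv\<^bsub>AG\<^esub> kap y \<cdot> kap z) \<cdot> D [^]\<^bsub>AG\<^esub> (- (- ell v)) \<in> S"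
    using s by (rule S_conj_pow)
  also have "D [^]\<^bsub>AG\<^esub> (- ell v) \<cdot> (inv\<^bsub>AG\<^esub> kap y \<cdot> kap z) \<cdot> D [^]\<^bsub>AG\<^esub> (- (- ell v)) = inv\<^bsub>AG\<^esub> psi v y \<cdot> psi v z"
    using v y by (simp add: psi_def AG.inv_mult_group inv_Dpow AG.m_assoc AG.inv_cancel_left)
  finally show ?thesis by (simp add: adjS_def)
qed

lemma psi_out: "v \<in> carrier AG \<Longrightarrow> psi v (Elt (v \<cdot> lt x)) = lt x \<cdot> inv\<^bsub>AG\<^esub> D"
  using Dpow_add[of "- (ell v + 1)" "ell v"]
  by (auto simp: psi_def ell_mult lt_def AG.m_assoc AG.inv_cancel_left AG.int_pow_neg)

lemma psi_in: "v \<in> carrier AG \<Longrightarrow> psi v (Elt (v \<cdot> inv\<^bsub>AG\<^esub> lt x)) = inv\<^bsub>AG\<^esub> lt x \<cdot> D"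
  using Dpow_add[of "- (ell v - 1)" "ell v"]
  by (auto simp: psi_def ell_mult ell_inv lt_def AG.m_assoc AG.inv_cancel_left)

lemma bedge_no_common:
  assumes v: "v \<in> carrier AG" and s: "s \<in> {a, b}" and y: "bedge (Elt v) y"
    "bedge y (Elt (v \<cdot> gen s))" "bedge y (Elt (v \<cdot> inv\<^bsub>AG\<^esub> gen s))"
  shows False
proof -
  obtain x where x: "gen s = lt x" using s gen_lt by auto
  show False
    using in_out_no_common[OF psi_S[OF v y(1)], of x] psi_adjS[OF v y(2)] psi_adjS[OF v y(3)]
    unfolding x psi_out[OF v] psi_in[OF v] by blast
qed

end

context artin_graph
begin

lemma gen2_eq:
  assumes "gen s \<cdot> gen t = gen c \<cdot> gen d" "c \<noteq> d" "s \<in> V" "t \<in> V" "c \<in> V" "d \<in> V"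
  shows "{c, d} = {s, t}"
proof -
  have "weq [(s, True), (t, True)] [(c, True), (d, True)]"
    using assms el_eq_iff[of "[(s, True), (t, True)]" "[(c, True), (d, True)]"]
    by (simp add: gen_def el_mult words_Cons)
  from weq_pair_support[OF this assms(2)] show ?thesis using assms(2) by auto
qed

text \<open>Cayley edges change the length by one. The only other edges between group elements are
  diagonals of square cells, which change it by two; the length tells the two kinds apart.\<close>

lemma Elt_edge:
  assumes p: "p \<in> carrier AG" "q \<in> carrier AG" and e: "{Elt p, Elt q} \<in> Edges" and le: "ell p \<le> ell q"
  obtains s where "s \<in> V" "q = p \<cdot> gen s"
  | c d where "{c, d} \<in> E" "m {c, d} = 2" "q = p \<cdot> (gen c \<cdot> gen d)" "block_edge {c, d} (Elt p) (Elt q)"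
proof -
  have no: "p \<noteq> q \<cdot> gen s" if "s \<in> V" for s using that le p ell_mult[of q "gen s"] by auto
  from e show ?thesis
  proof (cases rule: Edges_cases)
    case (cayley h s)
    then show ?thesis using that(1)[of s] no[of s] by (auto simp: doubleton_eq_iff)
  next
    case (block e)
    then obtain c d where cd: "e = {c, d}" "{c, d} \<in> E" "artin_edge.bedge V E m c d (Elt p) (Elt q)"
      unfolding block_edge_def by blast
    interpret cd: artin_edge V E m c d using cd(2) by (rule artin_edgeI)
    have lt: "\<exists>s\<in>V. cd.lt x = gen s" for x by (cases x) (auto simp: cd.lt_def)
    have "p \<noteq> q \<cdot> cd.D" using le p ell_mult[of q cd.D] cd.n_ge_2 by auto
    then consider x where "q = p \<cdot> cd.lt x" | x where "p = q \<cdot> cd.lt x" | "cd.n = 2" "q = p \<cdot> cd.D"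
      using cd.bedge_Elt[OF p cd(3)] by blast
    then show ?thesis
    proof cases
      case 1 then show ?thesis using lt[of x] that(1) by metis
    next
      case 2 then show ?thesis using lt[of x] no by metis
    next
      case 3
      then show ?thesis using that(2)[of c d] cd block cd.D_gen by metis
    qed
  qed
qed

lemma Elt_edge_ell:
  assumes p: "p \<in> carrier AG" "q \<in> carrier AG" and e: "{Elt p, Elt q} \<in> Edges"
  shows "ell p \<noteq> ell q"
proof
  assume eq: "ell p = ell q"
  then have "ell p \<le> ell q" by simp
  from p e this show False
  proof (cases rule: Elt_edge)
    case (1 s) then show False using eq p ell_mult[of p "gen s"] by simp
  next
    case (2 c d)
    then show False using eq p edge_V[of c d] ell_mult[of p "gen c \<cdot> gen d"] ell_mult[of "gen c" "gen d"] by simp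
  qed
qed

lemma Elt_edge_two:
  assumes p: "p \<in> carrier AG" "q \<in> carrier AG" and e: "{Elt p, Elt q} \<in> Edges" and le: "ell p + 2 \<le> ell q"
  obtains c d where "{c, d} \<in> E" "m {c, d} = 2" "q = p \<cdot> (gen c \<cdot> gen d)" "block_edge {c, d} (Elt p) (Elt q)" "ell q = ell p + 2"
proof -
  have "ell p \<le> ell q" using le by simp
  from p e this show ?thesis
  proof (cases rule: Elt_edge)
    case (1 s) then show ?thesis using le p ell_mult[of p "gen s"] by simp
  next
    case (2 c d)
    then have "ell q = ell p + 2" using p edge_V[of c d] ell_mult[of p "gen c \<cdot> gen d"] ell_mult[of "gen c" "gen d"] by simp
    then show ?thesis using 2 that by blast
  qed
qed

lemma Elt_edge_one:
  assumes p: "p \<in> carrier AG" "q \<in> carrier AG" and e: "{Elt p, Elt q} \<in> Edges" and le: "ell q = ell p + 1"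
  obtains s where "s \<in> V" "q = p \<cdot> gen s"
proof -
  have "ell p \<le> ell q" using le by simp
  from p e this show ?thesis
  proof (cases rule: Elt_edge)
    case (1 s) then show ?thesis using that by blast
  next
    case (2 c d)
    then have "ell q = ell p + 2" using p edge_V[of c d] ell_mult[of p "gen c \<cdot> gen d"] ell_mult[of "gen c" "gen d"] by simp
    then show ?thesis using le by simp
  qed
qed

text \<open>Lengths along an edge differ by one or two, so the long side is a diagonal
  \<open>xy\<close> and the short sides are letters \<open>s\<close> and \<open>t\<close>. The
  equality of \<open>st\<close> and \<open>xy\<close> forces the same pair of letters: the triangle
  is half of one square cell.\<close>

lemma Elt_triangle_sorted:
  assumes c: "u \<in> carrier AG" "v \<in> carrier AG" "w \<in> carrier AG"
    and e: "{Elt u, Elt v} \<in> Edges" "{Elt v, Elt w} \<in> Edges" "{Elt u, Elt w} \<in> Edges"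
    and l: "ell u < ell v" "ell v < ell w"
  shows "\<exists>e\<in>E. block_edge e (Elt u) (Elt v) \<and> block_edge e (Elt v) (Elt w) \<and> block_edge e (Elt u) (Elt w)"
proof -
  have "ell u + 2 \<le> ell w" using l by simp
  then obtain x y where xy: "{x, y} \<in> E" "m {x, y} = 2" "w = u \<cdot> (gen x \<cdot> gen y)"
      "block_edge {x, y} (Elt u) (Elt w)" "ell w = ell u + 2"
    using c e by (elim Elt_edge_two[of u w])
  have "ell v = ell u + 1" "ell w = ell v + 1" using l xy(5) by simp_all
  then obtain s t where s: "s \<in> V" "v = u \<cdot> gen s" and t: "t \<in> V" "w = v \<cdot> gen t"
    using c e by (metis Elt_edge_one)
  have V: "x \<in> V" "y \<in> V" "x \<noteq> y" using edge_V[OF xy(1)] edge_neq[OF xy(1)] by auto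
  have "u \<cdot> (gen s \<cdot> gen t) = u \<cdot> (gen x \<cdot> gen y)"
    using xy(3) s t c by (simp add: AG.m_assoc)
  then have "gen s \<cdot> gen t = gen x \<cdot> gen y"
    using c s t V by (metis AG.inv_cancel_left(1) AG.m_closed gen_closed)
  then have st: "{x, y} = {s, t}" using gen2_eq V s t by blast
  interpret artin_edge V E m x y using xy(1) by (rule artin_edgeI)
  have "bedge (Elt u) (Elt v)" "bedge (Elt v) (Elt w)"
    unfolding s(2) t(2) using bedge_gen c(1,2) st s by blast+
  then show ?thesis using xy block_edge_iff[OF xy(1)] by blast
qed

lemma Elt_triangle:
  assumes c: "u \<in> carrier AG" "v \<in> carrier AG" "w \<in> carrier AG"
    and e: "{Elt u, Elt v} \<in> Edges" "{Elt v, Elt w} \<in> Edges" "{Elt u, Elt w} \<in> Edges"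
  shows "\<exists>e\<in>E. block_edge e (Elt u) (Elt v) \<and> block_edge e (Elt u) (Elt w)"
proof -
  have e': "{Elt v, Elt u} \<in> Edges" "{Elt w, Elt v} \<in> Edges" "{Elt w, Elt u} \<in> Edges"
    using e by (simp_all only: insert_commute)
  have "ell u \<noteq> ell v" "ell v \<noteq> ell w" "ell u \<noteq> ell w" using Elt_edge_ell c e by blast+
  then consider "ell u < ell v" "ell v < ell w" | "ell u < ell w" "ell w < ell v" | "ell v < ell u" "ell u < ell w"
    | "ell v < ell w" "ell w < ell u" | "ell w < ell u" "ell u < ell v" | "ell w < ell v" "ell v < ell u" by linarith
  then show ?thesis
  proof cases
    case 1 then show ?thesis using Elt_triangle_sorted[of u v w] c e e' by blast
  next
    case 2 then show ?thesis using Elt_triangle_sorted[of u w v] c e e' by blast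
  next
    case 3 then show ?thesis using Elt_triangle_sorted[of v u w] c e e' block_edge_sym by blast
  next
    case 4 then show ?thesis using Elt_triangle_sorted[of v w u] c e e' block_edge_sym by blast
  next
    case 5 then show ?thesis using Elt_triangle_sorted[of w u v] c e e' block_edge_sym by blast
  next
    case 6 then show ?thesis using Elt_triangle_sorted[of w v u] c e e' block_edge_sym by blast
  qed
qed

lemma vertex_cases:
  assumes "y \<in> artin_vertices V E m"
  obtains p where "p \<in> carrier AG" "y = Elt p" | g e j where "y = Inner g e j"
  using assms unfolding artin_vertices_def by auto

lemma Inner_common:
  assumes "{Inner g e j, x} \<in> Edges" "{Inner g e j, y} \<in> Edges" "{x, y} \<in> Edges"
  shows "block_edge e x (Inner g e j) \<and> block_edge e x y \<and> e \<in> E"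
proof -
  obtain a b where e: "e = {a, b}" "{a, b} \<in> E"
    using Inner_block_edge[OF assms(1)] unfolding block_edge_def by blast
  interpret artin_edge V E m a b using e(2) by (rule artin_edgeI)
  have "bedge (Inner g e j) x" "bedge (Inner g e j) y"
    using Inner_block_edge assms(1,2) block_edge_iff[OF e(2)] e by blast+
  then show ?thesis using bedge_common_Edges assms(3) bedge_sym block_edge_iff[OF e(2)] e by blast
qed

text \<open>An interior vertex determines the block of every triangle through it, and triangles of
  group elements are halves of square cells.\<close>

lemma Elt_link_block:
  assumes v: "v \<in> carrier AG" and e: "{Elt v, y} \<in> Edges" "{Elt v, z} \<in> Edges" "{y, z} \<in> Edges"
  shows "\<exists>e\<in>E. block_edge e (Elt v) y \<and> block_edge e (Elt v) z"
proof -
  have e': "{y, Elt v} \<in> Edges" "{z, Elt v} \<in> Edges" "{z, y} \<in> Edges" using e by (simp_all only: insert_commute)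
  from EdgesD(3)[OF e(1)] show ?thesis
  proof (cases rule: vertex_cases)
    case (2 g e0 j)
    then show ?thesis using Inner_common[of g e0 j "Elt v" z] e e' by blast
  next
    case y: (1 p)
    from EdgesD(3)[OF e(2)] show ?thesis
    proof (cases rule: vertex_cases)
      case (2 g e0 j)
      then show ?thesis using Inner_common[of g e0 j "Elt v" y] e e' by blast
    next
      case (1 q)
      then show ?thesis using Elt_triangle[OF v y(1) 1(1)] e y by blast
    qed
  qed
qed

definition gv :: "'s word set \<Rightarrow> 's \<Rightarrow> bool \<Rightarrow> 's artin_vertex" where
  "gv v s g = Elt (v \<cdot> (if g then gen s else inv\<^bsub>AG\<^esub> gen s))"

lemma ell_inv_gen: "s \<in> V \<Longrightarrow> ell (inv\<^bsub>AG\<^esub> gen s) = -1"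
proof -
  assume s: "s \<in> V"
  have "ell \<one>\<^bsub>AG\<^esub> = 0" unfolding el_Nil[symmetric] by simp
  then show ?thesis using s ell_mult[of "gen s" "inv\<^bsub>AG\<^esub> gen s"] by simp
qed

text \<open>An interior vertex lies in one block only. For a group element, the quotient by
  \<open>v\<close> lies in both parabolic subgroups: if it is a letter or its inverse, that letter
  belongs to both edges; if it is a diagonal, two letters are shared and the edges are
  equal.\<close>

lemma Elt_block_meet:
  assumes v: "v \<in> carrier AG" and e: "e \<in> E" "e' \<in> E" "e \<noteq> e'" and y: "block_edge e (Elt v) y" "block_edge e' (Elt v) y"
  shows "\<exists>s g. s \<in> e \<and> s \<in> e' \<and> y = gv v s g"
proof -
  have E: "{y, Elt v} \<in> Edges" using block_edge_Edges[OF y(1)] by (simp add: insert_commute)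
  obtain a b where ab: "e = {a, b}" "{a, b} \<in> E" "artin_edge.bedge V E m a b (Elt v) y"
    using y(1) unfolding block_edge_def by blast
  obtain c d where cd: "e' = {c, d}" "{c, d} \<in> E" "artin_edge.bedge V E m c d (Elt v) y"
    using y(2) unfolding block_edge_def by blast
  interpret ab: artin_edge V E m a b using ab(2) by (rule artin_edgeI)
  interpret cd: artin_edge V E m c d using cd(2) by (rule artin_edgeI)
  from block_edgeD(4)[OF y(1)] show ?thesis
  proof (cases rule: vertex_cases)
    case (2 g e0 j)
    then have "y \<in> ab.block" "y \<in> cd.block" using ab(3) cd(3) by (simp_all add: ab.bedge_def cd.bedge_def)
    then have "e0 = {a, b}" "e0 = {c, d}" unfolding 2 ab.block_def cd.block_def by auto
    then show ?thesis using ab(1) cd(1) e(3) by simp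
  next
    case (1 p)
    have sup: "inv\<^bsub>AG\<^esub> v \<cdot> p \<in> supported {c, d}" using cd.bedge_Elt_supported[OF v 1(1)] cd(3) 1 by simp
    then have sup': "inv\<^bsub>AG\<^esub> p \<cdot> v \<in> supported {c, d}"
      using supported_inv[OF sup] v 1(1) by (simp add: AG.inv_mult_group)
    have lt: "\<exists>s\<in>{a, b}. s \<in> V \<and> ab.lt x = gen s" for x by (cases x) (auto simp: ab.lt_def)
    have ltD: "\<exists>s\<in>{a, b}. s \<in> V \<and> s \<in> {c, d} \<and> ab.lt x = gen s" if "ab.lt x \<in> supported {c, d}" for x
      using lt[of x] that gen_supportedD by metis
    have D: "\<not> (ab.n = 2 \<and> ab.D \<in> supported {c, d})"
    proof
      assume D: "ab.n = 2 \<and> ab.D \<in> supported {c, d}"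
      then have "gen a \<cdot> gen b \<in> supported {c, d}" by (metis ab.D_gen)
      then have "a \<in> {c, d}" "b \<in> {c, d}" using gen2_supportedD[OF _ ab.a_V ab.b_V ab.a_neq_b] by blast+
      then show False using ab(1) cd(1) e(3) ab.a_neq_b by blast
    qed
    consider x where "p = v \<cdot> ab.lt x" | x where "v = p \<cdot> ab.lt x" | "ab.n = 2" "p = v \<cdot> ab.D" | "ab.n = 2" "v = p \<cdot> ab.D"
      using ab.bedge_Elt[OF v 1(1)] ab(3) 1 by blast
    then show ?thesis
    proof cases
      case a: 1
      have "inv\<^bsub>AG\<^esub> v \<cdot> p = ab.lt x" unfolding a using v by (simp add: AG.inv_cancel_left)
      then obtain s where s: "s \<in> {a, b}" "s \<in> V" "s \<in> {c, d}" "ab.lt x = gen s"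
        using ltD[of x] sup by metis
      then have "y = gv v s True" using 1(2) a by (simp add: gv_def)
      then show ?thesis using s ab cd by blast
    next
      case a: 2
      have "inv\<^bsub>AG\<^esub> p \<cdot> v = ab.lt x" unfolding a using 1 by (simp add: AG.inv_cancel_left)
      then obtain s where s: "s \<in> {a, b}" "s \<in> V" "s \<in> {c, d}" "ab.lt x = gen s"
        using ltD[of x] sup' by metis
      then have "y = gv v s False" using 1 a by (simp add: gv_def AG.m_assoc)
      then show ?thesis using s ab cd by blast
    next
      case a: 3
      have "inv\<^bsub>AG\<^esub> v \<cdot> p = ab.D" unfolding a(2) by (rule AG.inv_cancel_left(1)[OF v ab.D_closed])
      then have "ab.D \<in> supported {c, d}" using sup by metis
      then show ?thesis using D a(1) by blast
    next
      case a: 4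
      have "inv\<^bsub>AG\<^esub> p \<cdot> v = ab.D" unfolding a(2) by (rule AG.inv_cancel_left(1)[OF 1(1) ab.D_closed])
      then have "ab.D \<in> supported {c, d}" using sup' by metis
      then show ?thesis using D a(1) by blast
    qed
  qed
qed

lemma gv_ell: "v \<in> carrier AG \<Longrightarrow> s \<in> V \<Longrightarrow> ell (v \<cdot> (if g then gen s else inv\<^bsub>AG\<^esub> gen s)) = ell v + (if g then 1 else -1)"
  by (simp add: ell_mult ell_inv_gen)

lemma gv_edge_same:
  assumes v: "v \<in> carrier AG" and s: "s \<in> V" "t \<in> V" shows "{gv v s g, gv v t g} \<notin> Edges"
  using Elt_edge_ell[of "v \<cdot> (if g then gen s else inv\<^bsub>AG\<^esub> gen s)" "v \<cdot> (if g then gen t else inv\<^bsub>AG\<^esub> gen t)"]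
    gv_ell[OF v s(1), of g] gv_ell[OF v s(2), of g] v s by (auto simp: gv_def)

text \<open>The lengths of the ends differ by two, so the edge is a diagonal, and its two letters
  can only be \<open>t\<close> and \<open>s\<close>.\<close>

lemma gv_edge_opposite:
  assumes v: "v \<in> carrier AG" and s: "s \<in> V" "t \<in> V" and e: "{gv v t False, gv v s True} \<in> Edges"
  shows "{s, t} \<in> E \<and> m {s, t} = 2"
proof -
  let ?p = "v \<cdot> inv\<^bsub>AG\<^esub> gen t" and ?q = "v \<cdot> gen s"
  have pq: "?p \<in> carrier AG" "?q \<in> carrier AG" using v s by simp_all
  have "ell ?p + 2 \<le> ell ?q" using v s by (simp add: ell_mult ell_inv_gen)
  moreover have "{Elt ?p, Elt ?q} \<in> Edges" using e by (simp add: gv_def)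
  ultimately obtain c d where cd: "{c, d} \<in> E" "m {c, d} = 2" "?q = ?p \<cdot> (gen c \<cdot> gen d)"
    using pq by (elim Elt_edge_two[of ?p ?q])
  have V: "c \<in> V" "d \<in> V" "c \<noteq> d" using edge_V[OF cd(1)] edge_neq[OF cd(1)] by auto
  have "v \<cdot> gen s = v \<cdot> (inv\<^bsub>AG\<^esub> gen t \<cdot> (gen c \<cdot> gen d))" using cd(3) v s V by (simp add: AG.m_assoc)
  then have "gen s = inv\<^bsub>AG\<^esub> gen t \<cdot> (gen c \<cdot> gen d)"
    using v s V by (metis AG.inv_cancel_left(1) AG.inv_closed AG.m_closed gen_closed)
  then have "gen t \<cdot> gen s = gen c \<cdot> gen d" using s V by (simp add: AG.inv_cancel_left)
  then have "{c, d} = {t, s}" using gen2_eq V s by blast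
  then show ?thesis using cd by (simp add: insert_commute)
qed

lemma no_block_edge_square:
  assumes "block_edge e x v0" "block_edge e x v1" "block_edge e x v2" "block_edge e x v3"
    and "{v0, v1} \<in> Edges" "{v1, v2} \<in> Edges" "{v2, v3} \<in> Edges" "{v3, v0} \<in> Edges"
    and "{v0, v2} \<notin> Edges" "{v1, v3} \<notin> Edges" and "distinct [v0, v1, v2, v3]"
  shows False
proof -
  obtain a b where e: "e = {a, b}" "{a, b} \<in> E"
    using assms(1) unfolding block_edge_def by blast
  interpret artin_edge V E m a b using e(2) by (rule artin_edgeI)
  have x: "bedge x v0" "bedge x v1" "bedge x v2" "bedge x v3"
    using assms(1-4) unfolding e(1) block_edge_iff[OF e(2)] by blast+
  have n: "v0 \<noteq> v2" "v1 \<noteq> v3" using assms(11) by auto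
  show False
    by (rule no_block_square[OF x _ _ _ _ _ _ n])
      (use x assms(5-10) bedge_common_Edges bedge_Edges in blast)+
qed

lemma no_block_edge_pentagon:
  assumes "block_edge e x v0" "block_edge e x v1" "block_edge e x v2" "block_edge e x v3" "block_edge e x v4"
    and "{v0, v1} \<in> Edges" "{v1, v2} \<in> Edges" "{v2, v3} \<in> Edges" "{v3, v4} \<in> Edges" "{v4, v0} \<in> Edges"
    and "{v0, v2} \<notin> Edges" "{v1, v3} \<notin> Edges" "{v2, v4} \<notin> Edges" "{v3, v0} \<notin> Edges" "{v4, v1} \<notin> Edges"
    and "distinct [v0, v1, v2, v3, v4]"
  shows False
proof -
  obtain a b where e: "e = {a, b}" "{a, b} \<in> E"
    using assms(1) unfolding block_edge_def by blast
  interpret artin_edge V E m a b using e(2) by (rule artin_edgeI)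
  have x: "bedge x v0" "bedge x v1" "bedge x v2" "bedge x v3" "bedge x v4"
    using assms(1-5) unfolding e(1) block_edge_iff[OF e(2)] by blast+
  have n: "v0 \<noteq> v2" "v1 \<noteq> v3" "v2 \<noteq> v4" "v3 \<noteq> v0" "v4 \<noteq> v1" using assms(16) by auto
  show False
    by (rule no_block_pentagon[OF x _ _ _ _ _ _ _ _ _ _ n])
      (use x assms(6-15) bedge_common_Edges bedge_Edges in blast)+
qed

lemma six_large_linkI:
  assumes "\<And>v0 v1 v2 v3. \<lbrakk>distinct [v0, v1, v2, v3]; {x, v0} \<in> Edges; {x, v1} \<in> Edges; {x, v2} \<in> Edges; {x, v3} \<in> Edges;
      {v0, v1} \<in> Edges; {v1, v2} \<in> Edges; {v2, v3} \<in> Edges; {v3, v0} \<in> Edges; {v0, v2} \<notin> Edges; {v1, v3} \<notin> Edges\<rbrakk> \<Longrightarrow> False"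
    and "\<And>v0 v1 v2 v3 v4. \<lbrakk>distinct [v0, v1, v2, v3, v4]; {x, v0} \<in> Edges; {x, v1} \<in> Edges; {x, v2} \<in> Edges; {x, v3} \<in> Edges;
      {x, v4} \<in> Edges; {v0, v1} \<in> Edges; {v1, v2} \<in> Edges; {v2, v3} \<in> Edges; {v3, v4} \<in> Edges; {v4, v0} \<in> Edges;
      {v0, v2} \<notin> Edges; {v1, v3} \<notin> Edges; {v2, v4} \<notin> Edges; {v3, v0} \<notin> Edges; {v4, v1} \<notin> Edges\<rbrakk> \<Longrightarrow> False"
  shows "six_large (neighbours Edges x) (induced_edges Edges (neighbours Edges x))"
proof -
  have i: "{y, z} \<in> induced_edges Edges (neighbours Edges x) \<longleftrightarrow> {x, y} \<in> Edges \<and> {x, z} \<in> Edges \<and> {y, z} \<in> Edges" for y z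
    using EdgesD(1) unfolding induced_edges_def neighbours_def by auto
  have c: "{y, z} \<notin> Edges" if "{y, z} \<notin> induced_edges Edges (neighbours Edges x)" "{x, y} \<in> Edges" "{x, z} \<in> Edges" for y z
    using that i by blast
  show ?thesis
  proof (rule six_largeI)
    fix v0 v1 v2 v3
    let ?I = "induced_edges Edges (neighbours Edges x)"
    assume d: "distinct [v0, v1, v2, v3]" and e: "{v0, v1} \<in> ?I" "{v1, v2} \<in> ?I" "{v2, v3} \<in> ?I" "{v3, v0} \<in> ?I"
      and n: "{v0, v2} \<notin> ?I" "{v1, v3} \<notin> ?I"
    note e' = e[unfolded i]
    show False
      by (rule assms(1)[OF d]) (use e' n[THEN c] in simp_all)
  next
    fix v0 v1 v2 v3 v4
    let ?I = "induced_edges Edges (neighbours Edges x)"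
    assume d: "distinct [v0, v1, v2, v3, v4]"
      and e: "{v0, v1} \<in> ?I" "{v1, v2} \<in> ?I" "{v2, v3} \<in> ?I" "{v3, v4} \<in> ?I" "{v4, v0} \<in> ?I"
      and n: "{v0, v2} \<notin> ?I" "{v1, v3} \<notin> ?I" "{v2, v4} \<notin> ?I" "{v3, v0} \<notin> ?I" "{v4, v1} \<notin> ?I"
    note e' = e[unfolded i]
    show False
      by (rule assms(2)[OF d]) (use e' n[THEN c] in simp_all)
  qed
qed

lemma Inner_link_six_large:
  "six_large (neighbours Edges (Inner g e j)) (induced_edges Edges (neighbours Edges (Inner g e j)))"
proof (rule six_large_linkI)
  fix v0 v1 v2 v3
  assume d: "distinct [v0, v1, v2, v3]"
    and x: "{Inner g e j, v0} \<in> Edges" "{Inner g e j, v1} \<in> Edges" "{Inner g e j, v2} \<in> Edges" "{Inner g e j, v3} \<in> Edges"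
    and adj: "{v0, v1} \<in> Edges" "{v1, v2} \<in> Edges" "{v2, v3} \<in> Edges" "{v3, v0} \<in> Edges" "{v0, v2} \<notin> Edges" "{v1, v3} \<notin> Edges"
  show False by (rule no_block_edge_square[OF x[THEN Inner_block_edge] adj d])
next
  fix v0 v1 v2 v3 v4
  assume d: "distinct [v0, v1, v2, v3, v4]"
    and x: "{Inner g e j, v0} \<in> Edges" "{Inner g e j, v1} \<in> Edges" "{Inner g e j, v2} \<in> Edges" "{Inner g e j, v3} \<in> Edges"
      "{Inner g e j, v4} \<in> Edges"
    and adj: "{v0, v1} \<in> Edges" "{v1, v2} \<in> Edges" "{v2, v3} \<in> Edges" "{v3, v4} \<in> Edges" "{v4, v0} \<in> Edges"
      "{v0, v2} \<notin> Edges" "{v1, v3} \<notin> Edges" "{v2, v4} \<notin> Edges" "{v3, v0} \<notin> Edges" "{v4, v1} \<notin> Edges"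
  show False by (rule no_block_edge_pentagon[OF x[THEN Inner_block_edge] adj d])
qed

lemma block_edge_no_common:
  assumes v: "v \<in> carrier AG" and s: "s \<in> V"
    and e: "block_edge e (Elt v) y" "block_edge e (Elt v) (gv v s True)" "block_edge e (Elt v) (gv v s False)"
    and y: "{y, gv v s True} \<in> Edges" "{y, gv v s False} \<in> Edges"
  shows False
proof -
  obtain a b where oab: "e = {a, b}" "{a, b} \<in> E"
    using e(1) unfolding block_edge_def by blast
  interpret artin_edge V E m a b using oab(2) by (rule artin_edgeI)
  have b: "bedge (Elt v) y" "bedge (Elt v) (gv v s True)" "bedge (Elt v) (gv v s False)"
    using e unfolding oab(1) block_edge_iff[OF oab(2)] by blast+
  have y': "bedge y (Elt (v \<cdot> gen s))" "bedge y (Elt (v \<cdot> inv\<^bsub>AG\<^esub> gen s))"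
    using bedge_common_Edges[OF b(1,2) y(1)] bedge_common_Edges[OF b(1,3) y(2)] by (simp_all add: gv_def)
  have "inv\<^bsub>AG\<^esub> v \<cdot> (v \<cdot> gen s) \<in> supported {a, b}"
    using bedge_Elt_supported[OF v _ b(2)[unfolded gv_def if_True]] v s by simp
  then have "gen s \<in> supported {a, b}" using s v by (simp add: AG.inv_cancel_left)
  then have "s \<in> {a, b}" using gen_supportedD s by blast
  then show False using bedge_no_common[OF v _ b(1) y'] by blast
qed

lemma Elt_link_six_large:
  assumes large: "almost_large_type V E m" and v: "v \<in> carrier AG"
  shows "six_large (neighbours Edges (Elt v)) (induced_edges Edges (neighbours Edges (Elt v)))"
proof -
  define adj where "adj y z \<longleftrightarrow> {Elt v, y} \<in> Edges \<and> {Elt v, z} \<in> Edges \<and> {y, z} \<in> Edges" for y z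
  define Lk where "Lk e = {y. block_edge e (Elt v) y}" for e
  have LkE: "{Elt v, y} \<in> Edges" if "y \<in> Lk e" for y e
    using that block_edge_Edges unfolding Lk_def by blast
  interpret block_graph V E m adj Lk "gv v"
  proof
    show "almost_large_type V E m" by (rule large)
    show "simple_graph V E" using defining_graph by (simp add: defining_graph_def)
    show "adj z y" if "adj y z" for y z using that by (simp add: adj_def insert_commute)
    show "\<exists>e\<in>E. y \<in> Lk e \<and> z \<in> Lk e" if "adj y z" for y z
      using that Elt_link_block[OF v, of y z] unfolding adj_def Lk_def by blast
    show "\<exists>s g. s \<in> e \<and> s \<in> e' \<and> y = gv v s g" if "e \<in> E" "e' \<in> E" "e \<noteq> e'" "y \<in> Lk e" "y \<in> Lk e'" for e e' y
      using Elt_block_meet[OF v that(1-3)] that(4,5) unfolding Lk_def by blast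
    show "\<not> adj (gv v s g) (gv v t g)" if "s \<in> V" "t \<in> V" for s t g
      using gv_edge_same[OF v that] unfolding adj_def by blast
    show "\<not> adj (gv v s g) (gv v s (\<not> g))" if "s \<in> V" for s g
    proof
      assume "adj (gv v s g) (gv v s (\<not> g))"
      then have "{gv v s False, gv v s True} \<in> Edges" by (cases g) (simp_all add: adj_def insert_commute)
      then show False using gv_edge_opposite[OF v that that] edge_neq by blast
    qed
    show False if "e \<in> E" "s \<in> V" "y \<in> Lk e" "gv v s True \<in> Lk e" "gv v s False \<in> Lk e"
      "adj y (gv v s True)" "adj y (gv v s False)" for e s y
      using block_edge_no_common[OF v that(2), of e y] that unfolding adj_def Lk_def by blast
    show "m {s, t} = 2" if st: "s \<in> V" "t \<in> V" and a: "adj (gv v s g) (gv v t h)" for s t g h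
    proof -
      have e: "{gv v s g, gv v t h} \<in> Edges" "{gv v t h, gv v s g} \<in> Edges"
        using a by (simp_all add: adj_def insert_commute)
      have "g \<noteq> h" using gv_edge_same[OF v st] e by blast
      then consider "g" "\<not> h" | "\<not> g" "h" by blast
      then show ?thesis
      proof cases
        case 1 then show ?thesis using gv_edge_opposite[OF v st] e by simp
      next
        case 2 then show ?thesis using gv_edge_opposite[OF v st(2,1)] e by (simp add: insert_commute)
      qed
    qed
    show False if "e \<in> E" "{v0, v1, v2, v3} \<subseteq> Lk e" "distinct [v0, v1, v2, v3]" "adj v0 v1" "adj v1 v2" "adj v2 v3"
      "adj v3 v0" "\<not> adj v0 v2" "\<not> adj v1 v3" for e v0 v1 v2 v3
      by (rule no_block_edge_square[of e "Elt v" v0 v1 v2 v3]) (use that LkE in \<open>auto simp: adj_def Lk_def\<close>)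
    show False if "e \<in> E" "{v0, v1, v2, v3, v4} \<subseteq> Lk e" "distinct [v0, v1, v2, v3, v4]" "adj v0 v1" "adj v1 v2" "adj v2 v3"
      "adj v3 v4" "adj v4 v0" "\<not> adj v0 v2" "\<not> adj v1 v3" "\<not> adj v2 v4" "\<not> adj v3 v0" "\<not> adj v4 v1" for e v0 v1 v2 v3 v4
      by (rule no_block_edge_pentagon[of e "Elt v" v0 v1 v2 v3 v4]) (use that LkE in \<open>auto simp: adj_def Lk_def\<close>)
  qed
  show ?thesis
  proof (rule six_large_linkI)
    fix v0 v1 v2 v3
    assume "distinct [v0, v1, v2, v3]" "{Elt v, v0} \<in> Edges" "{Elt v, v1} \<in> Edges" "{Elt v, v2} \<in> Edges" "{Elt v, v3} \<in> Edges"
      "{v0, v1} \<in> Edges" "{v1, v2} \<in> Edges" "{v2, v3} \<in> Edges" "{v3, v0} \<in> Edges" "{v0, v2} \<notin> Edges" "{v1, v3} \<notin> Edges"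
    then show False using no_induced_square[of v0 v1 v2 v3] unfolding adj_def by blast
  next
    fix v0 v1 v2 v3 v4
    assume "distinct [v0, v1, v2, v3, v4]" "{Elt v, v0} \<in> Edges" "{Elt v, v1} \<in> Edges" "{Elt v, v2} \<in> Edges"
      "{Elt v, v3} \<in> Edges" "{Elt v, v4} \<in> Edges"
      "{v0, v1} \<in> Edges" "{v1, v2} \<in> Edges" "{v2, v3} \<in> Edges" "{v3, v4} \<in> Edges" "{v4, v0} \<in> Edges"
      "{v0, v2} \<notin> Edges" "{v1, v3} \<notin> Edges" "{v2, v4} \<notin> Edges" "{v3, v0} \<notin> Edges" "{v4, v1} \<notin> Edges"
    then show False using no_induced_pentagon[of v0 v1 v2 v3 v4] unfolding adj_def by blast
  qed
qed

lemma link_six_large: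
  assumes "almost_large_type V E m" "x \<in> artin_vertices V E m"
  shows "six_large (neighbours Edges x) (induced_edges Edges (neighbours Edges x))"
  using assms(2)
proof (cases rule: vertex_cases)
  case (1 p)
  then show ?thesis using Elt_link_six_large[OF assms(1)] by simp
next
  case (2 g e j)
  then show ?thesis using Inner_link_six_large by simp
qed

end

section \<open>Simplicial complexes and edge paths\<close>

lemma continuous_on_coordinate: "continuous_on UNIV (\<lambda>x::'v \<Rightarrow> real. x v)"
  by (rule continuous_on_product_coordinates)

lemma closed_closed_simplex:
  assumes "finite (\<sigma> :: 'v set)" shows "closed (closed_simplex \<sigma>)"
proof -
  have 1: "closed {x :: 'v \<Rightarrow> real. 0 \<le> x v}" "closed {x :: 'v \<Rightarrow> real. x v = 0}" for v
    by (intro closed_Collect_le closed_Collect_eq continuous_on_coordinate continuous_on_const)+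
  have 2: "closed {x :: 'v \<Rightarrow> real. sum x \<sigma> = 1}"
    by (intro closed_Collect_eq continuous_on_sum continuous_on_coordinate continuous_on_const)
  have "closed_simplex \<sigma> = (\<Inter>v. {x. 0 \<le> x v}) \<inter> (\<Inter>v\<in>-\<sigma>. {x. x v = 0}) \<inter> {x. sum x \<sigma> = 1}"
    by (auto simp: closed_simplex_def)
  also have "closed \<dots>" using 1 2 by (intro closed_Int closed_INT) auto
  finally show ?thesis .
qed

lemma closed_finite_functions:
  assumes "finite (B :: ('v \<Rightarrow> real) set)" shows "closed B"
proof -
  have "closed {x}" for x :: "'v \<Rightarrow> real"
  proof -
    have "{x} = (\<Inter>v. {y. y v = x v})" by (auto simp: fun_eq_iff)
    also have "closed \<dots>"
      by (intro closed_INT ballI closed_Collect_eq continuous_on_coordinate continuous_on_const)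
    finally show ?thesis .
  qed
  then have "closed (\<Union>x\<in>B. {x})" using assms by (intro closed_UN) auto
  then show ?thesis by simp
qed

lemma realization_subtopology_euclidean:
  fixes K :: "'v set set"
  assumes "openin (euclidean :: ('v \<Rightarrow> real) topology) W"
  shows "openin (realization K) (W \<inter> realization_points K)"
proof -
  have "openin (top_of_set (closed_simplex \<sigma>)) (W \<inter> realization_points K \<inter> closed_simplex \<sigma>)" if "\<sigma> \<in> K" for \<sigma>
  proof -
    have "W \<inter> realization_points K \<inter> closed_simplex \<sigma> = closed_simplex \<sigma> \<inter> W"
      using that by (auto simp: realization_points_def)
    then show ?thesis using assms by (metis open_openin openin_open)
  qed
  then show ?thesis unfolding openin_realization by blast
qed

lemma continuous_map_from_realization:
  fixes K :: "'v set set"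
  assumes "continuous_map X (realization K) f" shows "continuous_map X euclidean f"
  unfolding continuous_map_def
proof (intro conjI allI impI)
  show "f \<in> topspace X \<rightarrow> topspace euclidean" by simp
next
  fix W :: "('v \<Rightarrow> real) set" assume "openin euclidean W"
  then have "openin X {x \<in> topspace X. f x \<in> W \<inter> realization_points K}"
    using assms realization_subtopology_euclidean unfolding continuous_map_def by blast
  moreover have "f x \<in> realization_points K" if "x \<in> topspace X" for x
    using assms that by (metis continuous_map_image_subset_topspace image_subset_iff topspace_realization)
  ultimately show "openin X {x \<in> topspace X. f x \<in> W}"
    by (metis (no_types, lifting) Collect_cong IntE IntI)
qed

text \<open>On a finite union of closed simplices the weak topology agrees with the one given by
  coordinates: a weakly closed set meets each simplex in a set closed in the product, and a finite
  union of closed preimages is closed. Continuity of the homotopies below is reduced to coordinates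
  in this way.\<close>

lemma continuous_map_into_realization:
  assumes f: "continuous_map X euclidean f" and F: "finite F" "F \<subseteq> K" "\<And>\<sigma>. \<sigma> \<in> K \<Longrightarrow> finite \<sigma>"
    and sub: "\<And>x. x \<in> topspace X \<Longrightarrow> \<exists>\<sigma>\<in>F. f x \<in> closed_simplex \<sigma>"
  shows "continuous_map X (realization K) f"
  unfolding continuous_map_closedin
proof (intro conjI allI impI)
  show "f \<in> topspace X \<rightarrow> topspace (realization K)"
    using sub F(2) by (force simp: topspace_realization realization_points_def)
next
  fix C assume C: "closedin (realization K) C"
  have "closedin X {x \<in> topspace X. f x \<in> C \<inter> closed_simplex \<sigma>}" if "\<sigma> \<in> F" for \<sigma>
  proof -
    have \<sigma>: "\<sigma> \<in> K" using that F by blast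
    have "openin (top_of_set (closed_simplex \<sigma>)) ((topspace (realization K) - C) \<inter> closed_simplex \<sigma>)"
      using C \<sigma> unfolding closedin_def openin_realization by blast
    moreover have "closed_simplex \<sigma> - (topspace (realization K) - C) \<inter> closed_simplex \<sigma> = C \<inter> closed_simplex \<sigma>"
      using \<sigma> by (auto simp: topspace_realization realization_points_def)
    ultimately have "closedin (top_of_set (closed_simplex \<sigma>)) (C \<inter> closed_simplex \<sigma>)"
      by (metis closedin_def inf_le2 openin_closedin_eq topspace_euclidean_subtopology)
    then have "closed (C \<inter> closed_simplex \<sigma>)"
      using closed_closed_simplex F(3) \<sigma> closedin_closed_trans by blast
    then show ?thesis using f unfolding continuous_map_closedin by (metis closed_closedin)
  qed
  then have "closedin X (\<Union>\<sigma>\<in>F. {x \<in> topspace X. f x \<in> C \<inter> closed_simplex \<sigma>})"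
    using F(1) by (intro closedin_Union) auto
  also have "(\<Union>\<sigma>\<in>F. {x \<in> topspace X. f x \<in> C \<inter> closed_simplex \<sigma>}) = {x \<in> topspace X. f x \<in> C}"
    using sub by blast
  finally show "closedin X {x \<in> topspace X. f x \<in> C}" .
qed

definition support :: "('v \<Rightarrow> real) \<Rightarrow> 'v set" where
  "support x = {v. x v \<noteq> 0}"

lemma closed_simplex_support: "x \<in> closed_simplex \<sigma> \<Longrightarrow> support x \<subseteq> \<sigma>"
  by (auto simp: closed_simplex_def support_def)

lemma closed_simplex_own_support:
  assumes "x \<in> closed_simplex \<sigma>" "finite \<sigma>" shows "x \<in> closed_simplex (support x)"
proof -
  have "sum x (support x) = sum x \<sigma>"
    using assms closed_simplex_support[OF assms(1)] by (intro sum.mono_neutral_left) (auto simp: support_def)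
  then show ?thesis using assms by (auto simp: closed_simplex_def support_def)
qed

lemma closed_simplex_mono:
  assumes "\<tau> \<subseteq> \<sigma>" "finite \<sigma>" shows "closed_simplex \<tau> \<subseteq> closed_simplex \<sigma>"
proof
  fix x assume x: "x \<in> closed_simplex \<tau>"
  have "sum x \<sigma> = sum x \<tau>" using assms x by (intro sum.mono_neutral_right) (auto simp: closed_simplex_def)
  then show "x \<in> closed_simplex \<sigma>" using x assms(1) by (auto simp: closed_simplex_def)
qed

lemma closed_simplex_nonempty: "closed_simplex {} = {}"
  by (auto simp: closed_simplex_def)

lemma closed_simplex_pos:
  assumes "x \<in> closed_simplex \<sigma>" shows "v \<in> support x \<longleftrightarrow> 0 < x v"
proof -
  have "0 \<le> x v" using assms by (simp add: closed_simplex_def)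
  then show ?thesis by (simp add: support_def order_less_le)
qed

locale simplicial_complex =
  fixes K :: "'v set set"
  assumes complex: "abstract_complex K"
begin

lemma simplex_finite: "\<sigma> \<in> K \<Longrightarrow> finite \<sigma>" and simplex_nonempty: "\<sigma> \<in> K \<Longrightarrow> \<sigma> \<noteq> {}"
  and simplex_face: "\<sigma> \<in> K \<Longrightarrow> \<tau> \<noteq> {} \<Longrightarrow> \<tau> \<subseteq> \<sigma> \<Longrightarrow> \<tau> \<in> K"
  using complex unfolding abstract_complex_def by blast+

lemma realization_point:
  assumes "x \<in> realization_points K"
  shows "support x \<in> K" "x \<in> closed_simplex (support x)"
proof -
  obtain \<sigma> where \<sigma>: "\<sigma> \<in> K" "x \<in> closed_simplex \<sigma>" using assms by (auto simp: realization_points_def)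
  show x: "x \<in> closed_simplex (support x)" using closed_simplex_own_support \<sigma> simplex_finite by blast
  then have "support x \<noteq> {}" using closed_simplex_nonempty by auto
  then show "support x \<in> K" using closed_simplex_support \<sigma> simplex_face by blast
qed

text \<open>One point of \<open>C\<close> is chosen for each support that occurs. A simplex has
  finitely many faces and so contains finitely many chosen points; hence every set of chosen points
  is closed in the weak topology, and a closed discrete subset of a compact set is finite.\<close>

lemma compact_finite_supports:
  assumes C: "compactin (realization K) C" shows "finite (support ` C)"
proof -
  have CK: "C \<subseteq> realization_points K" using compactin_subset_topspace[OF C] by (simp add: topspace_realization)
  define pt where "pt S = (SOME x. x \<in> C \<and> support x = S)" for S
  have pt: "pt S \<in> C \<and> support (pt S) = S" if "S \<in> support ` C" for S
    unfolding pt_def using that by (intro someI_ex[of "\<lambda>x. x \<in> C \<and> support x = S"]) auto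
  define T where "T = pt ` support ` C"
  have injT: "inj_on support T" unfolding T_def using pt by (intro inj_onI) auto
  have TC: "T \<subseteq> C" using pt by (auto simp: T_def)
  have op: "openin (realization K) (realization_points K - B)" if B: "B \<subseteq> T" for B
    unfolding openin_realization
  proof (intro conjI ballI)
    fix \<sigma> assume \<sigma>: "\<sigma> \<in> K"
    have "support ` (B \<inter> closed_simplex \<sigma>) \<subseteq> Pow \<sigma>" using closed_simplex_support by auto
    then have "finite (support ` (B \<inter> closed_simplex \<sigma>))" using simplex_finite[OF \<sigma>] finite_subset by blast
    moreover have "inj_on support (B \<inter> closed_simplex \<sigma>)" using injT B by (meson inf_le1 inj_on_subset)
    ultimately have "finite (B \<inter> closed_simplex \<sigma>)" using finite_imageD by blast
    then have "closed (B \<inter> closed_simplex \<sigma>)" by (rule closed_finite_functions)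
    moreover have "(realization_points K - B) \<inter> closed_simplex \<sigma> = closed_simplex \<sigma> \<inter> (- (B \<inter> closed_simplex \<sigma>))"
      using \<sigma> by (auto simp: realization_points_def)
    ultimately show "openin (top_of_set (closed_simplex \<sigma>)) ((realization_points K - B) \<inter> closed_simplex \<sigma>)"
      by (metis openin_open open_Compl)
  qed blast
  have "finite T"
  proof (cases "T = {}")
    case False
    \<comment> \<open>Each of these open sets contains exactly one chosen point.\<close>
    let ?U = "\<lambda>x. realization_points K - (T - {x})"
    have "C \<subseteq> \<Union>(?U ` T)" using CK False by blast
    moreover have "\<forall>U\<in>?U ` T. openin (realization K) U" using op by blast
    ultimately obtain \<F> where \<F>: "finite \<F>" "\<F> \<subseteq> ?U ` T" "C \<subseteq> \<Union>\<F>"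
      using C unfolding compactin_def by meson
    then obtain T0 where T0: "finite T0" "T0 \<subseteq> T" "\<F> = ?U ` T0" by (meson finite_subset_image)
    have "T \<subseteq> T0" using \<F>(3) TC T0 by blast
    then show ?thesis using T0 finite_subset by blast
  qed simp
  moreover have "support ` C \<subseteq> support ` T"
  proof
    fix S assume "S \<in> support ` C"
    then have "S = support (pt S)" "pt S \<in> T" using pt by (auto simp: T_def)
    then show "S \<in> support ` T" by (rule image_eqI)
  qed
  ultimately show ?thesis using finite_subset by blast
qed

lemma loop_supports:
  assumes p: "pathin (realization K) p"
  shows "finite ((\<lambda>t. support (p t)) ` {0..1})" "(\<lambda>t. support (p t)) ` {0..1} \<subseteq> K"
    "\<And>t. t \<in> {0..1} \<Longrightarrow> p t \<in> closed_simplex (support (p t))"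
    "\<And>t. t \<in> {0..1} \<Longrightarrow> p t \<in> realization_points K"
    "continuous_map (top_of_set {0..1}) euclidean p"
proof -
  have "compactin (realization K) (p ` {0..1})"
    using p unfolding pathin_def by (intro image_compactin[where X = "top_of_set {0..1}"])
      (auto simp: compactin_subtopology)
  then show "finite ((\<lambda>t. support (p t)) ` {0..1})"
    using compact_finite_supports[of "p ` {0..1}"] by (simp add: image_image)
  show pts: "\<And>t. t \<in> {0..1} \<Longrightarrow> p t \<in> realization_points K"
    using p unfolding pathin_def continuous_map_def by (auto simp: topspace_realization Pi_iff)
  then show "(\<lambda>t. support (p t)) ` {0..1} \<subseteq> K" "\<And>t. t \<in> {0..1} \<Longrightarrow> p t \<in> closed_simplex (support (p t))"
    using realization_point by blast+
  show "continuous_map (top_of_set {0..1}) euclidean p"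
    using p unfolding pathin_def by (rule continuous_map_from_realization)
qed

abbreviation loop_homotopic :: "(real \<Rightarrow> 'v \<Rightarrow> real) \<Rightarrow> (real \<Rightarrow> 'v \<Rightarrow> real) \<Rightarrow> bool" where
  "loop_homotopic \<equiv> homotopic_with (\<lambda>r. r 1 = r 0) (top_of_set {0..1}) (realization K)"

lemma unit_square: "prod_topology (top_of_set {0..1::real}) (top_of_set {0..1::real}) = top_of_set ({0..1} \<times> {0..1})"
  by (metis euclidean_product_topology prod_topology_subtopology_eu)

lemma segment_closed_simplex:
  assumes "x \<in> closed_simplex \<sigma>" "y \<in> closed_simplex \<sigma>" "0 \<le> s" "s \<le> 1"
  shows "(\<lambda>v. (1 - s) * x v + s * y v) \<in> closed_simplex \<sigma>"
  using assms by (auto simp: closed_simplex_def sum.distrib simp flip: sum_distrib_left)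

lemma loop_homotopic_straight:
  assumes p: "continuous_map (top_of_set {0..1}) euclidean p" and q: "continuous_map (top_of_set {0..1}) euclidean q"
    and F: "finite F" "F \<subseteq> K" and pq: "\<And>t. t \<in> {0..1} \<Longrightarrow> \<exists>\<sigma>\<in>F. p t \<in> closed_simplex \<sigma> \<and> q t \<in> closed_simplex \<sigma>"
    and loops: "p 1 = p 0" "q 1 = q 0"
  shows "loop_homotopic p q"
proof -
  define h where "h = (\<lambda>z. \<lambda>v. (1 - fst z) * p (snd z) v + fst z * q (snd z) v)"
  have c: "continuous_on {0..1} (\<lambda>t. p t v)" "continuous_on {0..1} (\<lambda>t. q t v)" for v
    using p q by (auto intro!: continuous_on_product_then_coordinatewise)
  have "continuous_on ({0..1} \<times> {0..1}) h"
    unfolding h_def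
    by (intro continuous_on_coordinatewise_then_product continuous_intros
      continuous_on_compose2[OF c(1)] continuous_on_compose2[OF c(2)]) auto
  then have "continuous_map (top_of_set ({0..1} \<times> {0..1})) euclidean h" by simp
  moreover have "\<exists>\<sigma>\<in>F. h z \<in> closed_simplex \<sigma>" if "z \<in> topspace (top_of_set ({0..1} \<times> {0..1}))" for z
    using that pq[of "snd z"] unfolding h_def by (auto intro!: segment_closed_simplex)
  ultimately have "continuous_map (top_of_set ({0..1} \<times> {0..1})) (realization K) h"
    using F simplex_finite by (intro continuous_map_into_realization) auto
  moreover have "h (0, t) = p t" "h (1, t) = q t" for t by (simp_all add: h_def)
  moreover have "h (s, 1) = h (s, 0)" for s by (simp add: h_def loops)
  ultimately show ?thesis unfolding homotopic_with_def unit_square by blast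
qed

lemma loop_homotopic_trans: "loop_homotopic p q \<Longrightarrow> loop_homotopic q r \<Longrightarrow> loop_homotopic p r"
  by (rule homotopic_with_trans)

lemma loop_homotopic_sym: "loop_homotopic p q \<Longrightarrow> loop_homotopic q p"
  by (rule homotopic_with_symD)

end

section \<open>Edge paths and their piecewise linear realization\<close>

definition hat :: "real \<Rightarrow> real" where "hat y = max 0 (1 - \<bar>y\<bar>)"

text \<open>The sum runs over positions rather than vertices, so a vertex may occur repeatedly;
  between consecutive integers at most two summands are nonzero.\<close>

definition polyline :: "'v list \<Rightarrow> real \<Rightarrow> ('v \<Rightarrow> real)" where
  "polyline vs x = (\<lambda>w. \<Sum>i<length vs. if vs ! i = w then hat (x - real i) else 0)"

definition edge_loop :: "'v list \<Rightarrow> real \<Rightarrow> ('v \<Rightarrow> real)" where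
  "edge_loop vs t = polyline vs (real (length vs - 1) * t)"

lemma polyline_segment:
  assumes k: "Suc k < length vs" and x: "real k \<le> x" "x \<le> real (Suc k)"
  shows "polyline vs x = (\<lambda>w. (if vs ! k = w then 1 - (x - real k) else 0) + (if vs ! Suc k = w then x - real k else 0))"
proof
  fix w
  have "polyline vs x w = (\<Sum>i\<in>{k, Suc k}. if vs ! i = w then hat (x - real i) else 0)"
    unfolding polyline_def
  proof (rule sum.mono_neutral_right)
    show "\<forall>i\<in>{..<length vs} - {k, Suc k}. (if vs ! i = w then hat (x - real i) else 0) = 0"
    proof
      fix i assume "i \<in> {..<length vs} - {k, Suc k}"
      then have "real i + 1 \<le> real k \<or> real k + 2 \<le> real i" by auto
      then have "hat (x - real i) = 0" using x by (auto simp: hat_def)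
      then show "(if vs ! i = w then hat (x - real i) else 0) = 0" by simp
    qed
  qed (use k in auto)
  also have "\<dots> = (if vs ! k = w then 1 - (x - real k) else 0) + (if vs ! Suc k = w then x - real k else 0)"
    using x by (auto simp: hat_def)
  finally show "polyline vs x w = (if vs ! k = w then 1 - (x - real k) else 0) + (if vs ! Suc k = w then x - real k else 0)" .
qed

lemma polyline_closed_simplex:
  assumes k: "Suc k < length vs" and x: "real k \<le> x" "x \<le> real (Suc k)"
  shows "polyline vs x \<in> closed_simplex {vs ! k, vs ! Suc k}"
  unfolding polyline_segment[OF assms] using x by (cases "vs ! k = vs ! Suc k") (auto simp: closed_simplex_def)

lemma polyline_nth:
  assumes "i < length vs" shows "polyline vs (real i) = (\<lambda>w. if w = vs ! i then 1 else 0)"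
proof
  fix w
  have "polyline vs (real i) w = (\<Sum>j<length vs. if j = i then (if vs ! i = w then 1 else 0) else 0)"
    unfolding polyline_def
  proof (rule sum.cong)
    fix j
    have "hat (real i - real j) = 0" if "j \<noteq> i"
    proof -
      have "\<bar>real i - real j\<bar> \<ge> 1" using that by linarith
      then show ?thesis by (simp add: hat_def)
    qed
    then show "(if vs ! j = w then hat (real i - real j) else 0) = (if j = i then (if vs ! i = w then 1 else 0) else 0)"
      by (auto simp: hat_def)
  qed simp
  then show "polyline vs (real i) w = (if w = vs ! i then 1 else 0)" using assms by auto
qed

lemma continuous_hat: "continuous_on UNIV (\<lambda>x. hat (x - c))"
  unfolding hat_def by (intro continuous_intros)

lemma continuous_polyline: "continuous_on UNIV (polyline vs)"
proof (rule continuous_on_coordinatewise_then_product)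
  fix w
  have "continuous_on UNIV (\<lambda>x. if vs ! i = w then hat (x - real i) else 0)" for i
    using continuous_hat by (cases "vs ! i = w") auto
  then show "continuous_on UNIV (\<lambda>x. polyline vs x w)"
    unfolding polyline_def by (intro continuous_on_sum)
qed

lemma continuous_edge_loop: "continuous_map (top_of_set {0..1}) euclidean (edge_loop vs)"
proof -
  have "continuous_on {0..1} (\<lambda>t. polyline vs (real (length vs - 1) * t))"
    by (rule continuous_on_compose2[OF continuous_polyline]) (auto intro!: continuous_intros)
  then show ?thesis by (simp add: edge_loop_def[abs_def])
qed

lemma edge_loop_ends:
  assumes "vs \<noteq> []"
  shows "edge_loop vs 0 = (\<lambda>w. if w = hd vs then 1 else 0)" "edge_loop vs 1 = (\<lambda>w. if w = last vs then 1 else 0)"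
  using assms polyline_nth[of 0 vs] polyline_nth[of "length vs - 1" vs]
  by (simp_all add: edge_loop_def hd_conv_nth last_conv_nth)

lemma unit_interval_segment:
  assumes "2 \<le> L" "0 \<le> t" "t \<le> (1 :: real)"
  obtains k where "Suc k < L" "real k \<le> real (L - 1) * t" "real (L - 1) * t \<le> real (Suc k)"
proof -
  define x where "x = real (L - 1) * t"
  have x: "0 \<le> x" "x \<le> real (L - 1)" using assms mult_left_le[of t "real (L - 1)"] by (simp_all add: x_def)
  show ?thesis
  proof (cases "x = real (L - 1)")
    case True
    then show ?thesis using that[of "L - 2"] assms(1) x unfolding x_def[symmetric] by (auto simp: of_nat_diff)
  next
    case False
    let ?k = "nat \<lfloor>x\<rfloor>"
    have "real ?k \<le> x" "x \<le> real (Suc ?k)" using x by linarith+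
    moreover have "Suc ?k < L"
    proof -
      have "real ?k < real (L - 1)" using \<open>real ?k \<le> x\<close> x False by linarith
      then show ?thesis by simp
    qed
    ultimately show ?thesis using that[of ?k] unfolding x_def[symmetric] by blast
  qed
qed

context simplicial_complex
begin

text \<open>Consecutive vertices may coincide, because \<open>{u, u}\<close> is the simplex
  \<open>{u}\<close>. Paths can therefore be stretched by repeating vertices.\<close>

definition edge_path :: "'v list \<Rightarrow> bool" where
  "edge_path vs \<longleftrightarrow> vs \<noteq> [] \<and> set vs \<subseteq> \<Union>K \<and> successively (\<lambda>u v. {u, v} \<in> K) vs"

lemma vertex_simplex: "v \<in> \<Union>K \<longleftrightarrow> {v} \<in> K"
  using simplex_face[of _ "{v}"] by blast

lemma edge_path_nth:
  assumes "edge_path vs" "Suc i < length vs" shows "{vs ! i, vs ! Suc i} \<in> K"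
proof -
  have "successively P xs \<Longrightarrow> Suc i < length xs \<Longrightarrow> P (xs ! i) (xs ! Suc i)" for P :: "'v \<Rightarrow> 'v \<Rightarrow> bool" and xs i
    by (induction P xs arbitrary: i rule: successively.induct) (auto simp: nth_Cons split: nat.splits)
  then show ?thesis using assms by (fastforce simp: edge_path_def)
qed

lemma edge_loop_simplex:
  assumes vs: "edge_path vs" "2 \<le> length vs" and t: "0 \<le> t" "t \<le> 1"
  obtains k where "Suc k < length vs" "edge_loop vs t \<in> closed_simplex {vs ! k, vs ! Suc k}"
    "real k \<le> real (length vs - 1) * t" "real (length vs - 1) * t \<le> real (Suc k)"
  using unit_interval_segment[OF vs(2) t] polyline_closed_simplex by (metis edge_loop_def)

lemma edge_loop_pathin:
  assumes "edge_path vs" shows "pathin (realization K) (edge_loop vs)"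
proof (cases "2 \<le> length vs")
  case True
  let ?F = "(\<lambda>k. {vs ! k, vs ! Suc k}) ` {k. Suc k < length vs}"
  have "finite ?F" by (rule finite_imageI, rule finite_subset[of _ "{..length vs}"]) auto
  moreover have "?F \<subseteq> K" using edge_path_nth[OF assms] by blast
  moreover have "\<exists>\<sigma>\<in>?F. edge_loop vs t \<in> closed_simplex \<sigma>" if "t \<in> topspace (top_of_set {0..1})" for t
    using that edge_loop_simplex[OF assms True, of t] by auto
  ultimately show ?thesis unfolding pathin_def
    using continuous_edge_loop simplex_finite by (intro continuous_map_into_realization) auto
next
  case False
  then obtain u where u: "vs = [u]" using assms by (cases vs rule: list.exhaust; cases "tl vs") (auto simp: edge_path_def)
  have "edge_loop [u] t = (\<lambda>w. if w = u then 1 else 0)" for t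
    using polyline_nth[of 0 "[u]"] by (simp add: edge_loop_def)
  then have "edge_loop [u] t \<in> closed_simplex {u}" for t by (auto simp: closed_simplex_def)
  moreover have "{u} \<in> K" using assms vertex_simplex by (auto simp: u edge_path_def)
  ultimately show ?thesis unfolding pathin_def u
    using continuous_edge_loop simplex_finite by (intro continuous_map_into_realization[where F = "{{u}}"]) auto
qed

text \<open>With equally many vertices both loops run through corresponding segments at the same
  time, so the straight homotopy stays in one simplex at each time. Moves that change the number of
  vertices have to be reduced to this case.\<close>

lemma contiguous_homotopic:
  assumes vs: "edge_path vs" and ws: "edge_path ws" and len: "length vs = length ws" "2 \<le> length vs"
    and c: "\<And>i. Suc i < length vs \<Longrightarrow> {vs ! i, vs ! Suc i, ws ! i, ws ! Suc i} \<in> K"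
    and loops: "hd vs = last vs" "hd ws = last ws"
  shows "loop_homotopic (edge_loop vs) (edge_loop ws)"
proof -
  let ?s = "\<lambda>i. {vs ! i, vs ! Suc i, ws ! i, ws ! Suc i}"
  let ?F = "?s ` {i. Suc i < length vs}"
  have "finite ?F" by (rule finite_imageI, rule finite_subset[of _ "{..length vs}"]) auto
  moreover have "?F \<subseteq> K" using c by blast
  moreover have "\<exists>\<sigma>\<in>?F. edge_loop vs t \<in> closed_simplex \<sigma> \<and> edge_loop ws t \<in> closed_simplex \<sigma>" if "t \<in> {0..1}" for t
  proof -
    have "0 \<le> t" "t \<le> 1" using that by auto
    then obtain k where k: "Suc k < length vs" "real k \<le> real (length vs - 1) * t" "real (length vs - 1) * t \<le> real (Suc k)"
      by (rule unit_interval_segment[OF len(2)])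
    have "edge_loop vs t \<in> closed_simplex {vs ! k, vs ! Suc k}" "edge_loop ws t \<in> closed_simplex {ws ! k, ws ! Suc k}"
      unfolding edge_loop_def using k len by (auto intro!: polyline_closed_simplex)
    then have "edge_loop vs t \<in> closed_simplex (?s k)" "edge_loop ws t \<in> closed_simplex (?s k)"
      using closed_simplex_mono[of "{vs ! k, vs ! Suc k}" "?s k"] closed_simplex_mono[of "{ws ! k, ws ! Suc k}" "?s k"] by auto
    then show ?thesis using k(1) by blast
  qed
  moreover have "edge_loop vs 1 = edge_loop vs 0" "edge_loop ws 1 = edge_loop ws 0"
    using vs ws loops by (simp_all add: edge_loop_ends edge_path_def)
  ultimately show ?thesis
    by (rule loop_homotopic_straight[OF continuous_edge_loop continuous_edge_loop])
qed

text \<open>The interpolation between the identity and \<open>\<phi>\<close> takes the end point 1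
  into the interval from \<open>\<phi> 1\<close> to 1. There \<open>p\<close> has the value
  \<open>p 0\<close>, so every stage is a loop even if \<open>\<phi>\<close> does not reach
  1.\<close>

lemma loop_homotopic_reparam':
  assumes p: "pathin (realization K) p" and \<phi>: "continuous_on {0..1} \<phi>" "\<phi> \<in> {0..1} \<rightarrow> {0..1}" "\<phi> 0 = 0"
    and loop: "\<And>x. \<phi> 1 \<le> x \<Longrightarrow> x \<le> 1 \<Longrightarrow> p x = p 0"
  shows "loop_homotopic p (\<lambda>t. p (\<phi> t))"
proof -
  define g where "g = (\<lambda>z::real \<times> real. (1 - fst z) * snd z + fst z * \<phi> (snd z))"
  have cg: "continuous_on ({0..1} \<times> {0..1}) g"
    unfolding g_def by (intro continuous_intros continuous_on_compose2[OF \<phi>(1)]) auto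
  have g01: "g z \<in> {0..1}" if "z \<in> {0..1} \<times> {0..1}" for z
  proof -
    have z: "0 \<le> fst z" "fst z \<le> 1" "0 \<le> snd z" "snd z \<le> 1" "0 \<le> \<phi> (snd z)" "\<phi> (snd z) \<le> 1"
      using that \<phi>(2) by (auto simp: Pi_iff)
    then have "g z \<le> (1 - fst z) * 1 + fst z * 1" unfolding g_def by (intro add_mono mult_left_mono) auto
    then show ?thesis using z by (auto simp: g_def)
  qed
  then have "continuous_map (top_of_set ({0..1} \<times> {0..1})) (top_of_set {0..1}) g"
    using cg by (auto simp: continuous_map_in_subtopology)
  then have "continuous_map (top_of_set ({0..1} \<times> {0..1})) (realization K) (p \<circ> g)"
    using p unfolding pathin_def by (rule continuous_map_compose)
  moreover have "(p \<circ> g) (0, t) = p t" "(p \<circ> g) (1, t) = p (\<phi> t)" for t by (simp_all add: g_def)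
  moreover have "(p \<circ> g) (s, 1) = (p \<circ> g) (s, 0)" if "s \<in> {0..1}" for s
  proof -
    have "s * (1 - \<phi> 1) \<le> 1 * (1 - \<phi> 1)" using that \<phi>(2) by (intro mult_right_mono) auto
    then have "\<phi> 1 \<le> g (s, 1)" by (simp add: g_def algebra_simps)
    then show ?thesis using g01[of "(s, 1)"] that loop[of "g (s, 1)"] by (simp add: g_def \<phi>(3))
  qed
  ultimately show ?thesis unfolding homotopic_with_def unit_square by blast
qed

lemma edge_path_append_last:
  assumes "edge_path vs" shows "edge_path (vs @ [last vs])"
proof -
  have "last vs \<in> \<Union>K" using assms last_in_set[of vs] unfolding edge_path_def by blast
  then have "{last vs} \<in> K" by (simp only: vertex_simplex)
  then show ?thesis using assms \<open>last vs \<in> \<Union>K\<close> by (simp add: edge_path_def successively_append_iff)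
qed

lemma append_last_homotopic:
  assumes vs: "edge_path vs" and loop: "hd vs = last vs"
  shows "loop_homotopic (edge_loop (vs @ [last vs])) (edge_loop vs)"
proof -
  define N where "N = length vs - 1"
  have len: "length vs = Suc N" using vs by (simp add: N_def edge_path_def)
  define \<phi> where "\<phi> t = real N / real (Suc N) * t" for t
  have lN: "(vs @ [last vs]) ! N = last vs" "(vs @ [last vs]) ! Suc N = last vs"
    using len by (simp_all add: nth_append last_conv_nth flip: length_greater_0_conv)
  have tail: "edge_loop (vs @ [last vs]) x = (\<lambda>w. if w = last vs then 1 else 0)" if "\<phi> 1 \<le> x" "x \<le> 1" for x
  proof -
    have "real N \<le> real (Suc N) * x" using that(1) by (simp add: \<phi>_def field_simps)
    moreover have "real (Suc N) * x \<le> real (Suc N)" using that(2) by (simp add: mult_left_le)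
    ultimately have "polyline (vs @ [last vs]) (real (Suc N) * x) =
        (\<lambda>w. (if (vs @ [last vs]) ! N = w then 1 - (real (Suc N) * x - real N) else 0) +
          (if (vs @ [last vs]) ! Suc N = w then real (Suc N) * x - real N else 0))"
      using len by (intro polyline_segment) auto
    then show ?thesis using len lN by (auto simp: edge_loop_def)
  qed
  have "edge_loop vs t = edge_loop (vs @ [last vs]) (\<phi> t)" if t: "t \<in> {0..1}" for t
  proof -
    have "real (Suc N) * \<phi> t = real N * t" by (simp add: \<phi>_def)
    moreover have "polyline (vs @ [last vs]) (real N * t) = polyline vs (real N * t)"
    proof -
      have "real N * t \<le> real N" using t by (simp add: mult_left_le)
      then have "hat (real N * t - real (Suc N)) = 0" by (simp add: hat_def)
      moreover have "(\<Sum>i<length vs. if (vs @ [last vs]) ! i = w then hat (real N * t - real i) else 0)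
         = (\<Sum>i<length vs. if vs ! i = w then hat (real N * t - real i) else 0)" for w
        by (rule sum.cong) (auto simp: nth_append)
      ultimately show ?thesis using len by (auto simp: polyline_def fun_eq_iff)
    qed
    ultimately show ?thesis using len by (simp add: edge_loop_def)
  qed
  note eq = this
  have vs1: "vs \<noteq> []" using vs by (simp add: edge_path_def)
  have h: "loop_homotopic (edge_loop (vs @ [last vs])) (\<lambda>t. edge_loop (vs @ [last vs]) (\<phi> t))"
  proof (rule loop_homotopic_reparam')
    show "pathin (realization K) (edge_loop (vs @ [last vs]))"
      by (rule edge_loop_pathin[OF edge_path_append_last[OF vs]])
    show "continuous_on {0..1} \<phi>" unfolding \<phi>_def by (intro continuous_intros)
    show "\<phi> \<in> {0..1} \<rightarrow> {0..1}"
    proof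
      fix t :: real assume "t \<in> {0..1}"
      then have "real N / real (Suc N) * t \<le> 1 * 1" by (intro mult_mono) auto
      then show "\<phi> t \<in> {0..1}" using \<open>t \<in> {0..1}\<close> by (simp add: \<phi>_def)
    qed
    show "\<phi> 0 = 0" by (simp add: \<phi>_def)
    show "edge_loop (vs @ [last vs]) x = edge_loop (vs @ [last vs]) 0" if "\<phi> 1 \<le> x" "x \<le> 1" for x
      using tail[OF that] edge_loop_ends(1)[of "vs @ [last vs]"] vs1 loop by simp
  qed
  have "edge_loop vs 1 = edge_loop vs 0" using edge_loop_ends[OF vs1] loop by simp
  moreover have "edge_loop (vs @ [last vs]) (\<phi> 1) = edge_loop (vs @ [last vs]) (\<phi> 0)"
    using eq[of 0] eq[of 1] calculation by simp
  ultimately have "loop_homotopic (\<lambda>t. edge_loop (vs @ [last vs]) (\<phi> t)) (edge_loop vs)"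
    using homotopic_with_imp_continuous_maps[OF h] eq by (intro homotopic_with_equal) auto
  with h show ?thesis by (rule loop_homotopic_trans)
qed

text \<open>A move that keeps the number of vertices, hence a case of contiguity. The vertex
  \<open>q'\<close> may equal a neighbour, which is how repetitions are created and
  displaced.\<close>

lemma change_vertex:
  assumes vs: "edge_path (xs @ [p, q, r] @ ys)" and s: "{p, q, q'} \<in> K" "{q, q', r} \<in> K"
    and loop: "hd (xs @ [p, q, r] @ ys) = last (xs @ [p, q, r] @ ys)"
  shows "loop_homotopic (edge_loop (xs @ [p, q, r] @ ys)) (edge_loop (xs @ [p, q', r] @ ys))"
    "edge_path (xs @ [p, q', r] @ ys)"
proof -
  have "{p, q'} \<in> K" "{q', r} \<in> K" "{q'} \<in> K"
    using simplex_face[OF s(1)] simplex_face[OF s(2)] by auto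
  then show ws: "edge_path (xs @ [p, q', r] @ ys)"
    using vs s(1) unfolding edge_path_def by (auto simp: successively_append_iff)
  show "loop_homotopic (edge_loop (xs @ [p, q, r] @ ys)) (edge_loop (xs @ [p, q', r] @ ys))"
  proof (rule contiguous_homotopic[OF vs ws])
    show "hd (xs @ [p, q', r] @ ys) = last (xs @ [p, q', r] @ ys)"
      using loop by (cases xs) auto
    fix i assume i: "Suc i < length (xs @ [p, q, r] @ ys)"
    let ?v = "xs @ [p, q, r] @ ys" and ?w = "xs @ [p, q', r] @ ys"
    have n: "?v ! j = ?w ! j" if "j \<noteq> Suc (length xs)" for j
    proof (cases "j < length xs")
      case False
      then obtain d where d: "j = length xs + d" using le_Suc_ex by (metis not_less)
      then have "d \<noteq> Suc 0" using that by simp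
      then show ?thesis unfolding d nth_append_length_plus by (auto simp: nth_Cons split: nat.splits)
    qed (simp add: nth_append)
    have e: "?v ! length xs = p" "?v ! Suc (length xs) = q" "?v ! Suc (Suc (length xs)) = r"
        "?w ! length xs = p" "?w ! Suc (length xs) = q'" "?w ! Suc (Suc (length xs)) = r"
      using nth_append_length_plus[of xs "[p, q, r] @ ys" 0] nth_append_length_plus[of xs "[p, q, r] @ ys" 1]
        nth_append_length_plus[of xs "[p, q, r] @ ys" 2] nth_append_length_plus[of xs "[p, q', r] @ ys" 0]
        nth_append_length_plus[of xs "[p, q', r] @ ys" 1] nth_append_length_plus[of xs "[p, q', r] @ ys" 2]
      by (simp_all add: numeral_2_eq_2)
    consider "i = length xs" | "i = Suc (length xs)" | "i \<noteq> length xs" "i \<noteq> Suc (length xs)" by blast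
    then show "{?v ! i, ?v ! Suc i, ?w ! i, ?w ! Suc i} \<in> K"
    proof cases
      case 1
      have "{p, q, p, q'} = {p, q, q'}" by auto
      then show ?thesis unfolding 1 e using s(1) by simp
    next
      case 2
      have "{q, r, q', r} = {q, q', r}" by auto
      then show ?thesis unfolding 2 e using s(2) by simp
    next
      case 3
      then have "?w ! i = ?v ! i" "?w ! Suc i = ?v ! Suc i" using n[of i] n[of "Suc i"] by auto
      then have "{?v ! i, ?v ! Suc i, ?w ! i, ?w ! Suc i} = {?v ! i, ?v ! Suc i}" by auto
      then show ?thesis using edge_path_nth[OF vs i] by simp
    qed
  qed (use loop in auto)
qed

text \<open>The repetition is pushed to the right by changing \<open>w, w, y\<close> into
  \<open>w, y, y\<close> until it reaches the end, where it only amounts to a pause that a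
  reparametrization removes.\<close>

lemma shift_stutter:
  "edge_path (xs @ w # w # zs) \<Longrightarrow> hd (xs @ w # w # zs) = last (xs @ w # w # zs) \<Longrightarrow>
    loop_homotopic (edge_loop (xs @ w # w # zs)) (edge_loop (xs @ w # zs @ [last (w # zs)]))"
proof (induction zs arbitrary: xs w)
  case Nil
  have "edge_loop (xs @ [w, w]) 1 = edge_loop (xs @ [w, w]) 0"
    using edge_loop_ends[of "xs @ [w, w]"] Nil(2) by simp
  then show ?case using edge_loop_pathin[OF Nil(1)] unfolding pathin_def by simp
next
  case (Cons y zs)
  have e: "{w, y} \<in> K" using Cons.prems(1) by (auto simp: edge_path_def successively_append_iff)
  have 1: "edge_path (xs @ [w, w, y] @ zs)" "hd (xs @ [w, w, y] @ zs) = last (xs @ [w, w, y] @ zs)"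
    using Cons.prems by simp_all
  have 2: "{w, w, y} \<in> K" "{w, y, y} \<in> K" using e by simp_all
  note ch = change_vertex[OF 1(1) 2 1(2)]
  have "hd (xs @ [w, y, y] @ zs) = last (xs @ [w, y, y] @ zs)" using 1(2) by (cases xs) auto
  then have "loop_homotopic (edge_loop ((xs @ [w]) @ y # y # zs)) (edge_loop ((xs @ [w]) @ y # zs @ [last (y # zs)]))"
    using ch(2) by (intro Cons.IH) simp_all
  then show ?case using ch(1) by (auto intro: loop_homotopic_trans)
qed

text \<open>The moves act on arbitrary lists, so they can be applied to fragments of a path; that
  they preserve edge paths and end points is shown separately.\<close>

inductive edge_homotopic :: "'v list \<Rightarrow> 'v list \<Rightarrow> bool" where
  refl: "edge_homotopic vs vs"
| sym: "edge_homotopic vs ws \<Longrightarrow> edge_homotopic ws vs"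
| trans: "edge_homotopic us vs \<Longrightarrow> edge_homotopic vs ws \<Longrightarrow> edge_homotopic us ws"
| triangle: "{u, v, w} \<in> K \<Longrightarrow> edge_homotopic (xs @ u # v # w # ys) (xs @ u # w # ys)"
| stutter: "{u} \<in> K \<Longrightarrow> edge_homotopic (xs @ u # u # ys) (xs @ u # ys)"

lemma stutter_homotopic:
  assumes "edge_path (xs @ w # w # zs)" "hd (xs @ w # w # zs) = last (xs @ w # w # zs)"
  shows "loop_homotopic (edge_loop (xs @ w # w # zs)) (edge_loop (xs @ w # zs))"
proof -
  have p: "edge_path (xs @ w # zs)" using assms(1)
    by (auto simp: edge_path_def successively_append_iff successively_Cons)
  have "hd (xs @ w # zs) = last (xs @ w # zs)" using assms(2) by (cases xs) auto
  then have h: "loop_homotopic (edge_loop ((xs @ w # zs) @ [last (xs @ w # zs)])) (edge_loop (xs @ w # zs))"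
    by (rule append_last_homotopic[OF p])
  have e: "(xs @ w # zs) @ [last (xs @ w # zs)] = xs @ w # zs @ [last (w # zs)]" by simp
  show ?thesis by (rule loop_homotopic_trans[OF shift_stutter[OF assms] h[unfolded e]])
qed

text \<open>In the case of a triangle \<open>v\<close> is first changed into \<open>w\<close>,
  keeping the number of vertices, and then the repetition of \<open>w\<close> is removed.\<close>

lemma edge_homotopic_invariants:
  "edge_homotopic vs ws \<Longrightarrow> (edge_path vs \<longleftrightarrow> edge_path ws) \<and> hd vs = hd ws \<and> last vs = last ws \<and>
    (edge_path vs \<and> hd vs = last vs \<longrightarrow> loop_homotopic (edge_loop vs) (edge_loop ws))"
proof (induction rule: edge_homotopic.induct)
  case (refl vs)
  have "loop_homotopic (edge_loop vs) (edge_loop vs)" if "edge_path vs" "hd vs = last vs"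
  proof -
    have "edge_loop vs 1 = edge_loop vs 0" using edge_loop_ends[of vs] that by (simp add: edge_path_def)
    then show ?thesis using edge_loop_pathin[OF that(1)] unfolding pathin_def by simp
  qed
  then show ?case by blast
next
  case (sym vs ws)
  then show ?case by (auto intro: loop_homotopic_sym)
next
  case (trans us vs ws)
  then show ?case by (auto intro: loop_homotopic_trans)
next
  case (triangle u v w xs ys)
  have k: "{u, v} \<in> K" "{v, w} \<in> K" "{u, w} \<in> K" "{u} \<in> K" "{v} \<in> K" "{w} \<in> K"
    using simplex_face[OF triangle] by auto
  then have p: "edge_path (xs @ u # v # w # ys) \<longleftrightarrow> edge_path (xs @ u # w # ys)"
    by (auto simp: edge_path_def successively_append_iff)
  have "loop_homotopic (edge_loop (xs @ u # v # w # ys)) (edge_loop (xs @ u # w # ys))"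
    if "edge_path (xs @ u # v # w # ys)" "hd (xs @ u # v # w # ys) = last (xs @ u # v # w # ys)"
  proof -
    have 1: "edge_path (xs @ [u, v, w] @ ys)" "hd (xs @ [u, v, w] @ ys) = last (xs @ [u, v, w] @ ys)"
      using that by simp_all
    have 2: "{u, v, w} \<in> K" "{v, w, w} \<in> K" using triangle k by simp_all
    note ch = change_vertex[OF 1(1) 2 1(2)]
    have "hd (xs @ [u, w, w] @ ys) = last (xs @ [u, w, w] @ ys)" using 1(2) by (cases xs) auto
    then have "loop_homotopic (edge_loop ((xs @ [u]) @ w # w # ys)) (edge_loop ((xs @ [u]) @ w # ys))"
      using ch(2) by (intro stutter_homotopic) simp_all
    then show ?thesis using ch(1) by (auto intro: loop_homotopic_trans)
  qed
  moreover have "hd (xs @ u # v # w # ys) = hd (xs @ u # w # ys)" by (cases xs) auto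
  ultimately show ?case using p by auto
next
  case (stutter u xs ys)
  have p: "edge_path (xs @ u # u # ys) \<longleftrightarrow> edge_path (xs @ u # ys)"
    using stutter by (auto simp: edge_path_def successively_append_iff successively_Cons)
  moreover have "hd (xs @ u # u # ys) = hd (xs @ u # ys)" by (cases xs) auto
  ultimately show ?case using stutter_homotopic by auto
qed

text \<open>Simplicial approximation of loops; the loop is first made constant near its end so that the
  first and the last vertex of the edge path can be chosen to agree.\<close>

lemma loop_approximation:
  assumes p: "pathin (realization K) p" and loop: "p 1 = p 0"
  shows "\<exists>vs. edge_path vs \<and> hd vs = last vs \<and> loop_homotopic p (edge_loop vs)"
proof -
  \<comment> \<open>The loop becomes constant on the first and the last third. As
    \<open>\<phi>\<close> is defined on all reals, \<open>q\<close> also makes sense on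
    neighbourhoods of 0 and 1 that stick out of the unit interval.\<close>
  define \<phi> :: "real \<Rightarrow> real" where "\<phi> t = max 0 (min 1 (3 * t - 1))" for t
  define q where "q t = p (\<phi> t)" for t
  have \<phi>01: "\<phi> t \<in> {0..1}" for t by (simp add: \<phi>_def)
  have c\<phi>: "continuous_on A \<phi>" for A unfolding \<phi>_def by (intro continuous_intros)
  have pq: "loop_homotopic p q" unfolding q_def
    by (rule loop_homotopic_reparam'[OF p c\<phi>]) (auto simp: \<phi>_def loop)
  have q: "pathin (realization K) q" using homotopic_with_imp_continuous_maps[OF pq] by (simp add: pathin_def)
  note sp = loop_supports[OF p] and sq = loop_supports[OF q]
  define U where "U v = {t. 0 < q t v}" for v
  have op: "open (U v)" for v
  proof -
    have "continuous_on {0..1} (\<lambda>t. p t v)"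
      using sp(5) by (auto intro!: continuous_on_product_then_coordinatewise)
    then have "continuous_on UNIV (\<lambda>t. p (\<phi> t) v)"
      by (rule continuous_on_compose2[OF _ c\<phi>]) (use \<phi>01 in auto)
    then show ?thesis unfolding U_def q_def by (intro open_Collect_less continuous_on_const)
  qed
  have cov: "{-1..2} \<subseteq> \<Union>(range U)"
  proof
    fix t :: real
    have "p (\<phi> t) \<in> realization_points K" using sp(4) \<phi>01 by blast
    then have ne: "support (p (\<phi> t)) \<noteq> {}" and cs: "p (\<phi> t) \<in> closed_simplex (support (p (\<phi> t)))"
      using realization_point simplex_nonempty by blast+
    then obtain v where v: "v \<in> support (p (\<phi> t))" by blast
    then have "0 < p (\<phi> t) v" using closed_simplex_pos[OF cs] by blast
    then show "t \<in> \<Union>(range U)" by (auto simp: U_def q_def)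
  qed
  have opr: "\<And>B. B \<in> range U \<Longrightarrow> open B" using op by blast
  have ne: "range U \<noteq> {}" by simp
  have "\<exists>\<delta>>0. \<forall>T. T \<subseteq> {-1..2} \<longrightarrow> diameter T < \<delta> \<longrightarrow> (\<exists>B\<in>range U. T \<subseteq> B)"
  proof (rule Lebesgue_number_lemma[OF compact_Icc ne cov opr])
    fix \<delta> :: real assume d: "0 < \<delta>" "\<And>T. T \<subseteq> {-1..2} \<Longrightarrow> diameter T < \<delta> \<Longrightarrow> \<exists>B\<in>range U. T \<subseteq> B"
    show ?thesis by (intro exI[of _ \<delta>] conjI allI impI d)
  qed
  then obtain \<delta> where \<delta>: "\<delta> > 0" "\<And>T. T \<subseteq> {-1..2} \<Longrightarrow> diameter T < \<delta> \<Longrightarrow> \<exists>B\<in>range U. T \<subseteq> B"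
    by blast
  obtain N0 :: nat where N0: "2 / \<delta> < real N0" using reals_Archimedean2 by blast
  \<comment> \<open>With \<open>N \<ge> 3\<close> the last neighbourhood, as far as it lies in the
    unit interval, is contained in the final third, where the loop is constant. The summand
    \<open>N0\<close> makes all neighbourhoods smaller than the Lebesgue number.\<close>
  define N where "N = N0 + 3"
  have N: "N \<ge> 3" "2 / real N < \<delta>"
  proof -
    show "N \<ge> 3" by (simp add: N_def)
    have "2 / \<delta> < real N" using N0 by (simp add: N_def)
    then show "2 / real N < \<delta>" using \<delta>(1) \<open>N \<ge> 3\<close> by (simp add: field_simps)
  qed
  define T where "T i = {(real i - 1) / real N .. (real i + 1) / real N}" for i :: nat
  have "\<exists>v. T i \<subseteq> U v" if "i \<le> N" for i
  proof -
    have "real i + 1 \<le> 2 * real N" "- real N \<le> real i - 1" using that N(1) by linarith+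
    then have "T i \<subseteq> {-1..2}" using N(1) by (auto simp: T_def field_simps)
    moreover have "(real i - 1) / real N \<le> (real i + 1) / real N" by (intro divide_right_mono) auto
    then have "diameter (T i) = 2 / real N"
      by (simp add: T_def not_less flip: diff_divide_distrib)
    ultimately show ?thesis using \<delta>(2)[of "T i"] N(2) by auto
  qed
  then obtain v where v: "\<And>i. i \<le> N \<Longrightarrow> T i \<subseteq> U (v i)" by metis
  \<comment> \<open>The starting vertex is used again at the end; \<open>q\<close> has the same
    value there, so its coordinate at that vertex is still positive.\<close>
  define w where "w i = (if i = N then v 0 else v i)" for i
  have w: "0 < q t (w i)" if i: "i \<le> N" and t: "t \<in> T i" "t \<in> {0..1}" for i t
  proof (cases "i = N")
    case True
    have "real N - 1 \<le> real N * t" using t(1) True N(1) by (simp add: T_def field_simps)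
    moreover have "real N \<ge> 3" using N(1) by simp
    then have "1 \<le> real N * (1 / 3)" by simp
    ultimately have "real N * (2 / 3) \<le> real N * t" by linarith
    then have "2 / 3 \<le> t" using N(1) by simp
    then have "\<phi> t = 1" by (simp add: \<phi>_def)
    then have "q t = q 0" by (simp add: q_def loop \<phi>_def)
    moreover have "0 \<in> T 0" by (simp add: T_def)
    then have "0 < q 0 (v 0)" using v[of 0] by (auto simp: U_def)
    ultimately show ?thesis using True by (simp add: w_def)
  next
    case False
    then show ?thesis using v[OF i] t by (auto simp: w_def U_def)
  qed
  define vs where "vs = map w [0..<Suc N]"
  have len: "length vs = Suc N" by (simp add: vs_def)
  have nth: "vs ! i = w i" if "i \<le> N" for i using that by (simp add: vs_def nth_map del: upt_Suc)
  \<comment> \<open>On the segment between two subdivision points both their vertices have positive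
    coordinate in \<open>q t\<close>, so the edge path runs inside the simplex carrying
    \<open>q t\<close>.\<close>
  have common: "vs ! k \<in> support (q t) \<and> vs ! Suc k \<in> support (q t)"
    if k: "k < N" and t: "real k \<le> real N * t" "real N * t \<le> real (Suc k)" for k t
  proof -
    have "0 \<le> real N * t" "real N * t \<le> real N" using k t by linarith+
    then have t01: "t \<in> {0..1}" using N(1) by (simp add: zero_le_mult_iff mult_le_cancel_left1)
    have "t \<in> T k" "t \<in> T (Suc k)" using t N(1) by (auto simp: T_def field_simps)
    then have "0 < q t (w k)" "0 < q t (w (Suc k))" using w k t01 by simp_all
    then show ?thesis using nth[of k] nth[of "Suc k"] k by (simp add: support_def)
  qed
  have edge: "{vs ! k, vs ! Suc k} \<in> K" if k: "k < N" for k
  proof -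
    let ?t = "real k / real N"
    have t: "?t \<in> {0..1}" using k by simp
    have s1: "{vs ! k, vs ! Suc k} \<subseteq> support (q ?t)" using common[OF k, of ?t] k N(1) by simp
    have s2: "support (q ?t) \<in> K" using sq(2) t by blast
    show ?thesis by (rule simplex_face[OF s2 _ s1]) simp
  qed
  have path: "edge_path vs"
    unfolding edge_path_def
  proof (intro conjI)
    show "vs \<noteq> []" using len by auto
    have "vs ! k \<in> \<Union>K" if "k < Suc N" for k
    proof (cases "k < N")
      case True then show ?thesis using edge by blast
    next
      case False
      then have "Suc (N - 1) = k" using that N(1) by simp
      then show ?thesis using edge[of "N - 1"] N(1) by auto
    qed
    then show "set vs \<subseteq> \<Union>K" using len by (metis in_set_conv_nth subsetI)
    have "successively P xs" if "\<And>i. Suc i < length xs \<Longrightarrow> P (xs ! i) (xs ! Suc i)" for P :: "'v \<Rightarrow> 'v \<Rightarrow> bool" and xs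
      using that
    proof (induction P xs rule: successively.induct)
      case (3 P x y xs)
      have "P x y" using 3(2)[of 0] by simp
      moreover have "P ((y # xs) ! i) ((y # xs) ! Suc i)" if "Suc i < length (y # xs)" for i using 3(2)[of "Suc i"] that by simp
      ultimately show ?case using 3(1) by simp
    qed auto
    then show "successively (\<lambda>u v. {u, v} \<in> K) vs" using edge len by simp
  qed
  have hl: "hd vs = last vs"
  proof -
    have ne: "vs \<noteq> []" using len by auto
    have "hd vs = w 0" "last vs = w N" using ne nth[of 0] nth[of N] len by (simp_all add: hd_conv_nth last_conv_nth)
    then show ?thesis by (simp add: w_def)
  qed
  have "loop_homotopic q (edge_loop vs)"
  proof (rule loop_homotopic_straight[OF sq(5) continuous_edge_loop sq(1,2)])
    show "q 1 = q 0" by (simp add: q_def \<phi>_def loop)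
    show "edge_loop vs 1 = edge_loop vs 0" using edge_loop_ends[of vs] hl path by (simp add: edge_path_def)
    fix t :: real assume t: "t \<in> {0..1}"
    then have "0 \<le> t" "t \<le> 1" "2 \<le> length vs" using len N(1) by auto
    then obtain k where k: "Suc k < length vs" "edge_loop vs t \<in> closed_simplex {vs ! k, vs ! Suc k}"
      "real k \<le> real (length vs - 1) * t" "real (length vs - 1) * t \<le> real (Suc k)"
      using edge_loop_simplex[OF path, of t] by blast
    have "{vs ! k, vs ! Suc k} \<subseteq> support (q t)" using common[of k t] k len by simp
    moreover have "finite (support (q t))" using simplex_finite sq(2) t by blast
    ultimately have "edge_loop vs t \<in> closed_simplex (support (q t))"
      using closed_simplex_mono[of "{vs ! k, vs ! Suc k}" "support (q t)"] k(2) by blast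
    then show "\<exists>\<sigma>\<in>(\<lambda>t. support (q t)) ` {0..1}. q t \<in> closed_simplex \<sigma> \<and> edge_loop vs t \<in> closed_simplex \<sigma>"
      using sq(3)[OF t] t by blast
  qed
  then show ?thesis using path hl loop_homotopic_trans[OF pq] by blast
qed

lemma edge_loop_single: "edge_loop [u] = (\<lambda>t w. if w = u then 1 else 0)"
  using polyline_nth[of 0 "[u]"] by (simp add: edge_loop_def fun_eq_iff)

lemma constant_loops_homotopic:
  assumes "edge_path vs" shows "loop_homotopic (edge_loop [hd vs]) (edge_loop [last vs])"
proof -
  have "continuous_map (top_of_set ({0..1} \<times> {0..1})) (top_of_set {0..1}) (fst :: real \<times> real \<Rightarrow> real)"
    by (auto simp: continuous_map_in_subtopology intro!: continuous_intros)
  then have "continuous_map (top_of_set ({0..1} \<times> {0..1})) (realization K) (edge_loop vs \<circ> (fst :: real \<times> real \<Rightarrow> real))"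
    using edge_loop_pathin[OF assms] unfolding pathin_def by (rule continuous_map_compose)
  moreover have "(edge_loop vs \<circ> fst) (0, t) = edge_loop [hd vs] t" "(edge_loop vs \<circ> fst) (1, t) = edge_loop [last vs] t" for t :: real
    using edge_loop_ends[of vs] assms by (simp_all add: edge_loop_single edge_path_def)
  moreover have "(edge_loop vs \<circ> fst) (s, 1 :: real) = (edge_loop vs \<circ> fst) (s, 0 :: real)" for s by simp
  ultimately show ?thesis unfolding homotopic_with_def unit_square by blast
qed

text \<open>The homotopies are free, so constant loops at different vertices have to be compared as
  well, and the connecting paths do this. Conversely, a free homotopy between two constant loops
  traces a path, which gives connectedness.\<close>

lemma simply_connected_criterion:
  assumes red: "\<And>vs. edge_path vs \<Longrightarrow> hd vs = last vs \<Longrightarrow> edge_homotopic vs [hd vs]"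
    and conn: "\<And>u v. u \<in> \<Union>K \<Longrightarrow> v \<in> \<Union>K \<Longrightarrow> \<exists>vs. edge_path vs \<and> hd vs = u \<and> last vs = v"
  shows "simply_connected_top (realization K)" "connected_space (realization K)"
proof -
  have hom: "loop_homotopic p q" if p: "pathin (realization K) p" "p 1 = p 0" and q: "pathin (realization K) q" "q 1 = q 0" for p q
  proof -
    have *: "\<exists>u\<in>\<Union>K. loop_homotopic p (edge_loop [u])" if p: "pathin (realization K) p" "p 1 = p 0" for p
    proof -
      obtain vs where vs: "edge_path vs" "hd vs = last vs" "loop_homotopic p (edge_loop vs)"
        using loop_approximation[OF p] by blast
      have "loop_homotopic (edge_loop vs) (edge_loop [hd vs])"
        using edge_homotopic_invariants[OF red[OF vs(1,2)]] vs by blast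
      then have "loop_homotopic p (edge_loop [hd vs])" by (rule loop_homotopic_trans[OF vs(3)])
      moreover have "hd vs \<in> \<Union>K" using vs(1) hd_in_set[of vs] unfolding edge_path_def by blast
      ultimately show ?thesis by blast
    qed
    obtain u where u: "u \<in> \<Union>K" "loop_homotopic p (edge_loop [u])" using *[OF p] by blast
    obtain v where v: "v \<in> \<Union>K" "loop_homotopic q (edge_loop [v])" using *[OF q] by blast
    obtain vs where vs: "edge_path vs" "hd vs = u" "last vs = v" using conn[OF u(1) v(1)] by blast
    have "loop_homotopic (edge_loop [u]) (edge_loop [v])" using constant_loops_homotopic[OF vs(1)] vs by simp
    then show ?thesis
      by (rule loop_homotopic_trans[OF u(2) loop_homotopic_trans[OF _ loop_homotopic_sym[OF v(2)]]])
  qed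
  then show "simply_connected_top (realization K)" unfolding simply_connected_top_def by blast
  have "path_connected_space (realization K)"
    unfolding path_connected_space_def
  proof (intro ballI)
    fix x y assume x: "x \<in> topspace (realization K)" and y: "y \<in> topspace (realization K)"
    have "pathin (realization K) (\<lambda>t. x)" "pathin (realization K) (\<lambda>t. y)" using x y by (simp_all add: pathin_const)
    then have "loop_homotopic (\<lambda>t. x) (\<lambda>t. y)" by (intro hom) auto
    then obtain h where h: "continuous_map (top_of_set ({0..1} \<times> {0..1})) (realization K) h" "\<And>t :: real. h (0 :: real, t) = x" "\<And>t. h (1, t) = y"
      unfolding homotopic_with_def unit_square by blast
    have "continuous_map (top_of_set {0..1}) (top_of_set ({0..1} \<times> {0..1})) (\<lambda>s::real. (s, 0::real))"
      by (auto simp: continuous_map_in_subtopology intro!: continuous_intros)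
    then have "continuous_map (top_of_set {0..1}) (realization K) (h \<circ> (\<lambda>s. (s, 0)))"
      using h(1) by (rule continuous_map_compose)
    then have "pathin (realization K) (h \<circ> (\<lambda>s. (s, 0)))" by (simp add: pathin_def)
    then show "\<exists>g. pathin (realization K) g \<and> g 0 = x \<and> g 1 = y"
      using h(2,3) by (intro exI[of _ "h \<circ> (\<lambda>s. (s, 0))"]) simp
  qed
  then show "connected_space (realization K)" by (rule path_connected_imp_connected_space)
qed

end

section \<open>Simple connectivity\<close>

lemma flag_complex_complex: "abstract_complex (flag_complex V E)"
  unfolding abstract_complex_def flag_complex_def by (auto dest: finite_subset)

context artin_graph
begin

abbreviation X where "X \<equiv> artin_complex V E m"

lemma X_def: "X = flag_complex (artin_vertices V E m) Edges"
  by (simp add: artin_complex_def)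

sublocale X: simplicial_complex "artin_complex V E m"
  by unfold_locales (simp add: artin_complex_def flag_complex_complex)

lemma X_vertices: "\<Union>X = artin_vertices V E m"
proof
  show "\<Union>X \<subseteq> artin_vertices V E m" unfolding X_def flag_complex_def by blast
  show "artin_vertices V E m \<subseteq> \<Union>X"
  proof
    fix x assume "x \<in> artin_vertices V E m"
    then have "{x} \<in> X" unfolding X_def flag_complex_def by simp
    then show "x \<in> \<Union>X" by blast
  qed
qed

lemma vertex_X: "{x} \<in> X \<longleftrightarrow> x \<in> artin_vertices V E m"
  using X.vertex_simplex X_vertices by blast

lemma edge_X: assumes "{x, y} \<in> Edges" shows "{x, y} \<in> X"
  unfolding X_def flag_complex_def using EdgesD[OF assms] assms by (auto simp: insert_commute)

lemma triangle_X:
  assumes "x \<in> artin_vertices V E m" "y \<in> artin_vertices V E m" "z \<in> artin_vertices V E m"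
    "x = y \<or> {x, y} \<in> Edges" "y = z \<or> {y, z} \<in> Edges" "x = z \<or> {x, z} \<in> Edges"
  shows "{x, y, z} \<in> X"
proof -
  have "{y, x} \<in> Edges" if "{x, y} \<in> Edges" for x y using that by (simp only: insert_commute)
  then have "\<forall>v\<in>{x, y, z}. \<forall>w\<in>{x, y, z}. v \<noteq> w \<longrightarrow> {v, w} \<in> Edges"
    using assms(4-6) by blast
  then show ?thesis unfolding X_def flag_complex_def using assms(1-3) by blast
qed

lemma triangle_X':
  assumes "{x, y} \<in> Edges" "{y, z} \<in> Edges" "{x, z} \<in> Edges" shows "{x, y, z} \<in> X"
  using triangle_X EdgesD[OF assms(1)] EdgesD[OF assms(2)] assms by blast

lemma Edges_doubleton: assumes "e \<in> Edges" shows "\<exists>x y. e = {x, y}"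
  using assms unfolding triangulation_edges_def cayley_edges_def added_edges_def by blast

lemma X_skeleton: "skeleton_edges X = Edges"
proof
  show "skeleton_edges X \<subseteq> Edges"
  proof
    fix e assume "e \<in> skeleton_edges X"
    then obtain x y where "e = {x, y}" "x \<noteq> y" "e \<in> X" by (auto simp: skeleton_edges_def card_2_iff)
    then show "e \<in> Edges" unfolding X_def flag_complex_def by simp
  qed
  show "Edges \<subseteq> skeleton_edges X"
  proof
    fix e assume e: "e \<in> Edges"
    then obtain x y where xy: "e = {x, y}" using Edges_doubleton by blast
    then have "x \<noteq> y" "e \<in> X" using EdgesD(1) edge_X e by auto
    then show "e \<in> skeleton_edges X" using xy by (simp add: skeleton_edges_def)
  qed
qed

lemma X_flag: "is_flag X"
  unfolding is_flag_def X_vertices X_skeleton by (rule X_def)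

fun walk :: "'s word set \<Rightarrow> 's word \<Rightarrow> 's artin_vertex list" where
  "walk h [] = [Elt h]"
| "walk h (p # u) = Elt h # walk (h \<cdot> el [p]) u"

lemma walk_not_Nil [simp]: "walk h u \<noteq> []" by (cases u) auto

lemma hd_walk [simp]: "hd (walk h u) = Elt h" by (cases u) auto

lemma el_Cons: "p # u \<in> words V \<Longrightarrow> el (p # u) = el [p] \<cdot> el u"
  using el_mult[of "[p]" u] by (simp add: words_Cons)

lemma walk_append:
  "h \<in> carrier AG \<Longrightarrow> u \<in> words V \<Longrightarrow> v \<in> words V \<Longrightarrow> walk h (u @ v) = butlast (walk h u) @ walk (h \<cdot> el u) v"
proof (induction u arbitrary: h)
  case Nil then show ?case by (simp add: el_Nil)
next
  case (Cons p u)
  have p: "[p] \<in> words V" "u \<in> words V" using Cons.prems by (auto simp: words_Cons)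
  show ?case using Cons.IH[of "h \<cdot> el [p]"] Cons.prems p el_Cons[of p u] by (simp add: AG.m_assoc)
qed

lemma last_walk: "h \<in> carrier AG \<Longrightarrow> u \<in> words V \<Longrightarrow> last (walk h u) = Elt (h \<cdot> el u)"
proof (induction u arbitrary: h)
  case Nil then show ?case by (simp add: el_Nil)
next
  case (Cons p u)
  have p: "[p] \<in> words V" "u \<in> words V" using Cons.prems by (auto simp: words_Cons)
  show ?case using Cons.IH[of "h \<cdot> el [p]"] Cons.prems p el_Cons[of p u] by (simp add: AG.m_assoc)
qed

lemma walk_append': 
  assumes "h \<in> carrier AG" "u \<in> words V" "v \<in> words V"
  shows "walk h (u @ v) = walk h u @ tl (walk (h \<cdot> el u) v)"
proof -
  have "walk (h \<cdot> el u) v = Elt (h \<cdot> el u) # tl (walk (h \<cdot> el u) v)"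
    by (metis hd_walk list.collapse walk_not_Nil)
  moreover have "walk h u = butlast (walk h u) @ [Elt (h \<cdot> el u)]"
    using append_butlast_last_id[of "walk h u"] last_walk[OF assms(1,2)] by simp
  ultimately show ?thesis using walk_append[OF assms] by (metis append.assoc append_Cons append_Nil)
qed

lemma letter_edge:
  assumes h: "h \<in> carrier AG" and s: "s \<in> V" shows "{Elt h, Elt (h \<cdot> el [(s, c)])} \<in> Edges"
proof (cases c)
  case True
  then show ?thesis using cayley_Edges[OF h s] by (simp add: gen_def)
next
  case False
  have "{Elt (h \<cdot> inv\<^bsub>AG\<^esub> gen s), Elt ((h \<cdot> inv\<^bsub>AG\<^esub> gen s) \<cdot> gen s)} \<in> Edges"
    using h s by (intro cayley_Edges) simp_all
  then show ?thesis using h s False by (simp add: el_inverse_letter AG.m_assoc insert_commute)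
qed

lemma Elt_vertex: "h \<in> carrier AG \<Longrightarrow> Elt h \<in> artin_vertices V E m"
  by (simp add: artin_vertices_def)

lemma walk_edge_path: "h \<in> carrier AG \<Longrightarrow> u \<in> words V \<Longrightarrow> X.edge_path (walk h u)"
proof (induction u arbitrary: h)
  case Nil then show ?case by (simp add: X.edge_path_def X_vertices Elt_vertex)
next
  case (Cons p u)
  obtain s c where p: "p = (s, c)" by force
  have s: "s \<in> V" "u \<in> words V" using Cons.prems p by (auto simp: words_Cons)
  have "X.edge_path (walk (h \<cdot> el [p]) u)" using Cons s p by simp
  moreover have "{Elt h, Elt (h \<cdot> el [p])} \<in> X" using letter_edge[OF Cons.prems(1) s(1)] p edge_X by blast
  ultimately show ?case using Cons.prems
    by (simp add: X.edge_path_def X_vertices Elt_vertex successively_Cons)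
qed

abbreviation eqh (infix \<open>\<simeq>\<close> 50) where "vs \<simeq> ws \<equiv> X.edge_homotopic vs ws"

lemma eqh_context: "vs \<simeq> ws \<Longrightarrow> xs @ vs @ ys \<simeq> xs @ ws @ ys"
proof (induction rule: X.edge_homotopic.induct)
  case (triangle u v w as bs)
  then show ?case using X.edge_homotopic.triangle[of u v w "xs @ as" "bs @ ys"] by simp
next
  case (stutter u as bs)
  then show ?case using X.edge_homotopic.stutter[of u "xs @ as" "bs @ ys"] by simp
qed (blast intro: X.edge_homotopic.intros)+

lemma eqh_append: "vs \<simeq> ws \<Longrightarrow> vs @ ys \<simeq> ws @ ys"
  using eqh_context[of vs ws "[]" ys] by simp

lemma eqh_trans: "us \<simeq> vs \<Longrightarrow> vs \<simeq> ws \<Longrightarrow> us \<simeq> ws" by (rule X.edge_homotopic.trans)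
lemma eqh_sym: "us \<simeq> vs \<Longrightarrow> vs \<simeq> us" by (rule X.edge_homotopic.sym)

declare eqh_trans [trans]

lemma eqh_spur: assumes "{x, y} \<in> Edges" shows "xs @ x # y # x # ys \<simeq> xs @ x # ys"
proof -
  have v: "x \<in> artin_vertices V E m" "y \<in> artin_vertices V E m" using EdgesD[OF assms] by auto
  have "{x, y, x} \<in> X" using assms v by (intro triangle_X) (auto simp: insert_commute)
  then have "xs @ x # y # x # ys \<simeq> xs @ x # x # ys" by (rule X.edge_homotopic.triangle)
  also have "xs @ x # x # ys \<simeq> xs @ x # ys" using v vertex_X by (intro X.edge_homotopic.stutter) simp
  finally show ?thesis .
qed

end

context artin_edge
begin

definition alt_word :: "bool \<Rightarrow> nat \<Rightarrow> 's word" where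
  "alt_word x k = map (letter a b) (alternating x k)"

lemma alt_word_words [simp]: "alt_word x k \<in> words V"
  using pair_eval_el[of a b] by (simp add: alt_word_def)

lemma el_alt_word: "el (alt_word x k) = sim x k"
  using pair_eval_el[of a b] by (simp add: alt_word_def sim_def)

lemma alt_word_Suc: "\<exists>p. alt_word x (Suc k) = alt_word x k @ [p] \<and> [p] \<in> words V"
  unfolding alt_word_def alternating_Suc_end by (simp add: letter_def)

lemma alt_word_alt: "alt_word True k = alt a b k" "alt_word False k = alt b a k"
  by (simp_all add: alt_word_def map_letter_alternating)

lemma walk_alt_word_Suc:
  assumes "h \<in> carrier AG"
  shows "walk h (alt_word x (Suc k)) = walk h (alt_word x k) @ [rim x h (Suc k)]"
proof -
  obtain p where p: "alt_word x (Suc k) = alt_word x k @ [p]" "[p] \<in> words V" using alt_word_Suc by blast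
  have "tl (walk (h \<cdot> sim x k) [p]) = [Elt (h \<cdot> sim x k \<cdot> el [p])]" by simp
  moreover have "sim x (Suc k) = sim x k \<cdot> el [p]"
    using el_mult[OF alt_word_words p(2), of x k] p(1) el_alt_word[of x "Suc k"] by (simp add: el_alt_word)
  ultimately show ?thesis using walk_append'[OF assms alt_word_words p(2), of x k] p assms
    by (simp add: el_alt_word rim_def AG.m_assoc)
qed

lemma rim_edge: "h \<in> carrier AG \<Longrightarrow> {rim x h k, rim x h (Suc k)} \<in> Edges"
  using bedge_Edges[OF bedge_cayley[of "h \<cdot> sim x k" "if even k then x else \<not> x"]]
  by (simp add: rim_def sim_Suc AG.m_assoc)

definition spine_path :: "'s word set \<Rightarrow> nat \<Rightarrow> 's artin_vertex list" where
  "spine_path h j = map (spine h) [0..<Suc j]"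

lemma spine_path_Suc: "spine_path h (Suc j) = spine_path h j @ [spine h (Suc j)]"
  by (simp add: spine_path_def)

lemma spine_vertex_X: "h \<in> carrier AG \<Longrightarrow> j \<le> n - 1 \<Longrightarrow> spine h j \<in> artin_vertices V E m"
  using spine_block block_vertices by blast

lemma rim_vertex_X: "h \<in> carrier AG \<Longrightarrow> rim x h j \<in> artin_vertices V E m"
  using rim_block block_vertices by blast

text \<open>Two triangles of the cell, one on either side of the segment from
  \<open>spine h j\<close> to the next rim vertex, push one more step of the boundary path onto the
  spine.\<close>

lemma walk_spine:
  assumes h: "h \<in> carrier AG"
  shows "j \<le> n - 1 \<Longrightarrow> walk h (alt_word x j) @ [spine h j] \<simeq> spine_path h j"
proof (induction j)
  case 0
  have "[] @ Elt h # Elt h # [] \<simeq> [] @ Elt h # []"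
    using h vertex_X Elt_vertex by (intro X.edge_homotopic.stutter) simp
  then show ?case by (simp add: spine_path_def spine_def alt_word_def)
next
  case (Suc j)
  let ?w = "butlast (walk h (alt_word x j))"
  have w: "walk h (alt_word x j) = ?w @ [rim x h j]"
    using append_butlast_last_id[of "walk h (alt_word x j)"] last_walk[OF h alt_word_words]
    by (simp add: el_alt_word rim_def)
  have e1: "{rim x h (Suc j), spine h (Suc j)} \<in> Edges" "{rim x h (Suc j), spine h j} \<in> Edges" "{spine h j, spine h (Suc j)} \<in> Edges"
    using edge_rim_spine[OF h, of "Suc j"] Suc.prems by simp_all
  have e2: "rim x h j = spine h j \<or> {rim x h j, spine h j} \<in> Edges"
    using edge_rim_spine(1)[OF h, of j] Suc.prems h by (cases "j = 0") (auto simp: rim_def spine_def)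
  have e3: "{rim x h j, rim x h (Suc j)} \<in> Edges" by (rule rim_edge[OF h])
  have t1: "{rim x h j, spine h j, rim x h (Suc j)} \<in> X"
    using e1 e2 e3 h Suc.prems spine_vertex_X rim_vertex_X by (intro triangle_X) (auto simp: insert_commute)
  have t2: "{spine h j, rim x h (Suc j), spine h (Suc j)} \<in> X"
    using e1 by (intro triangle_X') (simp_all add: insert_commute)
  have "walk h (alt_word x (Suc j)) @ [spine h (Suc j)] = ?w @ rim x h j # rim x h (Suc j) # [spine h (Suc j)]"
    unfolding walk_alt_word_Suc[OF h] by (subst w) simp
  also have "\<dots> \<simeq> ?w @ rim x h j # spine h j # rim x h (Suc j) # [spine h (Suc j)]"
    by (rule eqh_sym, rule X.edge_homotopic.triangle[OF t1])
  also have "\<dots> = (?w @ [rim x h j]) @ spine h j # rim x h (Suc j) # spine h (Suc j) # []" by simp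
  also have "\<dots> \<simeq> (?w @ [rim x h j]) @ spine h j # spine h (Suc j) # []"
    by (rule X.edge_homotopic.triangle[OF t2])
  also have "\<dots> = (walk h (alt_word x j) @ [spine h j]) @ [spine h (Suc j)]" by (simp flip: w)
  also have "\<dots> \<simeq> spine_path h j @ [spine h (Suc j)]" using Suc by (intro eqh_append) simp
  finally show ?case by (simp add: spine_path_Suc)
qed

text \<open>The spine is independent of \<open>x\<close>, so both halves of the boundary are
  homotopic to it and hence to each other.\<close>

lemma walk_relation_spine:
  assumes h: "h \<in> carrier AG" shows "walk h (alt_word x n) \<simeq> spine_path h (n - 1)"
proof -
  have n: "n = Suc (n - 1)" using n_ge_2 by simp
  have "rim x h n = spine h (n - 1)" using n_ge_2 by (simp add: rim_def spine_def sim_n)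
  then have "walk h (alt_word x n) = walk h (alt_word x (n - 1)) @ [spine h (n - 1)]"
    using walk_alt_word_Suc[OF h, of x "n - 1"] n by simp
  then show ?thesis using walk_spine[OF h, of "n - 1" x] by simp
qed

lemma walk_relation:
  assumes h: "h \<in> carrier AG" shows "walk h (alt a b n) \<simeq> walk h (alt b a n)"
  using walk_relation_spine[OF h, of True] walk_relation_spine[OF h, of False] eqh_trans eqh_sym
  unfolding alt_word_alt by blast

end

context artin_graph
begin

lemma walk_weq: "weq u v \<Longrightarrow> h \<in> carrier AG \<Longrightarrow> walk h u \<simeq> walk h v"
proof (induction arbitrary: h rule: pres_eq.induct)
  case (refl u) then show ?case by (intro X.edge_homotopic.refl)
next
  case (sym u v) then show ?case using eqh_sym by blast
next
  case (trans u v w) then show ?case using eqh_trans by blast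
next
  case (cancel u v s c)
  have c: "[(s, c), (s, \<not> c)] \<in> words V" using cancel by (simp add: words_Cons)
  have "weq ([] @ [(s, c), (s, \<not> c)] @ []) ([] @ [])" using cancel by (intro pres_eq.cancel) auto
  then have e: "el [(s, c), (s, \<not> c)] = \<one>\<^bsub>AG\<^esub>" using c by (simp add: el_eq_iff flip: el_Nil)
  let ?h = "h \<cdot> el u"
  have h: "?h \<in> carrier AG" using cancel by simp
  have wl: "walk ?h v = Elt ?h # tl (walk ?h v)" by (cases v) auto
  have e2: "?h \<cdot> el [(s, c)] \<cdot> el [(s, \<not> c)] = ?h"
    using e el_mult[of "[(s, c)]" "[(s, \<not> c)]"] cancel h by (simp add: AG.m_assoc)
  have "walk h (u @ [(s, c), (s, \<not> c)] @ v) = butlast (walk h u) @ walk ?h ([(s, c), (s, \<not> c)] @ v)"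
    using cancel c by (intro walk_append) (simp_all add: words_Cons)
  also have "\<dots> = butlast (walk h u) @ Elt ?h # Elt (?h \<cdot> el [(s, c)]) # walk ?h v"
    using e2 by simp
  also have "\<dots> = butlast (walk h u) @ Elt ?h # Elt (?h \<cdot> el [(s, c)]) # Elt ?h # tl (walk ?h v)"
    by (simp only: wl[symmetric])
  also have "\<dots> \<simeq> butlast (walk h u) @ Elt ?h # tl (walk ?h v)"
    using letter_edge[OF h] cancel by (intro eqh_spur) simp
  also have "\<dots> = butlast (walk h u) @ walk ?h v" by (simp only: wl[symmetric])
  also have "\<dots> = walk h (u @ v)" using cancel by (intro walk_append[symmetric])
  finally show ?case .
next
  case (relation u v l r)
  then obtain a b where ab: "{a, b} \<in> E" and lr: "l = alt a b (m {a, b})" "r = alt b a (m {a, b})"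
    by (auto simp: artin_relations_def)
  interpret artin_edge V E m a b using ab by (rule artin_edgeI)
  let ?h = "h \<cdot> el u"
  have h: "?h \<in> carrier AG" using relation by simp
  have "weq ([] @ l @ []) ([] @ r @ [])" using relation by (intro pres_eq.relation) auto
  then have e: "el l = el r" using relation by (simp add: el_eq_iff)
  have split: "walk h (u @ w @ v) = butlast (walk h u) @ walk ?h w @ tl (walk (?h \<cdot> el w) v)" if "w \<in> words V" for w
    using walk_append[of h u "w @ v"] walk_append'[OF h that relation(2)] relation that by simp
  have "butlast (walk h u) @ walk ?h l @ tl (walk (?h \<cdot> el l) v) \<simeq> butlast (walk h u) @ walk ?h r @ tl (walk (?h \<cdot> el l) v)"
    unfolding lr by (rule eqh_context[OF walk_relation[OF h]])
  then show ?case using split[of l] split[of r] relation e by simp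
qed

definition word_of :: "'s word set \<Rightarrow> 's word" where
  "word_of h = (SOME w. w \<in> words V \<and> h = el w)"

lemma word_of: assumes "h \<in> carrier AG" shows "word_of h \<in> words V" "el (word_of h) = h"
proof -
  have "\<exists>w. w \<in> words V \<and> h = el w" using carrier_el[OF assms] by blast
  from someI_ex[OF this] show "word_of h \<in> words V" "el (word_of h) = h" by (simp_all add: word_of_def)
qed

abbreviation base :: "'s word \<Rightarrow> 's artin_vertex list" where "base \<equiv> walk \<one>\<^bsub>AG\<^esub>"

text \<open>Any word representing \<open>h\<close> will do, since walks along equal words are
  homotopic. For an interior vertex the path continues along the spine of its cell.\<close>

fun canonical :: "'s artin_vertex \<Rightarrow> 's artin_vertex list" where
  "canonical (Elt h) = base (word_of h)"
| "canonical (Inner h e j) = base (word_of h) @ map (Inner h e) [1..<Suc j]"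

lemma base_canonical:
  assumes "w \<in> words V" shows "base w \<simeq> canonical (Elt (el w))"
proof -
  have "weq w (word_of (el w))" using word_of[of "el w"] assms by (simp flip: el_eq_iff)
  then show ?thesis using walk_weq by simp
qed

lemma canonical_end:
  assumes "x \<in> artin_vertices V E m" shows "\<exists>xs. canonical x = xs @ [x]"
proof (cases x)
  case (Elt h)
  then have "h \<in> carrier AG" using assms by (auto simp: artin_vertices_def)
  then have "last (base (word_of h)) = Elt h" using last_walk[of "\<one>\<^bsub>AG\<^esub>" "word_of h"] word_of by simp
  then show ?thesis using append_butlast_last_id[of "base (word_of h)"] Elt by (metis canonical.simps(1) walk_not_Nil)
next
  case (Inner h e j)
  then have "1 \<le> j" using assms by (auto simp: artin_vertices_def)
  then show ?thesis using Inner by simp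
qed

text \<open>Compatibility of the canonical paths with an edge. Once it holds for all edges, every
  path from the identity is homotopic to the canonical path of its end.\<close>

definition follows :: "'s artin_vertex \<Rightarrow> 's artin_vertex \<Rightarrow> bool" where
  "follows x y \<longleftrightarrow> canonical x @ [y] \<simeq> canonical y"

lemma follows_sym:
  assumes "{x, y} \<in> Edges" "follows x y" shows "follows y x"
proof -
  obtain xs where xs: "canonical x = xs @ [x]" using canonical_end EdgesD(2)[OF assms(1)] by blast
  have "canonical y @ [x] \<simeq> (canonical x @ [y]) @ [x]"
    using assms(2) unfolding follows_def by (rule eqh_append[OF eqh_sym])
  also have "(canonical x @ [y]) @ [x] = xs @ x # y # x # []" by (simp add: xs)
  also have "\<dots> \<simeq> xs @ x # []" by (rule eqh_spur[OF assms(1)])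
  finally show ?thesis by (simp add: follows_def xs)
qed

text \<open>An edge inherits compatibility from two edges to a common vertex. This is how the added
  edges are handled.\<close>

lemma follows_triangle:
  assumes e: "{y, x} \<in> Edges" "{y, z} \<in> Edges" "{x, z} \<in> Edges" and f: "follows y x" "follows y z"
  shows "follows x z"
proof -
  obtain ys where ys: "canonical y = ys @ [y]" using canonical_end EdgesD(2)[OF e(1)] by blast
  have t: "{y, x, z} \<in> X" by (rule triangle_X'[OF e(1,3,2)])
  have "canonical x @ [z] \<simeq> (canonical y @ [x]) @ [z]"
    using f(1) unfolding follows_def by (rule eqh_append[OF eqh_sym])
  also have "(canonical y @ [x]) @ [z] = ys @ y # x # z # []" by (simp add: ys)
  also have "\<dots> \<simeq> ys @ y # z # []" by (rule X.edge_homotopic.triangle[OF t])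
  also have "\<dots> = canonical y @ [z]" by (simp add: ys)
  also have "\<dots> \<simeq> canonical z" using f(2) unfolding follows_def .
  finally show ?thesis by (simp add: follows_def)
qed

lemma follows_cayley:
  assumes "h \<in> carrier AG" "s \<in> V" shows "follows (Elt h) (Elt (h \<cdot> gen s))"
proof -
  have w: "word_of h @ [(s, True)] \<in> words V" using assms word_of by simp
  have e: "el (word_of h @ [(s, True)]) = h \<cdot> gen s"
    using el_mult[of "word_of h" "[(s, True)]"] assms word_of by (simp add: gen_def)
  have "base (word_of h @ [(s, True)]) = base (word_of h) @ [Elt (h \<cdot> gen s)]"
    using walk_append'[of "\<one>\<^bsub>AG\<^esub>" "word_of h" "[(s, True)]"] assms word_of[OF assms(1)] by (simp add: gen_def)
  then show ?thesis using base_canonical[OF w] by (simp add: follows_def e)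
qed

end

context artin_edge
begin

lemma base_rim:
  assumes h: "h \<in> carrier AG"
  shows "butlast (base (word_of h)) @ walk h (alt_word x k) \<simeq> canonical (rim x h k)"
proof -
  have w: "word_of h @ alt_word x k \<in> words V" using word_of[OF h] by simp
  have "el (word_of h @ alt_word x k) = h \<cdot> sim x k"
    using el_mult[of "word_of h" "alt_word x k"] word_of[OF h] by (simp add: el_alt_word)
  moreover have "base (word_of h @ alt_word x k) = butlast (base (word_of h)) @ walk h (alt_word x k)"
    using walk_append[of "\<one>\<^bsub>AG\<^esub>" "word_of h" "alt_word x k"] word_of[OF h] h by simp
  ultimately show ?thesis using base_canonical[OF w] by (simp add: rim_def)
qed

text \<open>At \<open>j = n - 1\<close> the spine ends in a group element, whose canonical path
  follows an unrelated word; there the spine is exchanged for one half of the boundary.\<close>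

lemma base_spine_path:
  assumes h: "h \<in> carrier AG" and j: "j \<le> n - 1"
  shows "butlast (base (word_of h)) @ spine_path h j \<simeq> canonical (spine h j)"
proof (cases "j = n - 1")
  case True
  have "butlast (base (word_of h)) @ spine_path h (n - 1) \<simeq> butlast (base (word_of h)) @ walk h (alt_word True n)"
    using eqh_context[OF eqh_sym[OF walk_relation_spine[OF h, of True]], of "butlast (base (word_of h))" "[]"] by simp
  also have "\<dots> \<simeq> canonical (rim True h n)" by (rule base_rim[OF h])
  also have "rim True h n = spine h (n - 1)" using n_ge_2 by (simp add: rim_def spine_def sim_n)
  finally show ?thesis by (simp add: True)
next
  case False
  have l: "base (word_of h) = butlast (base (word_of h)) @ [Elt h]"
    using append_butlast_last_id[of "base (word_of h)"] last_walk[of "\<one>\<^bsub>AG\<^esub>" "word_of h"] word_of[OF h] h by simp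
  have "spine h 0 = Elt h" by (simp add: spine_def)
  then have sp: "spine_path h j = Elt h # map (spine h) [1..<Suc j]"
    unfolding spine_path_def by (simp add: upt_conv_Cons del: upt_Suc)
  have "map (spine h) [1..<Suc j] = map (Inner h {a, b}) [1..<Suc j]"
    using False j by (auto simp: spine_def simp del: upt_Suc)
  then have "butlast (base (word_of h)) @ spine_path h j = base (word_of h) @ map (Inner h {a, b}) [1..<Suc j]"
    by (subst (2) l) (simp add: sp del: upt_Suc)
  moreover have "canonical (spine h j) = base (word_of h) @ map (Inner h {a, b}) [1..<Suc j]"
    using False j by (cases "j = 0") (simp_all add: spine_def)
  ultimately show ?thesis using X.edge_homotopic.refl by simp
qed

lemma follows_rim_spine:
  assumes h: "h \<in> carrier AG" and k: "1 \<le> k" "k \<le> n - 1"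
  shows "follows (rim x h k) (spine h k)" "follows (spine h (k - 1)) (spine h k)" "follows (spine h (k - 1)) (rim x h k)"
proof -
  let ?b = "butlast (base (word_of h))"
  have rs: "canonical (rim x h j) @ [spine h j] \<simeq> canonical (spine h j)" if "j \<le> n - 1" for j
  proof -
    have "canonical (rim x h j) @ [spine h j] \<simeq> (?b @ walk h (alt_word x j)) @ [spine h j]"
      by (rule eqh_append[OF eqh_sym[OF base_rim[OF h]]])
    also have "\<dots> = ?b @ (walk h (alt_word x j) @ [spine h j]) @ []" by simp
    also have "\<dots> \<simeq> ?b @ spine_path h j @ []" by (rule eqh_context[OF walk_spine[OF h that]])
    also have "\<dots> = ?b @ spine_path h j" by simp
    also have "\<dots> \<simeq> canonical (spine h j)" by (rule base_spine_path[OF h that])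
    finally show ?thesis .
  qed
  then show "follows (rim x h k) (spine h k)" using k by (simp add: follows_def)
  have k1: "k - 1 \<le> n - 1" "Suc (k - 1) = k" using k by simp_all
  have "canonical (spine h (k - 1)) @ [spine h k] \<simeq> (?b @ spine_path h (k - 1)) @ [spine h k]"
    by (rule eqh_append[OF eqh_sym[OF base_spine_path[OF h k1(1)]]])
  also have "\<dots> = ?b @ spine_path h k" using spine_path_Suc[of h "k - 1"] k1 by simp
  also have "\<dots> \<simeq> canonical (spine h k)" by (rule base_spine_path[OF h k(2)])
  finally show "follows (spine h (k - 1)) (spine h k)" by (simp add: follows_def)
  have v: "rim x h (k - 1) \<in> artin_vertices V E m" by (rule rim_vertex_X[OF h])
  obtain xs where xs: "canonical (rim x h (k - 1)) = xs @ [rim x h (k - 1)]" using canonical_end[OF v] by blast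
  have e3: "{rim x h (k - 1), rim x h k} \<in> Edges" using rim_edge[OF h, of x "k - 1"] k1 by simp
  have e1: "{rim x h k, spine h (k - 1)} \<in> Edges" by (rule edge_rim_spine(2)[OF h k])
  have e2: "rim x h (k - 1) = spine h (k - 1) \<or> {rim x h (k - 1), spine h (k - 1)} \<in> Edges"
    using edge_rim_spine(1)[OF h, of "k - 1"] k h by (cases "k = 1") (auto simp: rim_def spine_def)
  have t: "{rim x h (k - 1), spine h (k - 1), rim x h k} \<in> X"
    using e1 e2 e3 h k1 spine_vertex_X rim_vertex_X by (intro triangle_X) (auto simp: insert_commute)
  have "canonical (spine h (k - 1)) @ [rim x h k] \<simeq> (canonical (rim x h (k - 1)) @ [spine h (k - 1)]) @ [rim x h k]"
    by (rule eqh_append[OF eqh_sym[OF rs[OF k1(1)]]])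
  also have "\<dots> = xs @ rim x h (k - 1) # spine h (k - 1) # rim x h k # []" unfolding xs by simp
  also have "\<dots> \<simeq> xs @ rim x h (k - 1) # rim x h k # []" by (rule X.edge_homotopic.triangle[OF t])
  also have "\<dots> = canonical (rim x h (k - 1)) @ [rim x h k]" unfolding xs by simp
  also have "\<dots> \<simeq> (?b @ walk h (alt_word x (k - 1))) @ [rim x h k]"
    by (rule eqh_append[OF eqh_sym[OF base_rim[OF h]]])
  also have "\<dots> = ?b @ walk h (alt_word x k)" using walk_alt_word_Suc[OF h, of x "k - 1"] k1 by simp
  also have "\<dots> \<simeq> canonical (rim x h k)" by (rule base_rim[OF h])
  finally show "follows (spine h (k - 1)) (rim x h k)" by (simp add: follows_def)
qed

lemma follows_rim:
  assumes g: "g \<in> carrier AG" shows "follows (rim x g k) (rim x g (Suc k))"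
proof -
  define s where "s = (if (if even k then x else \<not> x) then a else b)"
  have "lt (if even k then x else \<not> x) = gen s" unfolding s_def lt_def by (simp only: if_distrib[of gen])
  then have "rim x g (Suc k) = Elt (g \<cdot> sim x k \<cdot> gen s)"
    unfolding rim_def sim_Suc using g by (metis AG.m_assoc lt_closed sim_closed)
  moreover have "s \<in> V" by (simp add: s_def)
  ultimately show ?thesis unfolding rim_def[of x g k] using follows_cayley g by simp
qed

text \<open>The two cells share a boundary vertex: \<open>sir x i\<close> followed by the word of
  length \<open>j\<close> beginning with the other letter is alternating, so the \<open>j\<close>-th
  rim vertex of one cell is the \<open>(i + j)\<close>-th of the other. Both ends of the added edge
  are joined to it by edges of the triangulated cells.\<close>

lemma follows_added:
  assumes g: "g \<in> carrier AG" and i: "1 \<le> i" and j: "1 \<le> j"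
    and j': "j' = j + i \<and> j + i \<le> n - 2 \<or> j' = j + i - 1 \<and> j + i \<le> n - 1"
  shows "follows (spine g j) (spine (g \<cdot> inv\<^bsub>AG\<^esub> sir x i) j')"
proof -
  let ?h = "g \<cdot> inv\<^bsub>AG\<^esub> sir x i"
  have h: "?h \<in> carrier AG" using g by simp
  define z where "z = (if even i then \<not> x else x)"
  have "sir x i \<cdot> sim (\<not> x) j = sim z (i + j)" using sir_sim_mult[of x "\<not> x" i j] by (simp add: z_def)
  then have "?h \<cdot> sim z (i + j) = g \<cdot> sim (\<not> x) j" using g by (simp add: AG.m_assoc AG.inv_cancel_left flip: \<open>_ = sim z (i + j)\<close>)
  then have y: "rim (\<not> x) g j = rim z ?h (i + j)" by (simp add: rim_def)
  have b: "1 \<le> j" "j \<le> n - 1" "1 \<le> i + j" "i + j \<le> n - 1" using i j j' by auto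
  have e1: "{rim (\<not> x) g j, spine g j} \<in> Edges" by (rule edge_rim_spine(1)[OF g b(1,2)])
  have f1: "follows (rim (\<not> x) g j) (spine g j)" by (rule follows_rim_spine(1)[OF g b(1,2)])
  have e2: "{rim (\<not> x) g j, spine ?h j'} \<in> Edges" "follows (rim (\<not> x) g j) (spine ?h j')"
  proof -
    consider "j' = i + j" | "j' = i + j - 1" using j' by linarith
    then have "{rim z ?h (i + j), spine ?h j'} \<in> Edges \<and> follows (rim z ?h (i + j)) (spine ?h j')"
    proof cases
      case 1
      then show ?thesis using edge_rim_spine(1)[OF h b(3,4)] follows_rim_spine(1)[OF h b(3,4)] by simp
    next
      case 2
      have "{spine ?h (i + j - 1), rim z ?h (i + j)} \<in> Edges"
        using edge_rim_spine(2)[OF h b(3,4), of z] by (simp only: insert_commute)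
      then show ?thesis
        using edge_rim_spine(2)[OF h b(3,4), of z] follows_sym[OF _ follows_rim_spine(3)[OF h b(3,4), of z]] 2 by simp
    qed
    then show "{rim (\<not> x) g j, spine ?h j'} \<in> Edges" "follows (rim (\<not> x) g j) (spine ?h j')" by (simp_all add: y)
  qed
  have "{spine g j, spine ?h j'} \<in> Edges"
    using edge_added1[OF g i j, of x] edge_added2[OF g i j, of x] j' by auto
  then show ?thesis using follows_triangle[OF e1 e2(1) _ f1 e2(2)] by blast
qed

end

section \<open>Compatibility of all edges and contraction of edge loops\<close>

context artin_graph
begin

lemma cell_triangle_elim:
  assumes "t \<in> cell_triangles V E m"
  obtains (rim) g a b k where "g \<in> carrier AG" "{a, b} \<in> E" "k \<in> {1..m {a, b} - 2}"
      "t = {path_vertex V E m g a b k, path_vertex V E m g a b (k + 1), axis_vertex V E m g a b k}"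
    | (spine) g a b k where "g \<in> carrier AG" "{a, b} \<in> E" "k \<in> {1..m {a, b} - 1}"
      "t = {path_vertex V E m g a b k, axis_vertex V E m g a b (k - 1), axis_vertex V E m g a b k}"
  using assms unfolding cell_triangles_def
proof (elim UnE CollectE exE conjE)
  fix g a b k assume "g \<in> carrier AG" "{a, b} \<in> E" "k \<in> {1..m {a, b} - 2}"
      "t = {path_vertex V E m g a b k, path_vertex V E m g a b (k + 1), axis_vertex V E m g a b k}"
  then show thesis by (rule rim)
next
  fix g a b k assume "g \<in> carrier AG" "{a, b} \<in> E" "k \<in> {1..m {a, b} - 1}"
      "t = {path_vertex V E m g a b k, axis_vertex V E m g a b (k - 1), axis_vertex V E m g a b k}"
  then show thesis by (rule spine)
qed

lemma Edges_elim:
  assumes "e \<in> Edges"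
  obtains (cayley) h s where "h \<in> carrier AG" "s \<in> V" "e = {Elt h, Elt (h \<cdot> el [(s, True)])}"
    | (triangle) u v t where "t \<in> cell_triangles V E m" "u \<in> t" "v \<in> t" "u \<noteq> v" "e = {u, v}"
    | (added) g a b i j j' where "g \<in> carrier AG" "{a, b} \<in> E" "3 \<le> m {a, b}" "i \<in> {1..m {a, b} - 2}"
        "e = {Inner g {a, b} j, Inner (g \<cdot> inv\<^bsub>AG\<^esub> el (rev (alt a b i))) {a, b} j'}"
        "j' = j + i \<and> j \<in> {1..m {a, b} - 2 - i} \<or> j' = j + i - 1 \<and> j \<in> {1..m {a, b} - 1 - i}"
  using assms unfolding triangulation_edges_def cayley_edges_def added_edges_def
proof (elim UnE CollectE exE conjE)
  fix h s assume "e = {Elt h, Elt (h \<cdot> el [(s, True)])}" "h \<in> carrier AG" "s \<in> V"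
  then show thesis by (rule cayley[rotated 2])
next
  fix u v t assume "e = {u, v}" "t \<in> cell_triangles V E m" "u \<in> t" "v \<in> t" "u \<noteq> v"
  then show thesis by (rule triangle[rotated 4])
next
  fix g a b i j w assume *: "e = {Inner g {a, b} j, Inner (g \<cdot> inv\<^bsub>AG\<^esub> w) {a, b} (j + i)}"
    "g \<in> carrier AG" "{a, b} \<in> E" "3 \<le> m {a, b}" "i \<in> {1..m {a, b} - 2}"
    "w = el (rev (alt a b i))" "j \<in> {1..m {a, b} - 2 - i}"
  show thesis by (rule added[OF *(2-5) *(1)[unfolded *(6)]]) (use *(7) in simp)
next
  fix g a b i j w assume *: "e = {Inner g {a, b} j, Inner (g \<cdot> inv\<^bsub>AG\<^esub> w) {a, b} (j + i - 1)}"
    "g \<in> carrier AG" "{a, b} \<in> E" "3 \<le> m {a, b}" "i \<in> {1..m {a, b} - 2}"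
    "w = el (rev (alt a b i))" "j \<in> {1..m {a, b} - 1 - i}"
  show thesis by (rule added[OF *(2-5) *(1)[unfolded *(6)]]) (use *(7) in simp)
qed

lemma cell_triangle_follows:
  assumes "t \<in> cell_triangles V E m"
  shows "\<exists>p q r. t = {p, q, r} \<and> follows p q \<and> follows q r \<and> follows p r \<and>
    {p, q} \<in> Edges \<and> {q, r} \<in> Edges \<and> {p, r} \<in> Edges"
  using assms
proof (cases rule: cell_triangle_elim)
  case (rim g a b k)
  interpret artin_edge V E m a b using rim(2) by (rule artin_edgeI)
  have k: "1 \<le> k" "k \<le> n - 1" "1 \<le> k + 1" "k + 1 \<le> n - 1" using rim(3) by auto
  let ?p = "local.rim True g k" and ?q = "local.spine g k" and ?r = "local.rim True g (k + 1)"
  have t: "t = {?p, ?q, ?r}"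
    unfolding rim(4) rim_vertex(1) spine_vertex(1) by (rule arg_cong[where f = "insert ?p", OF insert_commute])
  have "follows ?p ?r" using follows_rim[OF rim(1), of True k] by simp
  moreover have "{?q, ?r} \<in> Edges"
    using edge_rim_spine(2)[OF rim(1) k(3,4), of True] by (simp add: insert_commute)
  moreover have "follows ?q ?r"
    using follows_rim_spine(3)[OF rim(1) k(3,4), of True] by simp
  moreover have "{?p, ?r} \<in> Edges" using rim_edge[OF rim(1), of True k] by simp
  ultimately show ?thesis
    using t follows_rim_spine(1)[OF rim(1) k(1,2), of True] edge_rim_spine(1)[OF rim(1) k(1,2), of True]
    by (intro exI[of _ ?p] exI[of _ ?q] exI[of _ ?r] conjI)
next
  case (spine g a b k)
  interpret artin_edge V E m a b using spine(2) by (rule artin_edgeI)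
  have k: "1 \<le> k" "k \<le> n - 1" using spine(3) by auto
  have t: "t = {local.spine g (k - 1), local.rim True g k, local.spine g k}"
    unfolding spine(4) rim_vertex(1) spine_vertex(1) by (rule insert_commute)
  have "{local.spine g (k - 1), local.rim True g k} \<in> Edges"
    using edge_rim_spine(2)[OF spine(1) k, of True] by (simp only: insert_commute)
  then show ?thesis
    using t follows_rim_spine(1)[OF spine(1) k, of True] follows_rim_spine(2)[OF spine(1) k]
      follows_rim_spine(3)[OF spine(1) k, of True] edge_rim_spine(1)[OF spine(1) k, of True] edge_rim_spine(3)[OF spine(1) k]
    by (intro exI[of _ "local.spine g (k - 1)"] exI[of _ "local.rim True g k"] exI[of _ "local.spine g k"] conjI)
qed

lemma Edges_follows:
  assumes e: "{x, y} \<in> Edges" shows "follows x y"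
proof -
  have swap: "follows x y" if eq: "{x, y} = {u, v}" and f: "follows u v" for u v
  proof -
    have uv: "{u, v} \<in> Edges" using eq e by simp
    from eq have "x = u \<and> y = v \<or> x = v \<and> y = u" by (simp only: doubleton_eq_iff)
    then show ?thesis using f follows_sym[OF uv f] by auto
  qed
  from e show ?thesis
  proof (cases rule: Edges_elim)
    case (cayley h s)
    show ?thesis by (rule swap[OF cayley(3)]) (use follows_cayley[OF cayley(1,2)] in \<open>simp add: gen_def\<close>)
  next
    case (triangle u v t)
    obtain p q r where t: "t = {p, q, r}" and pq: "follows p q" "follows q r" "follows p r"
      and E: "{p, q} \<in> Edges" "{q, r} \<in> Edges" "{p, r} \<in> Edges"
      using cell_triangle_follows[OF triangle(1)] by blast
    note qp = follows_sym[OF E(1) pq(1)] follows_sym[OF E(2) pq(2)] follows_sym[OF E(3) pq(3)]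
    have "follows u v" using triangle(2-4) pq qp unfolding t by auto
    then show ?thesis by (rule swap[OF triangle(5)])
  next
    case (added g a b i j j')
    interpret artin_edge V E m a b using added(2) by (rule artin_edgeI)
    have ij: "1 \<le> i" "i \<le> n - 2" "1 \<le> j" "j \<le> n - 2" "1 \<le> j'" "j' \<le> n - 2" using added(4,6) by auto
    have s: "Inner h {a, b} l = spine h l" if "1 \<le> l" "l \<le> n - 2" for h l using that by (auto simp: spine_def)
    have r: "el (rev (alt a b i)) = sir True i" by (simp add: sir_el)
    have eq: "{x, y} = {spine g j, spine (g \<cdot> inv\<^bsub>AG\<^esub> sir True i) j'}"
      unfolding added(5) r by (simp only: s[OF ij(3,4)] s[OF ij(5,6)])
    have "j' = j + i \<and> j + i \<le> n - 2 \<or> j' = j + i - 1 \<and> j + i \<le> n - 1" using added(4,6) by auto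
    then have "follows (spine g j) (spine (g \<cdot> inv\<^bsub>AG\<^esub> sir True i) j')"
      by (rule follows_added[OF added(1) ij(1,3)])
    then show ?thesis by (rule swap[OF eq])
  qed
qed

lemma canonical_base: "canonical (Elt \<one>\<^bsub>AG\<^esub>) \<simeq> [Elt \<one>\<^bsub>AG\<^esub>]"
  using eqh_sym[OF base_canonical[of "[]"]] by (simp add: el_Nil)

lemma edge_path_canonical:
  "X.edge_path vs \<Longrightarrow> hd vs = Elt \<one>\<^bsub>AG\<^esub> \<Longrightarrow> vs \<simeq> canonical (last vs)"
proof (induction vs rule: rev_induct)
  case Nil then show ?case by (simp add: X.edge_path_def)
next
  case (snoc y vs)
  show ?case
  proof (cases "vs = []")
    case True
    then show ?thesis using snoc.prems eqh_sym[OF canonical_base] by simp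
  next
    case False
    then have p: "X.edge_path vs" and e: "{last vs, y} \<in> X" and y: "y \<in> artin_vertices V E m"
      using snoc.prems(1) by (auto simp: X.edge_path_def successively_append_iff X_vertices)
    have IH: "vs @ [y] \<simeq> canonical (last vs) @ [y]"
      by (rule eqh_append) (use snoc.IH[OF p] snoc.prems(2) False in simp)
    show ?thesis
    proof (cases "y = last vs")
      case True
      obtain ys where ys: "canonical y = ys @ [y]" using canonical_end[OF y] by blast
      have "canonical (last vs) @ [y] = ys @ y # y # []" using True ys by simp
      also have "\<dots> \<simeq> ys @ y # []" using y vertex_X by (intro X.edge_homotopic.stutter) simp
      finally have "canonical (last vs) @ [y] \<simeq> canonical y" by (simp add: ys)
      then show ?thesis using eqh_trans[OF IH] by simp
    next
      case False
      then have "{last vs, y} \<in> skeleton_edges X" using e by (auto simp: skeleton_edges_def)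
      then have "{last vs, y} \<in> Edges" by (simp only: X_skeleton)
      then have "canonical (last vs) @ [y] \<simeq> canonical y" using Edges_follows unfolding follows_def by blast
      then show ?thesis using eqh_trans[OF IH] by simp
    qed
  qed
qed

lemma canonical_edge_path:
  assumes x: "x \<in> artin_vertices V E m" shows "X.edge_path (canonical x) \<and> hd (canonical x) = Elt \<one>\<^bsub>AG\<^esub> \<and> last (canonical x) = x"
proof (cases x)
  case (Elt h)
  then have h: "h \<in> carrier AG" using x by (auto simp: artin_vertices_def)
  then show ?thesis using walk_edge_path[of "\<one>\<^bsub>AG\<^esub>" "word_of h"] word_of[OF h] last_walk[of "\<one>\<^bsub>AG\<^esub>" "word_of h"] Elt by simp
next
  case (Inner h e j)
  then have h: "h \<in> carrier AG" and e: "e \<in> E" and j: "1 \<le> j" "j \<le> m e - 2" using x by (auto simp: artin_vertices_def)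
  obtain a b where eab: "e = {a, b}" using edge_obtain[OF e] by metis
  interpret artin_edge V E m a b using e eab by (intro artin_edgeI) simp
  have "X.edge_path (base (word_of h) @ map (Inner h e) [1..<Suc i]) \<and> hd (base (word_of h) @ map (Inner h e) [1..<Suc i]) = Elt \<one>\<^bsub>AG\<^esub>
      \<and> last (base (word_of h) @ map (Inner h e) [1..<Suc i]) = spine h i" if "i \<le> n - 2" for i
    using that
  proof (induction i)
    case 0
    then show ?case using walk_edge_path[of "\<one>\<^bsub>AG\<^esub>" "word_of h"] word_of[OF h] last_walk[of "\<one>\<^bsub>AG\<^esub>" "word_of h"] h
      by (simp add: spine_def)
  next
    case (Suc i)
    have s: "Inner h e (Suc i) = spine h (Suc i)" unfolding eab using Suc.prems by (auto simp: spine_def)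
    have "{spine h i, spine h (Suc i)} \<in> X" using edge_rim_spine(3)[OF h, of "Suc i"] Suc.prems by (intro edge_X) simp
    moreover have "spine h (Suc i) \<in> artin_vertices V E m" using Suc.prems spine_vertex_X h by simp
    ultimately show ?case using Suc by (simp add: X.edge_path_def successively_append_iff X_vertices s flip: append_assoc)
  qed
  from this[of j] show ?thesis using Inner j eab by (auto simp: spine_def simp del: upt_Suc)
qed

lemma rev_path_cancel:
  "X.edge_path c \<Longrightarrow> rev c @ c \<simeq> [last c]"
proof (induction c)
  case Nil then show ?case by (simp add: X.edge_path_def)
next
  case (Cons u d)
  have u: "{u} \<in> X" using Cons.prems vertex_X by (auto simp: X.edge_path_def X_vertices)
  show ?case
  proof (cases d)
    case Nil
    have "[] @ u # u # [] \<simeq> [] @ u # []" by (rule X.edge_homotopic.stutter[OF u])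
    then show ?thesis using Nil by simp
  next
    case (Cons v d')
    have p: "X.edge_path d" and e: "{u, v} \<in> X" using Cons.prems Cons by (auto simp: X.edge_path_def)
    have t: "{v, u, v} \<in> X" using e by (simp add: insert_commute)
    have "rev (u # d) @ (u # d) = rev d @ u # u # d" by simp
    also have "\<dots> \<simeq> rev d @ u # d" by (rule X.edge_homotopic.stutter[OF u])
    also have "\<dots> = rev d' @ v # u # v # d'" using Cons by simp
    also have "\<dots> \<simeq> rev d' @ v # v # d'" by (rule X.edge_homotopic.triangle[OF t])
    also have "\<dots> = rev d @ d" using Cons by simp
    also have "\<dots> \<simeq> [last d]" by (rule Cons.IH[OF p])
    finally show ?thesis using Cons by simp
  qed
qed

text \<open>The loop starts at an arbitrary vertex \<open>x\<close>. Replacing its first vertex by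
  \<open>rev c @ c\<close> makes \<open>c @ t\<close> a path from the identity to \<open>x\<close>,
  which collapses to the canonical path \<open>c\<close>.\<close>

lemma closed_path_trivial:
  assumes vs: "X.edge_path vs" "hd vs = last vs" shows "vs \<simeq> [hd vs]"
proof -
  obtain x t where xt: "vs = x # t" using vs(1) by (cases vs) (auto simp: X.edge_path_def)
  have x: "x \<in> artin_vertices V E m" using vs(1) xt by (auto simp: X.edge_path_def X_vertices)
  define c where "c = canonical x"
  have c: "X.edge_path c" "hd c = Elt \<one>\<^bsub>AG\<^esub>" "last c = x" using canonical_edge_path[OF x] by (simp_all add: c_def)
  have c0: "c \<noteq> []" using c(1) by (simp add: X.edge_path_def)
  have ct: "X.edge_path (c @ t)"
    using c vs(1) xt c0 by (auto simp: X.edge_path_def successively_append_iff successively_Cons)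
  have "last (c @ t) = x" using vs(2) xt c(3) by (cases "t = []") auto
  then have 1: "c @ t \<simeq> c" using edge_path_canonical[OF ct] c c0 by (simp add: c_def)
  have "vs = [x] @ t" using xt by simp
  also have "\<dots> \<simeq> (rev c @ c) @ t" by (rule eqh_append, rule eqh_sym) (use rev_path_cancel[OF c(1)] c(3) in simp)
  also have "\<dots> = rev c @ (c @ t) @ []" by simp
  also have "\<dots> \<simeq> rev c @ c @ []" by (rule eqh_context[OF 1])
  also have "\<dots> = rev c @ c" by simp
  also have "\<dots> \<simeq> [x]" using rev_path_cancel[OF c(1)] c(3) by simp
  finally show ?thesis using xt by simp
qed

lemma path_exists:
  assumes "u \<in> \<Union>X" "v \<in> \<Union>X" shows "\<exists>vs. X.edge_path vs \<and> hd vs = u \<and> last vs = v"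
proof -
  have u: "u \<in> artin_vertices V E m" and v: "v \<in> artin_vertices V E m" using assms X_vertices by auto
  note cu = canonical_edge_path[OF u] and cv = canonical_edge_path[OF v]
  have ne: "canonical u \<noteq> []" "canonical v \<noteq> []" using cu cv by (auto simp: X.edge_path_def)
  have "{Elt \<one>\<^bsub>AG\<^esub>} \<in> X" using vertex_X Elt_vertex by simp
  then have "X.edge_path (rev (canonical u) @ canonical v)"
    using cu cv ne by (auto simp: X.edge_path_def successively_append_iff insert_commute last_rev)
  moreover have "hd (rev (canonical u) @ canonical v) = u" "last (rev (canonical u) @ canonical v) = v"
    using cu cv ne by (simp_all add: hd_rev)
  ultimately show ?thesis by blast
qed

lemma X_simply_connected: "simply_connected_top (realization X)" "connected_space (realization X)"
  using X.simply_connected_criterion closed_path_trivial path_exists by blast+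

theorem X_systolic: "almost_large_type V E m \<Longrightarrow> systolic X"
  unfolding systolic_def X_vertices X_skeleton
  using X_simply_connected X_flag X.complex link_six_large by blast

end

section \<open>The action\<close>

lemma affine_extension_eq:
  assumes "inj_on f (support x)"
  shows "v \<in> support x \<Longrightarrow> affine_extension f x (f v) = x v"
    and "w \<notin> f ` support x \<Longrightarrow> affine_extension f x w = 0"
    and "support (affine_extension f x) = f ` support x"
proof -
  have 1: "affine_extension f x (f v) = x v" if "v \<in> support x" for v
  proof -
    have "{u. x u \<noteq> 0 \<and> f u = f v} = {v}" using assms that by (auto simp: support_def inj_on_def)
    then show ?thesis by (simp add: affine_extension_def)
  qed
  have 2: "affine_extension f x w = 0" if "w \<notin> f ` support x" for w
  proof -
    have "{u. x u \<noteq> 0 \<and> f u = w} = {}" using that by (auto simp: support_def)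
    then show ?thesis unfolding affine_extension_def by (simp only: sum.empty)
  qed
  show "v \<in> support x \<Longrightarrow> affine_extension f x (f v) = x v" by (rule 1)
  show "w \<notin> f ` support x \<Longrightarrow> affine_extension f x w = 0" by (rule 2)
  show "support (affine_extension f x) = f ` support x"
  proof
    show "support (affine_extension f x) \<subseteq> f ` support x" using 2 unfolding support_def[of "affine_extension f x"] by blast
    show "f ` support x \<subseteq> support (affine_extension f x)" using 1 by (auto simp: support_def)
  qed
qed

lemma affine_extension_closed_simplex:
  assumes x: "x \<in> closed_simplex \<sigma>" and f: "inj_on f \<sigma>"
  shows "affine_extension f x \<in> closed_simplex (f ` \<sigma>)"
proof -
  have s: "support x \<subseteq> \<sigma>" by (rule closed_simplex_support[OF x])
  then have i: "inj_on f (support x)" using f by (rule inj_on_subset[rotated])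
  have eq: "affine_extension f x (f v) = x v" if v: "v \<in> \<sigma>" for v
  proof (cases "v \<in> support x")
    case True then show ?thesis by (rule affine_extension_eq(1)[OF i])
  next
    case False
    then have "f v \<notin> f ` support x" using v s f by (auto simp: inj_on_def)
    then show ?thesis using affine_extension_eq(2)[OF i] False by (simp add: support_def)
  qed
  have "0 \<le> affine_extension f x w" for w
    unfolding affine_extension_def using x by (auto simp: closed_simplex_def intro: sum_nonneg)
  moreover have "affine_extension f x w = 0" if "w \<notin> f ` \<sigma>" for w
    using that s by (intro affine_extension_eq(2)[OF i]) blast
  moreover have "sum (affine_extension f x) (f ` \<sigma>) = 1"
    using eq x by (simp add: sum.reindex[OF f] closed_simplex_def)
  ultimately show ?thesis by (simp add: closed_simplex_def)
qed

lemma affine_extension_inverse: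
  assumes f: "inj_on f (support x)" and g: "\<And>v. v \<in> support x \<Longrightarrow> g (f v) = v"
  shows "affine_extension g (affine_extension f x) = x"
proof
  fix w
  let ?y = "affine_extension f x"
  have s: "support ?y = f ` support x" by (rule affine_extension_eq(3)[OF f])
  have i: "inj_on g (support ?y)" unfolding s by (rule inj_onI) (auto simp: g)
  show "affine_extension g ?y w = x w"
  proof (cases "w \<in> support x")
    case True
    then have "affine_extension g ?y (g (f w)) = ?y (f w)" using affine_extension_eq(1)[OF i, of "f w"] s by simp
    then show ?thesis using affine_extension_eq(1)[OF f True] g[OF True] by simp
  next
    case False
    then have "w \<notin> g ` support ?y" unfolding s using g by auto
    then show ?thesis using affine_extension_eq(2)[OF i] False by (simp add: support_def)
  qed
qed

lemma compact_closed_simplex: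
  assumes "finite \<sigma>" shows "compact (closed_simplex \<sigma>)"
proof -
  have "compactin (product_topology (\<lambda>_. euclidean) UNIV) (Pi\<^sub>E UNIV (\<lambda>_ :: 'a. {0..1::real}))"
    by (simp add: compactin_PiE)
  then have "compact (Pi\<^sub>E UNIV (\<lambda>_ :: 'a. {0..1::real}))"
    by (simp add: euclidean_product_topology)
  moreover have "closed_simplex \<sigma> \<subseteq> Pi\<^sub>E UNIV (\<lambda>_. {0..1})"
  proof
    fix x assume x: "x \<in> closed_simplex \<sigma>"
    have "x v \<le> 1" for v
    proof (cases "v \<in> \<sigma>")
      case True
      then have "x v \<le> sum x \<sigma>" using x assms by (intro member_le_sum) (auto simp: closed_simplex_def)
      then show ?thesis using x by (simp add: closed_simplex_def)
    qed (use x in \<open>simp add: closed_simplex_def\<close>)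
    then show "x \<in> Pi\<^sub>E UNIV (\<lambda>_. {0..1})" using x by (auto simp: closed_simplex_def PiE_UNIV_domain)
  qed
  then have "closed_simplex \<sigma> = Pi\<^sub>E UNIV (\<lambda>_. {0..1}) \<inter> closed_simplex \<sigma>" by blast
  ultimately show ?thesis using compact_Int_closed closed_closed_simplex[OF assms] by metis
qed

lemma (in simplicial_complex) compactin_closed_simplex:
  assumes "\<sigma> \<in> K" shows "compactin (realization K) (closed_simplex \<sigma>)"
proof -
  have c: "continuous_map (top_of_set (closed_simplex \<sigma>)) (realization K) id"
    by (rule continuous_map_into_realization[where F = "{\<sigma>}"]) (use assms simplex_finite in auto)
  have "compactin (top_of_set (closed_simplex \<sigma>)) (closed_simplex \<sigma>)"
    using compact_closed_simplex simplex_finite[OF assms] by (simp add: compactin_subtopology)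
  then show ?thesis using image_compactin[OF _ c] by fastforce
qed

context artin_graph
begin

fun elt_of :: "'s artin_vertex \<Rightarrow> 's word set" where
  "elt_of (Elt h) = h"
| "elt_of (Inner h e j) = h"

text \<open>A total version of the action: without the restriction to the vertex set, equations can
  be rewritten before membership is known.\<close>

fun translate :: "'s word set \<Rightarrow> 's artin_vertex \<Rightarrow> 's artin_vertex" where
  "translate g (Elt h) = Elt (g \<cdot> h)"
| "translate g (Inner h e j) = Inner (g \<cdot> h) e j"

lemma artin_action_translate:
  "x \<in> artin_vertices V E m \<Longrightarrow> artin_action V E m g x = translate g x"
  by (cases x) (simp_all add: artin_action_def)

lemma elt_of_closed: "x \<in> artin_vertices V E m \<Longrightarrow> elt_of x \<in> carrier AG"
  by (auto simp: artin_vertices_def)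

lemma elt_of_translate [simp]: "elt_of (translate g x) = g \<cdot> elt_of x"
  by (cases x) simp_all

lemma translate_closed:
  "g \<in> carrier AG \<Longrightarrow> x \<in> artin_vertices V E m \<Longrightarrow> translate g x \<in> artin_vertices V E m"
  by (auto simp: artin_vertices_def)

lemma translate_mult:
  "g \<in> carrier AG \<Longrightarrow> h \<in> carrier AG \<Longrightarrow> elt_of x \<in> carrier AG \<Longrightarrow>
    translate (g \<cdot> h) x = translate g (translate h x)"
  by (cases x) (simp_all add: AG.m_assoc)

lemma translate_one: "elt_of x \<in> carrier AG \<Longrightarrow> translate \<one>\<^bsub>AG\<^esub> x = x"
  by (cases x) simp_all

lemma translate_inv:
  assumes "g \<in> carrier AG" "elt_of x \<in> carrier AG"
  shows "translate (inv\<^bsub>AG\<^esub> g) (translate g x) = x" "translate g (translate (inv\<^bsub>AG\<^esub> g) x) = x"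
  using translate_mult[of "inv\<^bsub>AG\<^esub> g" g x] translate_mult[of g "inv\<^bsub>AG\<^esub> g" x] translate_one[of x] assms by simp_all

text \<open>Freeness on vertices in explicit form: the group element is computed from one vertex and
  its image.\<close>

lemma translate_determined:
  assumes "g \<in> carrier AG" "elt_of u \<in> carrier AG" "translate g u = x"
  shows "g = elt_of x \<cdot> inv\<^bsub>AG\<^esub> elt_of u"
  using assms(1,2) by (simp flip: assms(3) add: AG.m_assoc)

lemma alt_closed: "{a, b} \<in> E \<Longrightarrow> alt a b k \<in> words V"
  using edge_V[of a b]
proof (induction a b k rule: alt.induct)
  case (2 a b k)
  then have "{b, a} \<in> E" by (simp add: insert_commute)
  then show ?case using 2 by (simp add: words_Cons)
qed simp

lemma rev_alt_closed: "{a, b} \<in> E \<Longrightarrow> rev (alt a b k) \<in> words V"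
  using alt_closed[of a b k] by (simp add: words_def lists_eq_set)

lemma translate_path_vertex:
  "g \<in> carrier AG \<Longrightarrow> h \<in> carrier AG \<Longrightarrow> {a, b} \<in> E \<Longrightarrow>
    translate g (path_vertex V E m h a b k) = path_vertex V E m (g \<cdot> h) a b k"
  by (simp add: path_vertex_def AG.m_assoc alt_closed)

lemma translate_axis_vertex:
  "g \<in> carrier AG \<Longrightarrow> h \<in> carrier AG \<Longrightarrow> {a, b} \<in> E \<Longrightarrow>
    translate g (axis_vertex V E m h a b k) = axis_vertex V E m (g \<cdot> h) a b k"
  by (simp add: axis_vertex_def translate_path_vertex)

lemma translate_cell_triangle:
  assumes g: "g \<in> carrier AG" and t: "t \<in> cell_triangles V E m"
  shows "translate g ` t \<in> cell_triangles V E m"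
proof -
  from t show ?thesis
  proof (cases rule: cell_triangle_elim)
    case (rim h a b k)
    show ?thesis unfolding cell_triangles_def
      by (rule UnI1, rule CollectI, rule exI[of _ "g \<cdot> h"], rule exI[of _ a], rule exI[of _ b], rule exI[of _ k])
        (use g rim in \<open>simp add: translate_path_vertex translate_axis_vertex\<close>)
  next
    case (spine h a b k)
    show ?thesis unfolding cell_triangles_def
      by (rule UnI2, rule CollectI, rule exI[of _ "g \<cdot> h"], rule exI[of _ a], rule exI[of _ b], rule exI[of _ k])
        (use g spine in \<open>simp add: translate_path_vertex translate_axis_vertex\<close>)
  qed
qed

lemma translate_edge:
  assumes g: "g \<in> carrier AG" and e: "{x, y} \<in> Edges"
  shows "{translate g x, translate g y} \<in> Edges"
proof -
  have ne: "translate g x \<noteq> translate g y"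
    using translate_inv(1)[OF g, of x] translate_inv(1)[OF g, of y] EdgesD[OF e] elt_of_closed by metis
  have im: "{translate g x, translate g y} = translate g ` {x, y}" by simp
  from e show ?thesis
  proof (cases rule: Edges_elim)
    case (cayley h s)
    have "translate g ` {x, y} = {Elt (g \<cdot> h), Elt (g \<cdot> h \<cdot> el [(s, True)])}"
      unfolding cayley(3) using g cayley(1,2) by (simp add: AG.m_assoc words_Cons)
    then show ?thesis unfolding im triangulation_edges_def cayley_edges_def
      using AG.m_closed[OF g cayley(1)] cayley(2) by blast
  next
    case (triangle u v t)
    have "translate g x \<in> translate g ` t" "translate g y \<in> translate g ` t" using triangle by (auto simp: doubleton_eq_iff)
    then show ?thesis unfolding triangulation_edges_def using translate_cell_triangle[OF g triangle(1)] ne by blast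
  next
    case (added h a b i j j')
    have w: "el (rev (alt a b i)) \<in> carrier AG" using rev_alt_closed[OF added(2)] by simp
    have eq: "translate g ` {x, y} = {Inner (g \<cdot> h) {a, b} j, Inner (g \<cdot> h \<cdot> inv\<^bsub>AG\<^esub> el (rev (alt a b i))) {a, b} j'}"
      unfolding added(5) using g added(1) w by (simp add: AG.m_assoc)
    from added(6) have "translate g ` {x, y} \<in> added_edges V E m"
    proof
      assume j: "j' = j + i \<and> j \<in> {1..m {a, b} - 2 - i}"
      show ?thesis unfolding eq added_edges_def
        by (rule UnI1, rule CollectI, rule exI[of _ "g \<cdot> h"], rule exI[of _ a], rule exI[of _ b], rule exI[of _ i],
            rule exI[of _ j], rule exI[of _ "el (rev (alt a b i))"]) (use g added(1-4) j in simp)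
    next
      assume j: "j' = j + i - 1 \<and> j \<in> {1..m {a, b} - 1 - i}"
      show ?thesis unfolding eq added_edges_def
        by (rule UnI2, rule CollectI, rule exI[of _ "g \<cdot> h"], rule exI[of _ a], rule exI[of _ b], rule exI[of _ i],
            rule exI[of _ j], rule exI[of _ "el (rev (alt a b i))"]) (use g added(1-4) j in simp)
    qed
    then show ?thesis unfolding im by blast
  qed
qed

lemma translate_simplex:
  assumes g: "g \<in> carrier AG" and \<sigma>: "\<sigma> \<in> X" shows "translate g ` \<sigma> \<in> X"
proof -
  have s: "finite \<sigma>" "\<sigma> \<noteq> {}" "\<sigma> \<subseteq> artin_vertices V E m"
    "\<And>v w. v \<in> \<sigma> \<Longrightarrow> w \<in> \<sigma> \<Longrightarrow> v \<noteq> w \<Longrightarrow> {v, w} \<in> Edges"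
    using \<sigma> unfolding X_def flag_complex_def by blast+
  show ?thesis unfolding X_def flag_complex_def
  proof (intro CollectI conjI ballI impI)
    show "finite (translate g ` \<sigma>)" "translate g ` \<sigma> \<noteq> {}" using s by simp_all
    show "translate g ` \<sigma> \<subseteq> artin_vertices V E m" using s(3) translate_closed[OF g] by blast
    fix p q assume "p \<in> translate g ` \<sigma>" "q \<in> translate g ` \<sigma>" "p \<noteq> q"
    then obtain v w where "v \<in> \<sigma>" "w \<in> \<sigma>" "v \<noteq> w" "p = translate g v" "q = translate g w" by blast
    then show "{p, q} \<in> Edges" using translate_edge[OF g s(4)] by simp
  qed
qed

lemma action_image:
  assumes "\<sigma> \<in> X" shows "artin_action V E m g ` \<sigma> = translate g ` \<sigma>"
  using assms X_vertices artin_action_translate by (intro image_cong) auto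

lemma action_simplex: "g \<in> carrier AG \<Longrightarrow> \<sigma> \<in> X \<Longrightarrow> artin_action V E m g ` \<sigma> \<in> X"
  using action_image translate_simplex by simp

lemma action_inj: assumes "g \<in> carrier AG" shows "inj_on (artin_action V E m g) (artin_vertices V E m)"
proof (rule inj_onI)
  fix x y assume "x \<in> artin_vertices V E m" "y \<in> artin_vertices V E m" "artin_action V E m g x = artin_action V E m g y"
  then show "x = y"
    using translate_inv(1)[OF assms, of x] translate_inv(1)[OF assms, of y] artin_action_translate elt_of_closed by metis
qed

lemma action_inv:
  assumes g: "g \<in> carrier AG" and x: "x \<in> artin_vertices V E m"
  shows "artin_action V E m g (artin_action V E m (inv\<^bsub>AG\<^esub> g) x) = x"
  using translate_inv(2)[OF g elt_of_closed[OF x]] artin_action_translate translate_closed g x by simp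

lemma action_group_action: "group_action AG (\<Union>X) (artin_action V E m)"
  unfolding X_vertices
proof (intro group_action.intro group_hom.intro group_hom_axioms.intro AG_group group_BijGroup)
  let ?A = "artin_vertices V E m" and ?\<phi> = "artin_action V E m"
  have bij: "?\<phi> g \<in> Bij ?A" if g: "g \<in> carrier AG" for g
  proof -
    have "?\<phi> g ` ?A = ?A"
    proof
      show "?\<phi> g ` ?A \<subseteq> ?A" using translate_closed[OF g] artin_action_translate by auto
      show "?A \<subseteq> ?\<phi> g ` ?A"
      proof
        fix x assume x: "x \<in> ?A"
        then have "?\<phi> (inv\<^bsub>AG\<^esub> g) x \<in> ?A" using translate_closed artin_action_translate g by simp
        then show "x \<in> ?\<phi> g ` ?A" using action_inv[OF g x] by (metis image_eqI)
      qed
    qed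
    then show ?thesis using action_inj[OF g] by (simp add: Bij_def bij_betw_def artin_action_def)
  qed
  have "?\<phi> (g \<cdot> h) = compose ?A (?\<phi> g) (?\<phi> h)" if g: "g \<in> carrier AG" and h: "h \<in> carrier AG" for g h
  proof
    fix x
    show "?\<phi> (g \<cdot> h) x = compose ?A (?\<phi> g) (?\<phi> h) x"
    proof (cases "x \<in> ?A")
      case True
      then show ?thesis
        using translate_mult[OF g h elt_of_closed] translate_closed[OF h] by (simp add: compose_eq artin_action_translate)
    next
      case False then show ?thesis by (simp add: compose_def artin_action_def)
    qed
  qed
  then show "?\<phi> \<in> hom AG (BijGroup ?A)" using bij by (auto simp: hom_def BijGroup_def)
qed

lemma X_simplicial_action: "simplicial_action AG X (artin_action V E m)"
  unfolding simplicial_action_def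
proof (intro conjI ballI action_group_action)
  fix g assume g: "g \<in> carrier AG"
  let ?\<phi> = "artin_action V E m"
  show "(\<lambda>\<sigma>. ?\<phi> g ` \<sigma>) ` X = X"
  proof
    show "(\<lambda>\<sigma>. ?\<phi> g ` \<sigma>) ` X \<subseteq> X" using action_simplex[OF g] by blast
    show "X \<subseteq> (\<lambda>\<sigma>. ?\<phi> g ` \<sigma>) ` X"
    proof
      fix \<sigma> assume s: "\<sigma> \<in> X"
      then have v: "\<sigma> \<subseteq> artin_vertices V E m" using X_vertices by auto
      have "?\<phi> g ` (?\<phi> (inv\<^bsub>AG\<^esub> g) ` \<sigma>) = (\<lambda>x. x) ` \<sigma>"
        unfolding image_image using v action_inv[OF g] by (intro image_cong) auto
      then have "\<sigma> = ?\<phi> g ` (?\<phi> (inv\<^bsub>AG\<^esub> g) ` \<sigma>)" by simp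
      moreover have "?\<phi> (inv\<^bsub>AG\<^esub> g) ` \<sigma> \<in> X" using action_simplex g s by simp
      ultimately show "\<sigma> \<in> (\<lambda>\<sigma>. ?\<phi> g ` \<sigma>) ` X" by (rule image_eqI)
    qed
  qed
qed

lemma realization_support:
  assumes "x \<in> realization_points X"
  shows "support x \<in> X" "x \<in> closed_simplex (support x)" "support x \<subseteq> artin_vertices V E m" "support x \<noteq> {}"
proof -
  show 1: "support x \<in> X" and "x \<in> closed_simplex (support x)" by (rule X.realization_point[OF assms])+
  show "support x \<subseteq> artin_vertices V E m" "support x \<noteq> {}" using 1 X_vertices X.simplex_nonempty by auto
qed

text \<open>A compact set involves only finitely many vertices. If \<open>g\<close> carries one of
  its points into it, then \<open>g\<close> carries one of these vertices to another, and such a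
  pair determines \<open>g\<close>.\<close>

lemma X_proper_action: "proper_action AG X (artin_action V E m)"
  unfolding proper_action_def
proof (intro allI impI)
  fix C assume C: "compactin (realization X) C"
  let ?\<phi> = "artin_action V E m"
  define F where "F = \<Union>(support ` C)"
  have sub: "C \<subseteq> realization_points X" using compactin_subset_topspace[OF C] by (simp add: topspace_realization)
  have "finite F" unfolding F_def
    using X.compact_finite_supports[OF C] realization_support(1) sub X.simplex_finite by blast
  have "{g \<in> carrier AG. affine_extension (?\<phi> g) ` C \<inter> C \<noteq> {}}
      \<subseteq> (\<lambda>(v, w). elt_of w \<cdot> inv\<^bsub>AG\<^esub> elt_of v) ` (F \<times> F)"
  proof
    fix g assume "g \<in> {g \<in> carrier AG. affine_extension (?\<phi> g) ` C \<inter> C \<noteq> {}}"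
    then obtain x where g: "g \<in> carrier AG" and x: "x \<in> C" "affine_extension (?\<phi> g) x \<in> C" by blast
    note s = realization_support[of x]
    have xr: "x \<in> realization_points X" using x sub by blast
    obtain v where v: "v \<in> support x" using s(4)[OF xr] by blast
    then have va: "v \<in> artin_vertices V E m" using s(3)[OF xr] by blast
    have "inj_on (?\<phi> g) (support x)" using action_inj[OF g] s(3)[OF xr] by (rule inj_on_subset)
    then have "?\<phi> g v \<in> support (affine_extension (?\<phi> g) x)" using affine_extension_eq(3) v by blast
    then have "?\<phi> g v \<in> F" "v \<in> F" using x v by (auto simp: F_def)
    moreover have "g = elt_of (?\<phi> g v) \<cdot> inv\<^bsub>AG\<^esub> elt_of v"
      using translate_determined[OF g elt_of_closed[OF va]] artin_action_translate[OF va] by simp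
    ultimately show "g \<in> (\<lambda>(v, w). elt_of w \<cdot> inv\<^bsub>AG\<^esub> elt_of v) ` (F \<times> F)"
      by (intro image_eqI[of _ _ "(v, ?\<phi> g v)"]) auto
  qed
  then show "finite {g \<in> carrier AG. affine_extension (?\<phi> g) ` C \<inter> C \<noteq> {}}"
    by (rule finite_subset) (simp add: \<open>finite F\<close>)
qed

text \<open>Up to translation both ends of every edge lie in this finite set; the index ranges are
  generous so that membership is immediate.\<close>

definition near_one :: "'s artin_vertex set" where
  "near_one = insert (Elt \<one>\<^bsub>AG\<^esub>) ((\<lambda>s. Elt (el [(s, True)])) ` V) \<union>
     (\<Union>a\<in>V. \<Union>b\<in>V. \<Union>k\<le>m {a, b}.
        {path_vertex V E m \<one>\<^bsub>AG\<^esub> a b k, axis_vertex V E m \<one>\<^bsub>AG\<^esub> a b k, Inner \<one>\<^bsub>AG\<^esub> {a, b} k} \<union>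
        (\<lambda>i. Inner (inv\<^bsub>AG\<^esub> el (rev (alt a b i))) {a, b} k) ` {..m {a, b}})"

lemma finite_near_one: "finite near_one"
  unfolding near_one_def using finite_V by auto

lemma near_oneI:
  assumes "{a, b} \<in> E" "k \<le> m {a, b}"
  shows "path_vertex V E m \<one>\<^bsub>AG\<^esub> a b k \<in> near_one" "axis_vertex V E m \<one>\<^bsub>AG\<^esub> a b k \<in> near_one"
    "Inner \<one>\<^bsub>AG\<^esub> {a, b} k \<in> near_one"
    "i \<le> m {a, b} \<Longrightarrow> Inner (inv\<^bsub>AG\<^esub> el (rev (alt a b i))) {a, b} k \<in> near_one"
  using assms edge_V[OF assms(1)] unfolding near_one_def by blast+

lemma elt_of_path_axis:
  assumes "g \<in> carrier AG" "{a, b} \<in> E"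
  shows "elt_of (path_vertex V E m g a b k) \<in> carrier AG" "elt_of (axis_vertex V E m g a b k) \<in> carrier AG"
  using assms by (simp_all add: axis_vertex_def path_vertex_def alt_closed)

lemma edge_translate_near_one:
  assumes e: "{x, y} \<in> Edges"
  shows "\<exists>g\<in>carrier AG. \<exists>u\<in>near_one. \<exists>v\<in>near_one.
    elt_of u \<in> carrier AG \<and> x = translate g u \<and> y = translate g v"
proof -
  have pair: "\<exists>g\<in>carrier AG. \<exists>u\<in>near_one. \<exists>v\<in>near_one. elt_of u \<in> carrier AG \<and> x = translate g u \<and> y = translate g v"
    if h: "h \<in> carrier AG" and S: "S \<subseteq> near_one" "\<forall>u\<in>S. elt_of u \<in> carrier AG" "{x, y} \<subseteq> translate h ` S" for h S
  proof -
    have "x \<in> translate h ` S" "y \<in> translate h ` S" using S(3) by simp_all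
    then obtain u v where uv: "u \<in> S" "v \<in> S" "x = translate h u" "y = translate h v" by (elim imageE)
    have "u \<in> near_one" "v \<in> near_one" "elt_of u \<in> carrier AG" using S(1,2) uv(1,2) by auto
    then show ?thesis
      by (intro bexI[of _ h] bexI[of _ u] bexI[of _ v] conjI) (rule uv h | assumption)+
  qed
  from e show ?thesis
  proof (cases rule: Edges_elim)
    case (cayley h s)
    show ?thesis
      by (rule pair[OF cayley(1), of "{Elt \<one>\<^bsub>AG\<^esub>, Elt (el [(s, True)])}"]) (use cayley in \<open>auto simp: near_one_def words_Cons\<close>)
  next
    case (triangle u v t)
    then have xy: "{x, y} \<subseteq> t" by simp
    from triangle(1) show ?thesis
    proof (cases rule: cell_triangle_elim)
      case (rim h a b k)
      have k: "k \<le> m {a, b}" "k + 1 \<le> m {a, b}" using rim(3) by auto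
      show ?thesis
        by (rule pair[OF rim(1), of "{path_vertex V E m \<one>\<^bsub>AG\<^esub> a b k, path_vertex V E m \<one>\<^bsub>AG\<^esub> a b (k + 1), axis_vertex V E m \<one>\<^bsub>AG\<^esub> a b k}"])
          (use xy rim(1,2,4) near_oneI[OF rim(2) k(1)] near_oneI[OF rim(2) k(2)] elt_of_path_axis[OF _ rim(2)] in
            \<open>simp_all add: translate_path_vertex translate_axis_vertex\<close>)
    next
      case (spine h a b k)
      have k: "k \<le> m {a, b}" "k - 1 \<le> m {a, b}" using spine(3) by auto
      show ?thesis
        by (rule pair[OF spine(1), of "{path_vertex V E m \<one>\<^bsub>AG\<^esub> a b k, axis_vertex V E m \<one>\<^bsub>AG\<^esub> a b (k - 1), axis_vertex V E m \<one>\<^bsub>AG\<^esub> a b k}"])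
          (use xy spine(1,2,4) near_oneI[OF spine(2) k(1)] near_oneI[OF spine(2) k(2)] elt_of_path_axis[OF _ spine(2)] in
            \<open>simp_all add: translate_path_vertex translate_axis_vertex\<close>)
    qed
  next
    case (added h a b i j j')
    have w: "el (rev (alt a b i)) \<in> carrier AG" using rev_alt_closed[OF added(2)] by simp
    have k: "j \<le> m {a, b}" "j' \<le> m {a, b}" "i \<le> m {a, b}" using added(4,6) by auto
    show ?thesis
      by (rule pair[OF added(1), of "{Inner \<one>\<^bsub>AG\<^esub> {a, b} j, Inner (inv\<^bsub>AG\<^esub> el (rev (alt a b i))) {a, b} j'}"])
        (use added(1,5) w near_oneI[OF added(2) k(1)] near_oneI(4)[OF added(2) k(2,3)] in simp_all)
  qed
qed

lemma finite_neighbours: "finite {y. {x, y} \<in> Edges}"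
proof -
  have "{y. {x, y} \<in> Edges} \<subseteq> (\<lambda>(u, v). translate (elt_of x \<cdot> inv\<^bsub>AG\<^esub> elt_of u) v) ` (near_one \<times> near_one)"
  proof
    fix y assume "y \<in> {y. {x, y} \<in> Edges}"
    then obtain g u v where "g \<in> carrier AG" "u \<in> near_one" "v \<in> near_one"
      "elt_of u \<in> carrier AG" "x = translate g u" "y = translate g v"
      using edge_translate_near_one by blast
    then show "y \<in> (\<lambda>(u, v). translate (elt_of x \<cdot> inv\<^bsub>AG\<^esub> elt_of u) v) ` (near_one \<times> near_one)"
      using translate_determined[of g u x] by (intro image_eqI[of _ _ "(u, v)"]) auto
  qed
  then show ?thesis by (rule finite_subset) (simp add: finite_near_one)
qed

definition representatives :: "'s artin_vertex set" where
  "representatives = insert (Elt \<one>\<^bsub>AG\<^esub>) (\<Union>e\<in>E. Inner \<one>\<^bsub>AG\<^esub> e ` {1..m e - 2})"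

lemma finite_representatives: "finite representatives"
proof -
  have "E \<subseteq> Pow V" using defining_graph by (auto simp: defining_graph_def simple_graph_def)
  then have "finite E" using finite_V by (simp add: finite_subset)
  then show ?thesis by (simp add: representatives_def)
qed

lemma translate_representatives:
  assumes "x \<in> artin_vertices V E m" shows "translate (inv\<^bsub>AG\<^esub> elt_of x) x \<in> representatives"
proof (cases x)
  case (Elt h)
  then show ?thesis using elt_of_closed[OF assms] by (simp add: representatives_def)
next
  case (Inner h e j)
  then have "e \<in> E" "j \<in> {1..m e - 2}" using assms by (auto simp: artin_vertices_def)
  then have "Inner \<one>\<^bsub>AG\<^esub> e j \<in> representatives" unfolding representatives_def by blast
  then show ?thesis using elt_of_closed[OF assms] Inner by simp
qed

lemma finite_star: assumes "finite F" shows "finite {\<sigma> \<in> X. \<sigma> \<inter> F \<noteq> {}}"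
proof -
  have "{\<sigma> \<in> X. \<sigma> \<inter> F \<noteq> {}} \<subseteq> Pow (F \<union> (\<Union>x\<in>F. {y. {x, y} \<in> Edges}))"
  proof (intro subsetI PowI)
    fix \<sigma> y assume "\<sigma> \<in> {\<sigma> \<in> X. \<sigma> \<inter> F \<noteq> {}}" and y: "y \<in> \<sigma>"
    then obtain x where s: "\<sigma> \<in> X" and x: "x \<in> \<sigma>" "x \<in> F" by blast
    show "y \<in> F \<union> (\<Union>x\<in>F. {y. {x, y} \<in> Edges})"
    proof (cases "x = y")
      case False
      then have "{x, y} \<in> Edges" using s x(1) y unfolding X_def flag_complex_def by blast
      then show ?thesis by (rule UnI2[OF UN_I[OF x(2) CollectI]])
    qed (use x in simp)
  qed
  moreover have "finite (F \<union> (\<Union>x\<in>F. {y. {x, y} \<in> Edges}))"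
    by (rule finite_UnI[OF assms finite_UN_I[OF assms finite_neighbours]])
  ultimately show ?thesis by (meson finite_Pow_iff finite_subset)
qed

text \<open>By local finiteness only finitely many simplices meet the representatives, so their
  union is compact. A point is moved into it by the translation taking one vertex of its support to
  its representative.\<close>

lemma X_cocompact_action: "cocompact_action AG X (artin_action V E m)"
proof -
  let ?\<phi> = "artin_action V E m"
  define S where "S = {\<sigma> \<in> X. \<sigma> \<inter> representatives \<noteq> {}}"
  define C where "C = \<Union>(closed_simplex ` S)"
  have "compactin (realization X) C" unfolding C_def
    by (rule compactin_Union) (use finite_star[OF finite_representatives] X.compactin_closed_simplex in \<open>auto simp: S_def\<close>)
  moreover have "(\<Union>g\<in>carrier AG. affine_extension (?\<phi> g) ` C) = realization_points X"
  proof
    show "(\<Union>g\<in>carrier AG. affine_extension (?\<phi> g) ` C) \<subseteq> realization_points X"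
    proof clarify
      fix g x assume g: "g \<in> carrier AG" and "x \<in> C"
      then obtain \<sigma> where s: "\<sigma> \<in> X" "x \<in> closed_simplex \<sigma>" by (auto simp: C_def S_def)
      have "inj_on (?\<phi> g) \<sigma>" using action_inj[OF g] s(1) X_vertices by (metis Union_upper inj_on_subset)
      then have "affine_extension (?\<phi> g) x \<in> closed_simplex (?\<phi> g ` \<sigma>)"
        using s(2) by (intro affine_extension_closed_simplex)
      then show "affine_extension (?\<phi> g) x \<in> realization_points X"
        using action_simplex[OF g s(1)] by (auto simp: realization_points_def)
    qed
    show "realization_points X \<subseteq> (\<Union>g\<in>carrier AG. affine_extension (?\<phi> g) ` C)"
    proof
      fix x assume x: "x \<in> realization_points X"
      note s = realization_support[OF x]
      obtain v where v: "v \<in> support x" using s(4) by blast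
      then have va: "v \<in> artin_vertices V E m" using s(3) by blast
      define g where "g = elt_of v"
      have g: "g \<in> carrier AG" using elt_of_closed[OF va] by (simp add: g_def)
      then have gi: "inv\<^bsub>AG\<^esub> g \<in> carrier AG" by simp
      let ?y = "affine_extension (?\<phi> (inv\<^bsub>AG\<^esub> g)) x"
      have i: "inj_on (?\<phi> (inv\<^bsub>AG\<^esub> g)) (support x)" using action_inj[OF gi] s(3) by (rule inj_on_subset)
      have "?y \<in> closed_simplex (?\<phi> (inv\<^bsub>AG\<^esub> g) ` support x)" by (rule affine_extension_closed_simplex[OF s(2) i])
      moreover have "?\<phi> (inv\<^bsub>AG\<^esub> g) v \<in> representatives"
        using translate_representatives[OF va] artin_action_translate[OF va] by (simp add: g_def)
      then have "?\<phi> (inv\<^bsub>AG\<^esub> g) ` support x \<in> S" using action_simplex[OF gi s(1)] v by (auto simp: S_def)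
      ultimately have "?y \<in> C" by (auto simp: C_def)
      moreover have "affine_extension (?\<phi> g) ?y = x"
        by (rule affine_extension_inverse[OF i]) (use action_inv[OF g] s(3) in blast)
      ultimately show "x \<in> (\<Union>g\<in>carrier AG. affine_extension (?\<phi> g) ` C)" using g by (metis UN_I image_eqI)
    qed
  qed
  ultimately show ?thesis unfolding cocompact_action_def topspace_realization by blast
qed

end

theorem theorem5p8:
  fixes V :: "'s set" and E :: "'s set set" and m :: "'s set \<Rightarrow> nat"
  assumes "defining_graph V E m"
    and "almost_large_type V E m"
  shows "systolic (artin_complex V E m) \<and>
    simplicial_action (artin_group V E m) (artin_complex V E m) (artin_action V E m) \<and>
    proper_action (artin_group V E m) (artin_complex V E m) (artin_action V E m) \<and>
    cocompact_action (artin_group V E m) (artin_complex V E m) (artin_action V E m)"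
proof -
  interpret artin_graph V E m using assms(1) by (rule artin_graph.intro)
  show ?thesis
    using X_systolic[OF assms(2)] X_simplicial_action X_proper_action X_cocompact_action by blast
qed

end
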